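(* Let $N\in(\mathbb{N}^* )^m$, $I\subseteq\{1,\dots,m\}$, and let $A\subseteq F_I(\Gamma^m)$ be a largely continuous precell mod $N$. Then there exists a complex $\mathcal{C}$ of monohedral largely continuous precells mod $N$ such that $A=\bigcup\mathcal{C}$.
   Context: Let $\mathcal{Z}$ be a $\mathbb{Z}$-group (linearly ordered abelian group with smallest positive element $1$ and $|\mathcal{Z}/n\mathcal{Z}|=n$ for all $n\geq1$), $\mathcal{Q}$ its divisible hull ($\mathbb{Q}\subseteq\mathcal{Q}$), $\Gamma=\mathcal{Z}\cup\{+\infty\}$, $\Omega=\mathcal{Q}\cup\{+\infty\}$, $+\infty$ maximal and absorbing for $+$. Topology on $\Omega$ generated by open intervals and $]a,+\infty]$ ($a\in\mathcal{Q}$); product topology on $\Omega^m$, induced on $\Gamma^m$; $\overline A$ = closure in $\Omega^m$. $\mathrm{Supp}\,a=\{i:a_i\neq+\infty\}$, $F_I(\Gamma^m)=\{a\in\Gamma^m:\mathrm{Supp}\,a=I\}$, $F_I(A)=\{a\in\overline A:\mathrm{Supp}\,a=I\}$ (a face of $A$ when nonempty). Specialisation: $B\leq A$ iff $B\subseteq\overline A$; $A$ is monohedral if its faces are linearly ordered by specialisation. Socle: $\widehat a=(a_1,\dots,a_{m-1})$, $\widehat A$ its image, $\widehat N=(N_1,\dots,N_{m-1})$. Congruence: $a\equiv b\,[n]$ iff $a-b\in n\mathcal{Z}$, and $a\equiv+\infty\,[n]$ always. For $A\subseteq F_I(\Gamma^m)$, $f:A\to\Omega$ is affine if constantly $+\infty$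 or $f(a)=\alpha_0+\sum_{i\in I}\alpha_ia_i$ with $\alpha_0\in\mathcal{Q}$, $\alpha_i\in\mathbb{Q}$; largely continuous if it extends continuously to $\overline A$. Precells mod $N\in(\mathbb{N}^* )^m$: for $m=0$, $\Gamma^0$ is the only one. For $m\geq1$, $A\subseteq F_I(\Gamma^m)$ is a largely continuous precell mod $N$ if $\widehat A$ is a largely continuous precell mod $\widehat N$ and there are non-negative, largely continuous affine maps $\mu,\nu:\widehat A\to\Omega$ and an integer $0\leq\rho<N_m$ with $A=\{a\in F_I(\Gamma^m):\widehat a\in\widehat A,\ \mu(\widehat a)\leq a_m\leq\nu(\widehat a),\ a_m\equiv\rho\,[N_m]\}$. A complex is a finite family of pairwise disjoint subsets of $\Gamma^m$ such that for any two members $A,B$, $\overline A\cap\overline B$ is the union of the common faces of $A$ and $B$. *)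

theory Defs
  imports Main "HOL.Rat"
begin

section \<open>Ambient divisible hull Q (a type 'a) and the Z-group Z (a subset with least positive element e)\<close>

definition nmul :: "nat \<Rightarrow> 'a::ab_group_add \<Rightarrow> 'a" where
  "nmul n x = (\<Sum>i<n. x)"

definition imul :: "int \<Rightarrow> 'a::ab_group_add \<Rightarrow> 'a" where
  "imul k x = (if 0 \<le> k then nmul (nat k) x else - nmul (nat (- k)) x)"

text \<open>Multiplication of an element of the divisible (torsion-free) group by a rational p/q.\<close>
definition qmul :: "rat \<Rightarrow> 'a::ab_group_add \<Rightarrow> 'a" where
  "qmul r x = (THE y. imul (snd (quotient_of r)) y = imul (fst (quotient_of r)) x)"

text \<open>Z is a Z-group with least positive element e, and UNIV :: 'a is its divisible hull.\<close>
definition zgroup :: "'a::linordered_ab_group_add set \<Rightarrow> 'a \<Rightarrow> bool" where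
  "zgroup Z e \<longleftrightarrow>
     0 \<in> Z \<and> (\<forall>x\<in>Z. \<forall>y\<in>Z. x + y \<in> Z \<and> - x \<in> Z) \<and>
     e \<in> Z \<and> 0 < e \<and> (\<forall>z\<in>Z. 0 < z \<longrightarrow> e \<le> z) \<and>
     (\<forall>n::nat. 1 \<le> n \<longrightarrow>
        card {{w \<in> Z. w - z \<in> nmul n ` Z} | z. z \<in> Z} = n) \<and>
     (\<forall>x::'a. \<forall>n::nat. 0 < n \<longrightarrow> (\<exists>y. nmul n y = x)) \<and>
     (\<forall>x::'a. \<exists>n::nat. 0 < n \<and> nmul n x \<in> Z)"

datatype 'a ext = Fin 'a | PInf

fun ext_le :: "'a::linorder ext \<Rightarrow> 'a ext \<Rightarrow> bool" where
  "ext_le _ PInf = True"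
| "ext_le PInf (Fin _) = False"
| "ext_le (Fin x) (Fin y) = (x \<le> y)"

fun ext_less :: "'a::linorder ext \<Rightarrow> 'a ext \<Rightarrow> bool" where
  "ext_less PInf _ = False"
| "ext_less (Fin _) PInf = True"
| "ext_less (Fin x) (Fin y) = (x < y)"

fun fin_val :: "'a::zero ext \<Rightarrow> 'a" where
  "fin_val (Fin x) = x"
| "fin_val PInf = 0"

text \<open>Points of Omega^m are lists of length m; coordinates are indexed 0..m-1.\<close>

definition Gam :: "'a set \<Rightarrow> nat \<Rightarrow> 'a ext list set" where
  "Gam Z m = {a. length a = m \<and> (\<forall>i<m. a ! i = PInf \<or> (\<exists>z\<in>Z. a ! i = Fin z))}"

definition supp :: "'a ext list \<Rightarrow> nat set" where
  "supp a = {i. i < length a \<and> a ! i \<noteq> PInf}"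

definition FI :: "'a set \<Rightarrow> nat \<Rightarrow> nat set \<Rightarrow> 'a ext list set" where
  "FI Z m I = {a \<in> Gam Z m. supp a = I}"

definition basic_nbhd :: "'a::linorder ext \<Rightarrow> 'a ext set set" where
  "basic_nbhd x = {U. x \<in> U \<and>
     ((\<exists>a b. U = {y. ext_less (Fin a) y \<and> ext_less y (Fin b)}) \<or>
      (\<exists>a. U = {y. ext_less (Fin a) y}))}"

definition clos :: "nat \<Rightarrow> 'a::linorder ext list set \<Rightarrow> 'a ext list set" where
  "clos m A = {x. length x = m \<and>
     (\<forall>U. (\<forall>i<m. U i \<in> basic_nbhd (x ! i)) \<longrightarrow> (\<exists>a\<in>A. \<forall>i<m. a ! i \<in> U i))}"

definition cont_on :: "nat \<Rightarrow> 'a::linorder ext list set \<Rightarrow> ('a ext list \<Rightarrow> 'a ext) \<Rightarrow> bool" where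
  "cont_on m S g \<longleftrightarrow> (\<forall>x\<in>S. \<forall>V\<in>basic_nbhd (g x). \<exists>U. (\<forall>i<m. U i \<in> basic_nbhd (x ! i)) \<and>
       (\<forall>y\<in>S. (\<forall>i<m. y ! i \<in> U i) \<longrightarrow> g y \<in> V))"

definition largely_continuous :: "nat \<Rightarrow> 'a::linorder ext list set \<Rightarrow> ('a ext list \<Rightarrow> 'a ext) \<Rightarrow> bool" where
  "largely_continuous m A f \<longleftrightarrow> (\<exists>g. (\<forall>a\<in>A. g a = f a) \<and> cont_on m (clos m A) g)"

definition affine_map :: "nat set \<Rightarrow> 'a::linordered_ab_group_add ext list set \<Rightarrow> ('a ext list \<Rightarrow> 'a ext) \<Rightarrow> bool" where
  "affine_map I A f \<longleftrightarrow> (\<forall>a\<in>A. f a = PInf) \<or>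
     (\<exists>(\<alpha>0::'a) (\<alpha>::nat \<Rightarrow> rat). \<forall>a\<in>A. f a = Fin (\<alpha>0 + (\<Sum>i\<in>I. qmul (\<alpha> i) (fin_val (a ! i)))))"

definition nonneg_map :: "'a::linordered_ab_group_add ext list set \<Rightarrow> ('a ext list \<Rightarrow> 'a ext) \<Rightarrow> bool" where
  "nonneg_map A f \<longleftrightarrow> (\<forall>a\<in>A. ext_le (Fin 0) (f a))"

definition cong_ext :: "'a::linordered_ab_group_add set \<Rightarrow> 'a \<Rightarrow> 'a ext \<Rightarrow> nat \<Rightarrow> nat \<Rightarrow> bool" where
  "cong_ext Z e x \<rho> n \<longleftrightarrow> x = PInf \<or> (\<exists>q. x = Fin q \<and> q - nmul \<rho> e \<in> nmul n ` Z)"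

fun precell_rec :: "'a::linordered_ab_group_add set \<Rightarrow> 'a \<Rightarrow> nat \<Rightarrow> nat list \<Rightarrow> nat set \<Rightarrow> 'a ext list set \<Rightarrow> bool" where
  "precell_rec Z e 0 N I A \<longleftrightarrow> N = [] \<and> I = {} \<and> A = {[]}"
| "precell_rec Z e (Suc k) N I A \<longleftrightarrow> length N = Suc k \<and> I \<subseteq> {..k} \<and>
     precell_rec Z e k (butlast N) (I - {k}) (butlast ` A) \<and>
     (\<exists>\<mu> \<nu> (\<rho>::nat).
        affine_map (I - {k}) (butlast ` A) \<mu> \<and> nonneg_map (butlast ` A) \<mu> \<and>
          largely_continuous k (butlast ` A) \<mu> \<and>
        affine_map (I - {k}) (butlast ` A) \<nu> \<and> nonneg_map (butlast ` A) \<nu> \<and>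
          largely_continuous k (butlast ` A) \<nu> \<and>
        \<rho> < last N \<and>
        A = {a \<in> FI Z (Suc k) I. butlast a \<in> butlast ` A \<and>
               ext_le (\<mu> (butlast a)) (last a) \<and> ext_le (last a) (\<nu> (butlast a)) \<and>
               cong_ext Z e (last a) \<rho> (last N)})"

definition precell :: "'a::linordered_ab_group_add set \<Rightarrow> 'a \<Rightarrow> nat list \<Rightarrow> nat set \<Rightarrow> 'a ext list set \<Rightarrow> bool" where
  "precell Z e N I A = precell_rec Z e (length N) N I A"

definition face :: "nat \<Rightarrow> nat set \<Rightarrow> 'a::linorder ext list set \<Rightarrow> 'a ext list set" where
  "face m J A = {a \<in> clos m A. supp a = J}"

definition faces :: "nat \<Rightarrow> 'a::linorder ext list set \<Rightarrow> 'a ext list set set" where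
  "faces m A = {F. \<exists>J. F = face m J A \<and> F \<noteq> {}}"

definition monohedral :: "nat \<Rightarrow> 'a::linorder ext list set \<Rightarrow> bool" where
  "monohedral m A \<longleftrightarrow> (\<forall>B\<in>faces m A. \<forall>B'\<in>faces m A. B \<subseteq> clos m B' \<or> B' \<subseteq> clos m B)"

definition complex :: "'a set \<Rightarrow> nat \<Rightarrow> 'a::linorder ext list set set \<Rightarrow> bool" where
  "complex Z m C \<longleftrightarrow> finite C \<and> (\<forall>A\<in>C. A \<subseteq> Gam Z m) \<and>
     (\<forall>A\<in>C. \<forall>B\<in>C. A \<noteq> B \<longrightarrow> A \<inter> B = {}) \<and>
     (\<forall>A\<in>C. \<forall>B\<in>C. clos m A \<inter> clos m B = \<Union>(faces m A \<inter> faces m B))"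

end

theory Submission
  imports Defs "HOL.Modules"
begin

text \<open>The idea is to separate scales. A face of a precell with support \<open>J\<close> is its projection to the 
  coordinates in \<open>J\<close>, and it is nonempty exactly if some integral recession vector has support 
  \<open>I - J\<close>. Call a piece separated if its coordinates, together with a large constant \<open>c\<close>, are grouped
  into blocks such that coordinates in the same block are comparable up to a factor \<open>l\<close> whereas 
  different blocks are far apart in comparison with \<open>l\<close>. Then a recession vector is unbounded on all 
  blocks from some block onwards, so the supports of the faces form a chain and the piece is monohedral.

  Separated pieces are built by induction on the number of coordinates. By a Farkas lemma and large
  continuity, the bounds \<open>\<mu>\<close> and \<open>\<nu>\<close> of the last coordinate \<open>z\<close> are comparable with blocks of each 
  separated piece of the socle. Cutting the fibres \<open>[\<mu>, \<nu>]\<close> slightly below and above each block gives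
  slices which are long enough to meet every residue class, so each slice has full projection and the 
  modulus \<open>N\<close> is preserved. The cuts near a face only involve the blocks which are finite on that
  face, so that slices over different pieces fit together to a complex.\<close>

section \<open>Multiplication by natural and rational numbers\<close>

text \<open>The obstacle is that the socle of a precell is its actual projection: a piece may have
  no empty fibre over its base, although its congruences are fixed in advance. Arbitrary cuts are
  thus excluded; a cut is admissible only if it leaves a margin of at least \<open>nmul n e\<close>
  uniformly over the base. Adding a coordinate spoils separation: if it joins a block, the factor
  \<open>l\<close> of that block grows to \<open>l * cut M K l\<close>. Separation is therefore
  asked for an arbitrary growth function \<open>M\<close> of the factors, not for a fixed ratio. To
  obtain \<open>M\<close> after adding a coordinate, the socle is decomposed for the larger function
  \<open>gap M K\<close>. Here \<open>K\<close> only measures how the two bounds compare with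
  coordinates of the socle, so it does not depend on \<open>M\<close>. The constant \<open>c\<close>
  is shared by all levels of the induction, so its threshold has to be found before \<open>M\<close>
  is known. Moreover \<open>Z\<close> need not be archimedean. Recession vectors have natural
  entries, but the step along them runs through all non-negative elements of
  \<open>Z\<close>.\<close>

lemma nmul_0 [simp]: "nmul 0 x = 0" and nmul_Suc: "nmul (Suc n) x = x + nmul n x"
  by (simp_all add: nmul_def add.commute)

lemma nmul_1 [simp]: "nmul 1 x = x" "nmul (Suc 0) x = x"
  by (simp_all add: nmul_def)

lemma nmul_zero [simp]: "nmul n 0 = 0"
  by (simp add: nmul_def)

lemma nmul_add: "nmul (m + n) x = nmul m x + nmul n x"
  by (induction m) (simp_all add: nmul_Suc add.assoc)

lemma nmul_add_right: "nmul n (x + y) = nmul n x + nmul n y"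
  by (simp add: nmul_def sum.distrib)

lemma nmul_diff_right: "nmul n (x - y) = nmul n x - nmul n y"
  by (simp add: nmul_def sum_subtractf)

lemma nmul_mult: "nmul (m * n) x = nmul m (nmul n x)"
  by (induction m) (simp_all add: nmul_Suc nmul_add)

lemma nmul_mono: 
  fixes x y :: "'a::linordered_ab_group_add" 
  shows "x \<le> y \<Longrightarrow> nmul n x \<le> nmul n y"
  by (simp add: nmul_def sum_mono)

lemma nmul_strict_mono:
  fixes x y :: "'a::linordered_ab_group_add" 
  assumes "x < y" "0 < n" shows "nmul n x < nmul n y"
  using assms(2)
proof (induction n)
  case (Suc n)
  then show ?case using assms(1) nmul_mono[of x y n]
    by (simp add: nmul_Suc add_less_le_mono)
qed simp

lemma nmul_le_iff:
  fixes x y :: "'a::linordered_ab_group_add" 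
  assumes "0 < n" shows "nmul n x \<le> nmul n y \<longleftrightarrow> x \<le> y"
  using nmul_mono nmul_strict_mono[OF _ assms] by (metis not_le)

lemma nmul_eq_iff:
  fixes x y :: "'a::linordered_ab_group_add" 
  assumes "0 < n" shows "nmul n x = nmul n y \<longleftrightarrow> x = y"
  using nmul_le_iff[OF assms] by (metis order.antisym order.refl)

lemma nmul_less_iff:
  fixes x y :: "'a::linordered_ab_group_add" 
  assumes "0 < n" shows "nmul n x < nmul n y \<longleftrightarrow> x < y"
  using nmul_le_iff[OF assms] by (metis not_le)

lemma nmul_nonneg: 
  fixes x :: "'a::linordered_ab_group_add" 
  shows "0 \<le> x \<Longrightarrow> 0 \<le> nmul n x"
  using nmul_mono[of 0 x n] by simp

lemma nmul_mono_left:
  fixes x :: "'a::linordered_ab_group_add" 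
  assumes "m \<le> n" "0 \<le> x" shows "nmul m x \<le> nmul n x"
proof -
  obtain d where "n = m + d" using assms(1) le_Suc_ex by blast
  then show ?thesis using nmul_nonneg[OF assms(2)] by (simp add: nmul_add)
qed

lemma le_nmul:
  fixes x :: "'a::linordered_ab_group_add" 
  assumes "1 \<le> n" "0 \<le> x" shows "x \<le> nmul n x"
  using nmul_mono_left[OF assms] by simp

text \<open>Differences of naturals represent integers without a case distinction on the sign; most
  laws for \<open>imul\<close> below are reduced to this form.\<close>

lemma imul_diff: "imul (int m - int n) x = nmul m x - nmul n x"
proof (cases "n \<le> m")
  case True
  then obtain d where "m = n + d" using le_Suc_ex by blast
  then show ?thesis by (simp add: imul_def nmul_add)
next
  case False
  then obtain d where "n = m + d" using le_Suc_ex nat_le_linear by metis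
  then show ?thesis by (auto simp: imul_def nmul_add)
qed

lemma imul_of_nat: "imul (int n) x = nmul n x"
  using imul_diff[of n 0 x] by simp

lemma imul_add: "imul (a + b) x = imul a x + imul b x"
proof -
  obtain m n where a: "a = int m - int n" using int_diff_cases by blast
  obtain m' n' where b: "b = int m' - int n'" using int_diff_cases by blast
  have "a + b = int (m + m') - int (n + n')" by (simp add: a b)
  then show ?thesis unfolding a b by (simp only: imul_diff nmul_add) (simp add: algebra_simps)
qed

lemma imul_add_right: "imul a (x + y) = imul a x + imul a y"
  by (simp add: imul_def nmul_add_right)

lemma nmul_imul: "nmul n (imul a x) = imul (int n * a) x"
proof -
  obtain p q where a: "a = int p - int q" using int_diff_cases by blast
  have "int n * a = int (n * p) - int (n * q)" by (simp add: a right_diff_distrib)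
  then show ?thesis unfolding a by (simp only: imul_diff nmul_mult nmul_diff_right)
qed

lemma nmul_commute: "nmul m (nmul n x) = nmul n (nmul m x)"
  by (metis nmul_mult mult.commute)

lemma imul_nmul: "imul a (nmul n x) = imul (int n * a) x"
proof -
  obtain p q where a: "a = int p - int q" using int_diff_cases by blast
  have "int n * a = int (n * p) - int (n * q)" by (simp add: a right_diff_distrib)
  then show ?thesis unfolding a by (simp only: imul_diff nmul_mult nmul_diff_right nmul_commute)
qed

section \<open>Arithmetic of a Z-group inside its divisible hull\<close>

locale zgroup_hull =
  fixes Z :: "'a::linordered_ab_group_add set" and e :: 'a
  assumes zgroup: "zgroup Z e"
begin

lemma Z_zero [simp]: "0 \<in> Z" and Z_add: "x \<in> Z \<Longrightarrow> y \<in> Z \<Longrightarrow> x + y \<in> Z"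
  and Z_minus: "x \<in> Z \<Longrightarrow> - x \<in> Z" and Z_e [simp]: "e \<in> Z" and e_pos: "0 < e"
  and e_least: "z \<in> Z \<Longrightarrow> 0 < z \<Longrightarrow> e \<le> z"
  and card_quotient: "1 \<le> n \<Longrightarrow> card {{w \<in> Z. w - z \<in> nmul n ` Z} | z. z \<in> Z} = n"
  and divisible: "0 < n \<Longrightarrow> \<exists>y. nmul n y = x"
  and torsion: "\<exists>n. 0 < n \<and> nmul n x \<in> Z"
  using zgroup[unfolded zgroup_def] by (elim conjE; blast)+

lemma Z_diff: "x \<in> Z \<Longrightarrow> y \<in> Z \<Longrightarrow> x - y \<in> Z"
  using Z_add[of x "- y"] Z_minus by simp

lemma Z_nmul: "x \<in> Z \<Longrightarrow> nmul n x \<in> Z"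
  by (induction n) (simp_all add: nmul_Suc Z_add)

lemma Z_less_imp_le: "x \<in> Z \<Longrightarrow> y \<in> Z \<Longrightarrow> x < y \<Longrightarrow> x + e \<le> y"
  using e_least[of "y - x"] Z_diff[of y x] by (simp add: algebra_simps)

text \<open>The hull is torsion modulo \<open>Z\<close>, and multiplying a non-negative element by a
  positive natural does not decrease it. Cofinality allows limits to be tested along parameters in
  \<open>Z\<close>.\<close>

lemma cofinal: "\<exists>z\<in>Z. x \<le> z \<and> 0 \<le> z"
proof (cases "0 \<le> x")
  case True
  obtain n where n: "0 < n" "nmul n x \<in> Z" using torsion by blast
  then have "x \<le> nmul n x" using le_nmul[of n x] True by simp
  then show ?thesis using n True by (meson order.trans)
next
  case False
  then show ?thesis by (intro bexI[of _ 0]) auto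
qed

text \<open>\<open>qmul\<close> is defined from the reduced fraction. As the hull is torsion-free,
  every other fraction for \<open>r\<close> yields the same element, so the module laws can be
  checked with a common denominator.\<close>

lemma qmul_eqI:
  fixes x y :: 'a
  assumes "0 < d" "nmul d y = imul a x" "r = of_int a / of_nat d"
  shows "qmul r x = y"
proof -
  obtain p q where pq: "quotient_of r = (p, q)" by (cases "quotient_of r")
  have q: "0 < q" using quotient_of_denom_pos[OF pq] .
  have "r = of_int p / of_int q" using quotient_of_div[OF pq] .
  then have "(of_int (p * int d) :: rat) = of_int (a * q)" 
    using q assms(1,3) by (simp add: field_simps)
  then have eq: "p * int d = a * q" using of_int_eq_iff by blast
  obtain n where n: "q = int n" "0 < n" using q by (metis zero_less_imp_eq_int)
  have "nmul d (nmul n y) = nmul n (imul a x)" by (simp add: nmul_commute[of d n] assms(2))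
  also have "\<dots> = imul (int d * p) x" using eq n by (metis nmul_imul mult.commute)
  also have "\<dots> = nmul d (imul p x)" by (simp add: nmul_imul)
  finally have y: "nmul n y = imul p x" by (rule nmul_eq_iff[OF assms(1), THEN iffD1])
  have "(THE y. nmul n y = imul p x) = y"
    using y by (rule the_equality) (use y n nmul_eq_iff in metis)
  then show ?thesis by (simp add: qmul_def pq n imul_of_nat)
qed

lemma qmul_exists:
  fixes x :: 'a
  assumes "0 < d" shows "nmul d (qmul (of_int a / of_nat d) x) = imul a x"
proof -
  obtain y where y: "nmul d y = imul a x" using divisible[OF assms] by blast
  then show ?thesis using qmul_eqI[OF assms y refl] by simp
qed

lemma rat_obtain: 
  fixes r :: rat
  obtains a :: int and d :: nat where "0 < d" "r = of_int a / of_nat d"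
proof -
  obtain p q where pq: "quotient_of r = (p, q)" by (cases "quotient_of r")
  have "0 < q" "r = of_int p / of_int q"
    using quotient_of_denom_pos[OF pq] quotient_of_div[OF pq] .
  then show ?thesis using that[of "nat q" p] by simp
qed

lemma qmul_of_nat: "qmul (of_nat n) (x::'a) = nmul n x"
  by (rule qmul_eqI[of 1 _ "int n"]) (simp_all add: imul_of_nat)

sublocale q: module "qmul :: rat \<Rightarrow> 'a \<Rightarrow> 'a"
proof
  fix r s :: rat and x y :: 'a
  obtain a d where r: "0 < d" "r = of_int a / of_nat d" by (rule rat_obtain)
  obtain b f where s: "0 < f" "s = of_int b / of_nat f" by (rule rat_obtain)
  note rx = qmul_exists[OF r(1), of a, folded r(2)] and sx = qmul_exists[OF s(1), of b, folded s(2)]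
  show "qmul r (x + y) = qmul r x + qmul r y"
    by (rule qmul_eqI[OF r(1) _ r(2)]) (simp add: nmul_add_right rx imul_add_right)
  show "qmul (r + s) x = qmul r x + qmul s x"
  proof (rule qmul_eqI[of "d * f" _ "int f * a + int d * b"])
    show "nmul (d * f) (qmul r x + qmul s x) = imul (int f * a + int d * b) x"
      using nmul_mult[of f d "qmul r x"] nmul_mult[of d f "qmul s x"]
      unfolding nmul_add_right imul_add rx sx nmul_imul by (simp only: mult.commute[of f d])
  qed (use r s in \<open>simp_all add: field_simps\<close>)
  show "qmul r (qmul s x) = qmul (r * s) x"
  proof (rule qmul_eqI[of "d * f" _ "a * b", symmetric])
    have "nmul (d * f) (qmul r (qmul s x)) = nmul f (imul a (qmul s x))"
      using nmul_mult[of f d "qmul r (qmul s x)"] by (simp add: rx mult.commute)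
    also have "\<dots> = imul a (nmul f (qmul s x))"
      by (simp add: nmul_imul imul_nmul)
    also have "\<dots> = imul (a * b) x"
    proof -
      obtain p q where a: "a = int p - int q" using int_diff_cases by blast
      obtain p' q' where b: "b = int p' - int q'" using int_diff_cases by blast
      have "a * b = int (p * p' + q * q') - int (p * q' + q * p')" 
        by (simp add: a b algebra_simps)
      then show ?thesis unfolding sx unfolding a b
        by (simp only: imul_diff nmul_mult nmul_diff_right nmul_add) (simp add: algebra_simps)
    qed
    finally show "nmul (d * f) (qmul r (qmul s x)) = imul (a * b) x" .
  qed (use r s in \<open>simp_all add: field_simps\<close>)
  show "qmul 1 x = x" using qmul_of_nat[of 1 x] by simp
qed

lemma qmul_mono:
  fixes x y :: 'a
  assumes "0 \<le> r" "x \<le> y" shows "qmul r x \<le> qmul r y"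
proof -
  obtain a d where r: "0 < d" "r = of_int a / of_nat d" by (rule rat_obtain)
  have "0 \<le> a" using r assms(1) by (simp add: zero_le_divide_iff)
  then have "imul a x \<le> imul a y" using assms(2) by (simp add: imul_def nmul_mono)
  then have "nmul d (qmul r x) \<le> nmul d (qmul r y)" 
    using qmul_exists[OF r(1), of a, folded r(2)] by simp
  then show ?thesis using r(1) by (simp add: nmul_le_iff)
qed

lemma qmul_antimono: "r \<le> 0 \<Longrightarrow> (x::'a) \<le> y \<Longrightarrow> qmul r y \<le> qmul r x"
  using qmul_mono[of "- r" x y] by (simp add: q.scale_minus_left)

lemma qmul_nonneg: "0 \<le> r \<Longrightarrow> 0 \<le> (x::'a) \<Longrightarrow> 0 \<le> qmul r x"
  using qmul_mono[of r 0 x] by simp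

lemma qmul_le_iff: 
  fixes x y :: 'a
  assumes "0 < r" shows "qmul r x \<le> qmul r y \<longleftrightarrow> x \<le> y"
proof
  assume "qmul r x \<le> qmul r y"
  with assms have "qmul (1 / r) (qmul r x) \<le> qmul (1 / r) (qmul r y)" 
    by (simp only: qmul_mono zero_le_divide_1_iff less_imp_le)
  moreover have "qmul (1 / r) (qmul r w) = w" for w :: 'a using assms by (simp add: q.scale_scale)
  ultimately show "x \<le> y" by metis
qed (use assms in \<open>simp add: qmul_mono\<close>)

lemma qmul_le_iff_le: "0 < r \<Longrightarrow> qmul (1 / r) (x::'a) \<le> y \<longleftrightarrow> x \<le> qmul r y"
  using qmul_le_iff[of r "qmul (1 / r) x" y] by simp

lemma le_qmul_iff_le: "0 < r \<Longrightarrow> (x::'a) \<le> qmul (1 / r) y \<longleftrightarrow> qmul r x \<le> y"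
  using qmul_le_iff[of r x "qmul (1 / r) y"] by simp

text \<open>The \<open>n\<close> classes of \<open>0, e, \<dots>, (n-1) e\<close> are distinct, so they exhaust the quotient.\<close>

lemma residue:
  assumes "1 \<le> n" "z \<in> Z"
  obtains j u where "j < n" "u \<in> Z" "z = nmul n u + nmul j e"
proof -
  let ?c = "\<lambda>z. {w \<in> Z. w - z \<in> nmul n ` Z}"
  have 0: "0 \<in> nmul n ` Z" using image_eqI[of 0 "nmul n" 0 Z] by simp
  have fin: "finite {?c z | z. z \<in> Z}"
    using card_quotient[OF assms(1)] assms(1) by (intro card_ge_0_finite) simp
  have noteq: "nmul j e - nmul i e \<notin> nmul n ` Z" if ij: "i < j" "j < n" for i j
  proof
    assume "nmul j e - nmul i e \<in> nmul n ` Z"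
    then obtain w where w: "w \<in> Z" "nmul j e - nmul i e = nmul n w" by blast
    obtain d where d: "j = i + d" "0 < d" using less_imp_add_positive[OF ij(1)] by metis
    have eq: "nmul d e = nmul n w" unfolding w(2)[symmetric] d(1) by (simp add: nmul_add)
    have "0 < nmul d e" using nmul_strict_mono[OF e_pos d(2)] by simp
    then have "0 < w" using eq nmul_less_iff[of n 0 w] assms(1) by simp
    then have "nmul n e \<le> nmul d e" unfolding eq by (intro nmul_mono e_least w)
    moreover have "nmul d e < nmul n e" 
    proof -
      obtain f where "n = d + f" "0 < f" 
        using less_imp_add_positive[of d n] ij d by auto
      then show ?thesis using nmul_strict_mono[OF e_pos, of f] by (simp add: nmul_add)
    qed
    ultimately show False by simp
  qed
  have "inj_on (\<lambda>j. ?c (nmul j e)) {..<n}"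
  proof (rule linorder_inj_onI')
    fix i j assume ij: "i \<in> {..<n}" "j \<in> {..<n}" "i < j"
    have "nmul j e \<in> ?c (nmul j e)" using 0 by (simp add: Z_nmul)
    moreover have "nmul j e \<notin> ?c (nmul i e)" using noteq[of i j] ij by simp
    ultimately show "?c (nmul i e) \<noteq> ?c (nmul j e)" by blast
  qed
  then have "card ((\<lambda>j. ?c (nmul j e)) ` {..<n}) = card {?c z | z. z \<in> Z}" 
    using card_quotient[OF assms(1)] by (simp add: card_image)
  moreover have "(\<lambda>j. ?c (nmul j e)) ` {..<n} \<subseteq> {?c z | z. z \<in> Z}" using Z_nmul[OF Z_e] by blast
  ultimately have eq: "(\<lambda>j. ?c (nmul j e)) ` {..<n} = {?c z | z. z \<in> Z}"
    by (intro card_subset_eq fin)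
  have "?c z \<in> (\<lambda>j. ?c (nmul j e)) ` {..<n}" unfolding eq using assms(2) by blast
  then obtain j where j: "j < n" "?c z = ?c (nmul j e)" by (elim imageE) simp
  have "z \<in> ?c z" using 0 assms(2) by simp
  then have "z - nmul j e \<in> nmul n ` Z" unfolding j(2) by simp
  then obtain u where "u \<in> Z" "z - nmul j e = nmul n u" by blast
  then show ?thesis using that[of j u] j(1) by (simp add: algebra_simps)
qed

text \<open>Some multiple \<open>nmul n x\<close> lies in \<open>Z\<close>. Writing it as
  \<open>nmul n u + nmul j e\<close> with \<open>j < n\<close> and dividing by \<open>n\<close>
  exhibits \<open>u\<close> as the floor of \<open>x\<close>.\<close>

lemma integer_part: obtains u where "u \<in> Z" "u \<le> x" "x < u + e"
proof -
  obtain n where n: "0 < n" "nmul n x \<in> Z" using torsion by blast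
  have "1 \<le> n" using n by simp
  then obtain j u where j: "j < n" "u \<in> Z" "nmul n x = nmul n u + nmul j e"
    using n(2) by (rule residue)
  have "nmul n u \<le> nmul n x" unfolding j(3) using nmul_nonneg[of e j] e_pos by simp
  then have 1: "u \<le> x" by (rule nmul_le_iff[OF n(1), THEN iffD1])
  obtain f where f: "n = j + f" "0 < f" using less_imp_add_positive[OF j(1)] by metis
  have "nmul j e < nmul n e" 
    using nmul_strict_mono[OF e_pos f(2)] by (simp add: f(1) nmul_add)
  then have "nmul n x < nmul n (u + e)"
    unfolding j(3) nmul_add_right by (rule add_strict_left_mono)
  then have "x < u + e" by (rule nmul_less_iff[OF n(1), THEN iffD1])
  with 1 j(2) that show ?thesis by blast
qed

text \<open>Subtracting \<open>nmul \<rho> e\<close> and dividing by \<open>n\<close> turns the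
  residue class into \<open>Z\<close> and the interval into one of length at least \<open>e\<close>.
  The width \<open>nmul n e\<close> is the one demanded of slices in
  \<open>slice_bounds\<close>.\<close>

lemma residue_in_interval:
  assumes "1 \<le> n" "a + nmul n e \<le> b" 
  obtains z where "z \<in> Z" "a \<le> z" "z \<le> b" "z - nmul \<rho> e \<in> nmul n ` Z"
proof -
  obtain x where x: "nmul n x = a - nmul \<rho> e" using divisible[of n] assms(1) by auto
  \<comment> \<open>\<open>- u\<close> is the ceiling of \<open>x\<close>.\<close>
  obtain u where u: "u \<in> Z" "u \<le> - x" "- x < u + e" by (rule integer_part)
  define z where "z = nmul \<rho> e + nmul n (- u)"
  have 1: "z \<in> Z" "z - nmul \<rho> e \<in> nmul n ` Z" using u by (auto simp: z_def intro!: Z_add Z_nmul Z_minus)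
  have "nmul n x \<le> nmul n (- u)" using u(2) by (intro nmul_mono) (simp add: le_minus_iff)
  then have 2: "a \<le> z" using x by (simp add: z_def algebra_simps)
  have "- (u + e) \<le> x" using u(3) by (simp only: minus_le_iff less_imp_le)
  then have "- u \<le> x + e" using add_right_mono[of "- (u + e)" x e] by simp
  then have "nmul n (- u) \<le> nmul n x + nmul n e" using nmul_mono[of "-u" "x + e" n] by (simp add: nmul_add_right)
  then have "z \<le> a + nmul n e" using x by (simp add: z_def algebra_simps)
  then show ?thesis using that[of z] 1 2 assms(2) by (meson order.trans)
qed

text \<open>\<open>Z\<close> is closed and discrete in its hull. Hence a limit of points over
  \<open>Z\<close> has its finite coordinates attained exactly, not merely approximated.\<close>

lemma isolated: obtains a b where "a < w" "w < b" "\<And>z. z \<in> Z \<Longrightarrow> a < z \<Longrightarrow> z < b \<Longrightarrow> z = w"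
proof -
  obtain u where u: "u \<in> Z" "u \<le> w" "w < u + e" by (rule integer_part)
  have no: False if "z \<in> Z" "u < z" "z < u + e" for z using Z_less_imp_le[OF u(1) that(1,2)] that(3) by simp
  show ?thesis
  proof (cases "u = w")
    case True
    have "z = w" if "z \<in> Z" "u - e < z" "z < u + e" for z
    proof (cases z u rule: linorder_cases)
      case less
      then have "z + e \<le> u" by (rule Z_less_imp_le[OF that(1) u(1)])
      then show ?thesis using that(2) by (simp add: diff_less_eq)
    qed (use no[of z] that True in auto)
    then show ?thesis using that[of "u - e" "u + e"] e_pos True by simp
  next
    case False
    then have "u < w" using u(2) by simp
    then show ?thesis
    proof (rule that[of u "u + e"])
      show "z = w" if "z \<in> Z" "u < z" "z < u + e" for z using no[OF that] by simp
    qed (rule u(3))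
  qed
qed

end

section \<open>Points and recession vectors\<close>

definition val :: "'a::zero ext list \<Rightarrow> nat \<Rightarrow> 'a" where
  "val x i = fin_val (x ! i)"

text \<open>\<open>pt m J (val x)\<close> is the projection of \<open>x\<close> to the coordinates
  in \<open>J\<close>, the others being sent to \<open>PInf\<close>. Points of faces are written in
  this form throughout.\<close>

definition pt :: "nat \<Rightarrow> nat set \<Rightarrow> (nat \<Rightarrow> 'a) \<Rightarrow> 'a ext list" where
  "pt m J v = map (\<lambda>i. if i \<in> J then Fin (v i) else PInf) [0..<m]"

lemma length_pt [simp]: "length (pt m J v) = m"
  by (simp add: pt_def)

lemma nth_pt: "i < m \<Longrightarrow> pt m J v ! i = (if i \<in> J then Fin (v i) else PInf)"
  by (simp add: pt_def)

lemma val_pt [simp]: "i < m \<Longrightarrow> i \<in> J \<Longrightarrow> val (pt m J v) i = v i"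
  by (simp add: val_def nth_pt)

lemma pt_cong: "(\<And>i. i < m \<Longrightarrow> i \<in> J \<Longrightarrow> v i = w i) \<Longrightarrow> pt m J v = pt m J w"
  by (simp add: pt_def)

lemma pt_eq_iff: "pt m J v = pt m J w \<longleftrightarrow> (\<forall>i<m. i \<in> J \<longrightarrow> v i = w i)"
  by (auto simp: list_eq_iff_nth_eq nth_pt)

lemma supp_pt: "J \<subseteq> {..<m} \<Longrightarrow> supp (pt m J v) = J"
  by (auto simp: supp_def nth_pt split: if_splits)

lemma pt_in_FI: "I \<subseteq> {..<m} \<Longrightarrow> (\<And>i. i \<in> I \<Longrightarrow> v i \<in> Z) \<Longrightarrow> pt m I v \<in> FI Z m I"
  by (auto simp: FI_def Gam_def supp_pt nth_pt)

lemma FI_length: "x \<in> FI Z m I \<Longrightarrow> length x = m"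
  and FI_subset: "x \<in> FI Z m I \<Longrightarrow> I \<subseteq> {..<m}"
  by (auto simp: FI_def Gam_def supp_def)

lemma FI_nth_in: 
  assumes "x \<in> FI Z m I" "i \<in> I" shows "x ! i = Fin (val x i)" "val x i \<in> Z"
proof -
  have "i < m" "x ! i \<noteq> PInf" using assms by (auto simp: FI_def Gam_def supp_def)
  moreover from this obtain z where "z \<in> Z" "x ! i = Fin z" using assms(1) by (auto simp: FI_def Gam_def)
  ultimately show "x ! i = Fin (val x i)" "val x i \<in> Z" by (auto simp: val_def)
qed

lemma FI_nth_notin: 
  assumes "x \<in> FI Z m I" "i \<notin> I" "i < m" shows "x ! i = PInf"
  using assms by (auto simp: FI_def Gam_def supp_def)

lemma FI_pt: assumes "x \<in> FI Z m I" shows "pt m I (val x) = x"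
  using FI_length[OF assms] FI_nth_in(1)[OF assms] FI_nth_notin[OF assms]
  by (auto simp: list_eq_iff_nth_eq nth_pt)

lemma FI_snoc:
  assumes "x \<in> FI (Z :: 'a::zero set) k (I - {k})" "z \<in> Z" "k \<in> I"
  shows "x @ [Fin z] \<in> FI Z (Suc k) I"
proof -
  have "x @ [Fin z] = pt (Suc k) I (\<lambda>i. if i < k then val x i else z)"
    using FI_length[OF assms(1)] FI_nth_in(1)[OF assms(1)] FI_nth_notin[OF assms(1)] assms(3)
    by (auto simp: list_eq_iff_nth_eq nth_pt nth_append less_Suc_eq)
  moreover have "pt (Suc k) I (\<lambda>i. if i < k then val x i else z) \<in> FI Z (Suc k) I"
  proof (rule pt_in_FI)
    show "I \<subseteq> {..<Suc k}" using FI_subset[OF assms(1)] by auto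
    show "(if i < k then val x i else z) \<in> Z" if "i \<in> I" for i
      using FI_nth_in(2)[OF assms(1)] that assms(2) by simp
  qed
  ultimately show ?thesis by simp
qed

lemma snoc_in_FI_PInf:
  assumes "x \<in> FI Z k I" shows "x @ [PInf] \<in> FI Z (Suc k) I"
  using assms by (auto simp: FI_def Gam_def supp_def nth_append less_Suc_eq)

lemma FI_last:
  assumes "x \<in> FI Z (Suc k) I" shows "last x = x ! k"
  using FI_length[OF assms] by (cases x rule: rev_cases) auto

lemma FI_snoc_PInf_eq:
  assumes "x \<in> FI Z (Suc k) I" "k \<notin> I" shows "butlast x @ [PInf] = x"
proof -
  have "x \<noteq> []" using FI_length[OF assms(1)] by auto
  then show ?thesis using append_butlast_last_id[of x] FI_last[OF assms(1)] FI_nth_notin[OF assms] by simp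
qed

lemma val_snoc [simp]: "i < length x \<Longrightarrow> val (x @ [z]) i = val x i"
  "length x = k \<Longrightarrow> val (x @ [Fin z']) k = z'"
  by (auto simp: val_def nth_append)

lemma val_butlast: "i < length x - 1 \<Longrightarrow> val (butlast x) i = val x i"
  by (simp add: val_def nth_butlast)

lemma pt_Suc: "pt (Suc k) J v = pt k (J - {k}) v @ [if k \<in> J then Fin (v k) else PInf]"
  by (auto simp: pt_def)

section \<open>Rays, recession vectors and slopes\<close>

definition move :: "nat \<Rightarrow> nat set \<Rightarrow> 'a::ab_group_add ext list \<Rightarrow> (nat \<Rightarrow> nat) \<Rightarrow> 'a \<Rightarrow> 'a ext list" where
  "move m I x y t = pt m I (\<lambda>i. val x i + nmul (y i) t)"

text \<open>The entries are natural numbers, but \<open>t\<close> runs through all non-negative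
  elements of \<open>Z\<close>: standard steps alone need not tend to \<open>PInf\<close>. Requiring
  the condition at every point of \<open>A\<close> makes these vectors closed under
  addition.\<close>

definition recession :: "'a::linordered_ab_group_add set \<Rightarrow> nat \<Rightarrow> nat set \<Rightarrow> 'a ext list set \<Rightarrow> (nat \<Rightarrow> nat) set" where
  "recession Z m I A = {y. (\<forall>i. i \<notin> I \<longrightarrow> y i = 0) \<and> (\<forall>x\<in>A. \<forall>t\<in>Z. 0 \<le> t \<longrightarrow> move m I x y t \<in> A)}"

lemma recessionD:
  assumes "y \<in> recession Z m I A" 
  shows "i \<notin> I \<Longrightarrow> y i = 0" "x \<in> A \<Longrightarrow> t \<in> Z \<Longrightarrow> 0 \<le> t \<Longrightarrow> move m I x y t \<in> A"
  using assms by (auto simp: recession_def)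

lemma val_move [simp]: "i < m \<Longrightarrow> i \<in> I \<Longrightarrow> val (move m I x y t) i = val x i + nmul (y i) t"
  by (simp add: move_def)

lemma recession_zero:
  assumes "A \<subseteq> FI Z m I" shows "(\<lambda>_. 0) \<in> recession Z m I A"
  using assms FI_pt by (fastforce simp: recession_def move_def)

lemma recession_add:
  assumes "y \<in> recession Z m I A" "y' \<in> recession Z m I A" 
  shows "(\<lambda>i. y i + y' i) \<in> recession Z m I A"
  unfolding recession_def
proof (intro CollectI conjI allI impI ballI)
  fix x t assume *: "x \<in> A" "t \<in> Z" "0 \<le> t"
  have "move m I x (\<lambda>i. y i + y' i) t = move m I (move m I x y t) y' t"
    unfolding move_def[of m I x] move_def[of m I "pt m I v" for v] 
    by (rule pt_cong) (simp add: nmul_add add.assoc)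
  also have "\<dots> \<in> A" by (intro recessionD(2)[OF assms(2)] recessionD(2)[OF assms(1)] *)
  finally show "move m I x (\<lambda>i. y i + y' i) t \<in> A" .
qed (use recessionD(1)[OF assms(1)] recessionD(1)[OF assms(2)] in simp)

lemma recession_sum:
  assumes "finite S" "S \<subseteq> recession Z m I A" "A \<subseteq> FI Z m I"
  shows "(\<lambda>i. \<Sum>y\<in>S. y i) \<in> recession Z m I A"
  using assms(1,2)
proof (induction S)
  case empty
  then show ?case using recession_zero[OF assms(3)] by simp
next
  case (insert y S)
  then show ?case using recession_add[of y Z m I A "\<lambda>i. \<Sum>y\<in>S. y i"] by simp
qed

text \<open>\<open>lam\<close> is the slope of a linear form along a direction and
  \<open>lin\<close> its value at a point; \<open>lin_move\<close> relates them.\<close>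

definition lam :: "(nat \<Rightarrow> rat) \<Rightarrow> nat set \<Rightarrow> (nat \<Rightarrow> nat) \<Rightarrow> rat" where
  "lam \<alpha> I y = (\<Sum>i\<in>I. \<alpha> i * of_nat (y i))"

definition lin :: "(nat \<Rightarrow> rat) \<Rightarrow> nat set \<Rightarrow> 'a::linordered_ab_group_add ext list \<Rightarrow> 'a" where
  "lin \<alpha> I x = (\<Sum>i\<in>I. qmul (\<alpha> i) (val x i))"

lemma lam_scale: "lam \<alpha> I (\<lambda>i. D * y i) = of_nat D * lam \<alpha> I y"
  by (simp add: lam_def sum_distrib_left mult_ac)

lemma lam_add: "lam \<alpha> I (\<lambda>i. y i + y' i) = lam \<alpha> I y + lam \<alpha> I y'"
  by (simp add: lam_def sum.distrib algebra_simps)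

lemma lam_sum: "lam \<alpha> I (\<lambda>i. \<Sum>y\<in>S. y i) = (\<Sum>y\<in>S. lam \<alpha> I y)"
  unfolding lam_def by (simp add: sum_distrib_left) (rule sum.swap)

lemma lam_add_left: "lam (\<lambda>i. \<alpha> i + r * \<beta> i) I y = lam \<alpha> I y + r * lam \<beta> I y"
  by (simp add: lam_def sum.distrib sum_distrib_left algebra_simps)

lemma lam_cong: "(\<And>i. i \<in> I \<Longrightarrow> y i = y' i) \<Longrightarrow> lam \<alpha> I y = lam \<alpha> I y'"
  by (simp add: lam_def)

lemma lin_cong: "(\<And>i. i \<in> I \<Longrightarrow> val x i = val x' i) \<Longrightarrow> lin \<alpha> I x = lin \<alpha> I x'"
  by (simp add: lin_def)

context zgroup_hull
begin

lemma qmul_nmul': "qmul r (nmul n (t::'a)) = qmul (r * of_nat n) t"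
  by (simp add: qmul_of_nat[symmetric])

lemma lin_add_left: "lin (\<lambda>i. \<alpha> i + r * \<beta> i) I x = lin \<alpha> I x + qmul r (lin \<beta> I (x :: 'a ext list))"
  by (simp add: lin_def q.scale_left_distrib sum.distrib q.scale_sum_right)

lemma lin_move:
  assumes "I \<subseteq> {..<m}"
  shows "lin \<alpha> I (move m I (x :: 'a ext list) y t) = lin \<alpha> I x + qmul (lam \<alpha> I y) t"
proof -
  have "lin \<alpha> I (move m I x y t) = (\<Sum>i\<in>I. qmul (\<alpha> i) (val x i) + qmul (\<alpha> i * of_nat (y i)) t)"
    unfolding lin_def using assms by (intro sum.cong) (auto simp: q.scale_right_distrib qmul_nmul')
  then show ?thesis by (simp add: sum.distrib lin_def lam_def q.scale_sum_left)
qed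

lemma large_multiple:
  assumes "0 < r" shows "\<exists>T\<in>Z. 0 \<le> T \<and> (\<forall>t\<ge>T. (b::'a) \<le> qmul r t)"
proof -
  obtain T where T: "T \<in> Z" "qmul (1 / r) b \<le> T" "0 \<le> T" using cofinal by blast
  have "b \<le> qmul r t" if "T \<le> t" for t 
    using order.trans[OF T(2) that] by (simp only: qmul_le_iff_le[OF assms])
  then show ?thesis using T by blast
qed

text \<open>With a negative slope the values would drop below \<open>b\<close>, since multiples of
  \<open>t\<close> by a positive rational are unbounded.\<close>

lemma nonneg_slope:
  assumes "\<And>t. t \<in> Z \<Longrightarrow> 0 \<le> t \<Longrightarrow> (b::'a) \<le> a + qmul r t"
  shows "0 \<le> r"
proof (rule ccontr)
  assume "\<not> 0 \<le> r"
  then obtain T where T: "T \<in> Z" "0 \<le> T" "\<forall>t\<ge>T. a - b + e \<le> qmul (- r) t" 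
    using large_multiple[of "- r" "a - b + e"] by auto
  have "a - b + e \<le> - qmul r T" using T(3) by (simp add: q.scale_minus_left)
  then have "a + e + qmul r T \<le> b" by (simp add: algebra_simps)
  then have "(a + qmul r T) + e \<le> b" by (simp add: add_ac)
  also have "b \<le> (a + qmul r T) + 0" using assms[OF T(1,2)] by simp
  finally have "(a + qmul r T) + e \<le> (a + qmul r T) + 0" .
  then have "e \<le> 0" by (simp only: add_le_cancel_left)
  then show False using e_pos by simp
qed

lemma large_coordinate:
  assumes "1 \<le> n" shows "\<exists>T\<in>Z. 0 \<le> T \<and> (\<forall>t\<ge>T. (b::'a) < a + nmul n t)"
proof -
  obtain T where T: "T \<in> Z" "b - a + e \<le> T" "0 \<le> T" using cofinal by blast
  have "b < a + nmul n t" if "T \<le> t" for t 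
  proof -
    have "b - a + e \<le> t" using T that by simp
    also have "t \<le> nmul n t" using assms T(3) that by (intro le_nmul) auto
    finally have "b + e \<le> a + nmul n t" by (simp add: algebra_simps)
    then show ?thesis using e_pos by (meson add_pos_pos less_add_same_cancel1 order.strict_trans2)
  qed
  then show ?thesis using T by blast
qed

end

section \<open>Neighbourhoods and presentations of precells\<close>

lemma basic_nbhd_Fin: "a < w \<Longrightarrow> w < b \<Longrightarrow> {y. ext_less (Fin a) y \<and> ext_less y (Fin b)} \<in> basic_nbhd (Fin w)"
  by (auto simp: basic_nbhd_def)

lemma basic_nbhd_PInf: "{y. ext_less (Fin a) y} \<in> basic_nbhd PInf"
  by (auto simp: basic_nbhd_def)

lemma basic_nbhd_self: "U \<in> basic_nbhd x \<Longrightarrow> x \<in> U"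
  by (simp add: basic_nbhd_def)

lemma basic_nbhd_PInfD: "U \<in> basic_nbhd PInf \<Longrightarrow> PInf \<in> U \<and> (\<exists>a. \<forall>z>a. Fin z \<in> U)"
  by (auto simp: basic_nbhd_def)

lemma clos_mono: "A \<subseteq> B \<Longrightarrow> clos m A \<subseteq> clos m B"
  unfolding clos_def by blast

lemma clos_length: "x \<in> clos m A \<Longrightarrow> length x = m"
  by (simp add: clos_def)

lemma subset_clos: 
  assumes "A \<subseteq> FI Z m I" shows "A \<subseteq> clos m A"
proof
  fix x assume x: "x \<in> A"
  then have "length x = m" using assms FI_length by blast
  then show "x \<in> clos m A" using x basic_nbhd_self unfolding clos_def by blast
qed

lemma largely_continuous_subset:
  assumes "largely_continuous m A f" "B \<subseteq> A" shows "largely_continuous m B f"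
proof -
  obtain g where g: "\<forall>a\<in>A. g a = f a" "cont_on m (clos m A) g"
    using assms(1) by (auto simp: largely_continuous_def)
  have "cont_on m (clos m B) g"
    unfolding cont_on_def
  proof (intro ballI)
    fix x V assume "x \<in> clos m B" "V \<in> basic_nbhd (g x)"
    then obtain U where "\<forall>i<m. U i \<in> basic_nbhd (x ! i)" 
      "\<forall>y\<in>clos m A. (\<forall>i<m. y ! i \<in> U i) \<longrightarrow> g y \<in> V"
      using g(2) clos_mono[OF assms(2), of m] unfolding cont_on_def by blast
    then show "\<exists>U. (\<forall>i<m. U i \<in> basic_nbhd (x ! i)) \<and> (\<forall>y\<in>clos m B. (\<forall>i<m. y ! i \<in> U i) \<longrightarrow> g y \<in> V)"
      using clos_mono[OF assms(2), of m] by blast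
  qed
  then show ?thesis using g(1) assms(2) unfolding largely_continuous_def by blast
qed

lemma largely_continuous_cong:
  assumes "largely_continuous m A f" "\<And>x. x \<in> A \<Longrightarrow> f x = f' x" shows "largely_continuous m A f'"
  using assms unfolding largely_continuous_def by metis

lemma largely_continuousI: "cont_on m (clos m A) f \<Longrightarrow> largely_continuous m A f"
  unfolding largely_continuous_def by blast

section \<open>Recursive presentation of precells over their socles\<close>

lemma affine_map_iff:
  "affine_map I A f \<longleftrightarrow> (\<forall>a\<in>A. f a = PInf) \<or> (\<exists>b \<alpha>. \<forall>a\<in>A. f a = Fin (b + lin \<alpha> I a))"
  by (simp add: affine_map_def lin_def val_def)

lemma precell_rec_basic:
  "precell_rec Z e m N I A \<Longrightarrow> length N = m \<and> A \<noteq> {} \<and> A \<subseteq> FI Z m I \<and> I \<subseteq> {..<m}"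
proof (induction m arbitrary: N I A)
  case 0
  then show ?case by (auto simp: FI_def Gam_def supp_def)
next
  case (Suc k)
  then have "butlast ` A \<noteq> {}" and "length N = Suc k" "I \<subseteq> {..k}" by auto
  moreover have "A \<subseteq> FI Z (Suc k) I" using Suc.prems by auto
  ultimately show ?case by (auto simp: lessThan_Suc_atMost)
qed

lemmas precell_rec_length = precell_rec_basic[THEN conjunct1]
  and precell_rec_nonempty = precell_rec_basic[THEN conjunct2, THEN conjunct1]
  and precell_rec_FI = precell_rec_basic[THEN conjunct2, THEN conjunct2, THEN conjunct1]
  and precell_rec_subset = precell_rec_basic[THEN conjunct2, THEN conjunct2, THEN conjunct2]

text \<open>Precells with finite last coordinate. Only the upper bound can be \<open>PInf\<close>
  here, so the lower bound is stored by its coefficients.\<close>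

definition fibred :: "'a::linordered_ab_group_add set \<Rightarrow> 'a \<Rightarrow> nat \<Rightarrow> nat set \<Rightarrow> nat \<Rightarrow> nat \<Rightarrow> 'a ext list set \<Rightarrow>
    'a \<Rightarrow> (nat \<Rightarrow> rat) \<Rightarrow> ('a ext list \<Rightarrow> 'a ext) \<Rightarrow> 'a ext list set" where
  "fibred Z e k I n \<rho> B b \<alpha> \<nu> = {a \<in> FI Z (Suc k) I. butlast a \<in> B \<and> 
     b + lin \<alpha> (I - {k}) (butlast a) \<le> val a k \<and> ext_le (Fin (val a k)) (\<nu> (butlast a)) \<and>
     val a k - nmul \<rho> e \<in> nmul n ` Z}"

lemma precell_rec_fibredE:
  assumes "precell_rec Z e (Suc k) N I A" "k \<in> I"
  obtains b \<alpha> \<nu> \<rho> where "precell_rec Z e k (butlast N) (I - {k}) (butlast ` A)"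
    "\<forall>x\<in>butlast ` A. 0 \<le> b + lin \<alpha> (I - {k}) x"
    "largely_continuous k (butlast ` A) (\<lambda>x. Fin (b + lin \<alpha> (I - {k}) x))"
    "affine_map (I - {k}) (butlast ` A) \<nu>" "nonneg_map (butlast ` A) \<nu>" "largely_continuous k (butlast ` A) \<nu>"
    "\<rho> < last N" "A = fibred Z e k I (last N) \<rho> (butlast ` A) b \<alpha> \<nu>"
proof -
  have pre: "precell_rec Z e k (butlast N) (I - {k}) (butlast ` A)" using assms(1) by simp
  obtain \<mu> \<nu> \<rho> where 
    mu: "affine_map (I - {k}) (butlast ` A) \<mu>" "nonneg_map (butlast ` A) \<mu>" "largely_continuous k (butlast ` A) \<mu>"
    and nu: "affine_map (I - {k}) (butlast ` A) \<nu>" "nonneg_map (butlast ` A) \<nu>" "largely_continuous k (butlast ` A) \<nu>"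
    and rho: "\<rho> < last N"
    and A: "A = {a \<in> FI Z (Suc k) I. butlast a \<in> butlast ` A \<and>
               ext_le (\<mu> (butlast a)) (last a) \<and> ext_le (last a) (\<nu> (butlast a)) \<and>
               cong_ext Z e (last a) \<rho> (last N)}"
    using assms(1) unfolding precell_rec.simps by (elim conjE exE)
  have last: "last a = Fin (val a k)" if "a \<in> FI Z (Suc k) I" for a
    using FI_last[OF that] FI_nth_in(1)[OF that assms(2)] by simp
  obtain a0 where a0: "a0 \<in> A" using precell_rec_nonempty[OF assms(1)] by blast
  have "a0 \<in> FI Z (Suc k) I" "ext_le (\<mu> (butlast a0)) (last a0)" using a0 A by blast+
  \<comment> \<open>A finite last coordinate lies above \<open>\<mu>\<close>, which excludes the
    constant value \<open>PInf\<close>.\<close>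
  then have "\<mu> (butlast a0) \<noteq> PInf" using last by fastforce
  then obtain b \<alpha> where b: "\<And>x. x \<in> butlast ` A \<Longrightarrow> \<mu> x = Fin (b + lin \<alpha> (I - {k}) x)"
    using mu(1) a0 unfolding affine_map_iff by blast
  have "A = fibred Z e k I (last N) \<rho> (butlast ` A) b \<alpha> \<nu>"
    unfolding fibred_def
  proof (subst A, intro Collect_cong conj_cong refl, goal_cases)
    case (1 a)
    then show ?case using b[of "butlast a"] last[of a] by simp
  next
    case (2 a)
    then show ?case using last[of a] by simp
  next
    case (3 a)
    then show ?case using last[of a] by (simp add: cong_ext_def)
  qed
  moreover have "0 \<le> b + lin \<alpha> (I - {k}) x" if "x \<in> butlast ` A" for x
  proof -
    have "ext_le (Fin 0) (\<mu> x)" using mu(2) that unfolding nonneg_map_def by blast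
    then show ?thesis by (simp add: b[OF that])
  qed
  moreover have "largely_continuous k (butlast ` A) (\<lambda>x. Fin (b + lin \<alpha> (I - {k}) x))"
    using mu(3) b by (rule largely_continuous_cong)
  ultimately show ?thesis using that[of b \<alpha> \<nu> \<rho>] pre nu rho by blast
qed

text \<open>The last hypothesis, that no fibre over \<open>B\<close> is empty, is the critical one:
  it makes \<open>B\<close> the projection to which the definition of a precell refers.\<close>

lemma precell_rec_fibredI:
  assumes "precell_rec Z e k (butlast N) (I - {k}) B" "k \<in> I" "length N = Suc k"
    "\<And>x. x \<in> B \<Longrightarrow> 0 \<le> b + lin \<alpha> (I - {k}) x"
    "largely_continuous k B (\<lambda>x. Fin (b + lin \<alpha> (I - {k}) x))"
    "affine_map (I - {k}) B \<nu>" "nonneg_map B \<nu>" "largely_continuous k B \<nu>"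
    "\<rho> < last N" "A = fibred Z e k I (last N) \<rho> B b \<alpha> \<nu>" "B \<subseteq> butlast ` A"
  shows "precell_rec Z e (Suc k) N I A"
proof -
  have B: "butlast ` A = B" using assms(10,11) by (auto simp: fibred_def)
  have last: "last a = Fin (val a k)" if "a \<in> FI Z (Suc k) I" for a
    using FI_last[OF that] FI_nth_in(1)[OF that assms(2)] by simp
  have I: "I \<subseteq> {..k}" using precell_rec_subset[OF assms(1)] by force
  have "A = {a \<in> FI Z (Suc k) I. butlast a \<in> B \<and>
               ext_le (Fin (b + lin \<alpha> (I - {k}) (butlast a))) (last a) \<and> ext_le (last a) (\<nu> (butlast a)) \<and>
               cong_ext Z e (last a) \<rho> (last N)}"
    unfolding assms(10) fibred_def
    by (intro Collect_cong conj_cong refl) (simp_all add: last cong_ext_def)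
  moreover have "affine_map (I - {k}) B (\<lambda>x. Fin (b + lin \<alpha> (I - {k}) x))" 
    unfolding affine_map_iff by blast
  moreover have "nonneg_map B (\<lambda>x. Fin (b + lin \<alpha> (I - {k}) x))" 
    using assms(4) by (simp add: nonneg_map_def)
  ultimately show ?thesis unfolding precell_rec.simps B using assms(1,3,5-9) I by blast
qed

lemma precell_rec_PInfE:
  assumes "precell_rec Z e (Suc k) N I A" "k \<notin> I"
  shows "precell_rec Z e k (butlast N) I (butlast ` A)" "A = (\<lambda>x. x @ [PInf]) ` butlast ` A"
    "1 \<le> last N"
proof -
  have [simp]: "I - {k} = I" using assms(2) by simp
  show "precell_rec Z e k (butlast N) I (butlast ` A)" "1 \<le> last N" using assms(1) by auto
  have "butlast a @ [PInf] = a" if "a \<in> A" for a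
    using FI_snoc_PInf_eq[OF _ assms(2)] precell_rec_FI[OF assms(1)] that by blast
  then show "A = (\<lambda>x. x @ [PInf]) ` butlast ` A" by (force simp: image_image)
qed

context zgroup_hull
begin

lemma basic_nbhd_ex: "\<exists>U. U \<in> basic_nbhd (x :: 'a ext)"
  using basic_nbhd_Fin[of "w - e" w "w + e" for w] basic_nbhd_PInf e_pos by (cases x) auto

lemma largely_continuous_const: "largely_continuous m (A :: 'a ext list set) (\<lambda>_. w)"
proof (rule largely_continuousI)
  show "cont_on m (clos m A) (\<lambda>_. w)"
    unfolding cont_on_def
  proof (intro ballI)
    fix x :: "'a ext list" and V assume V: "V \<in> basic_nbhd w"
    obtain U where U: "\<And>w :: 'a ext. U w \<in> basic_nbhd w" using basic_nbhd_ex by metis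
    show "\<exists>U. (\<forall>i<m. U i \<in> basic_nbhd (x ! i)) \<and> (\<forall>y\<in>clos m A. (\<forall>i<m. y ! i \<in> U i) \<longrightarrow> w \<in> V)"
      using U basic_nbhd_self[OF V] by (intro exI[of _ "\<lambda>i. U (x ! i)"]) simp
  qed
qed

lemma precell_rec_PInfI:
  assumes "precell_rec Z e k (butlast N) I B" "k \<notin> I" "length N = Suc k" "1 \<le> last N"
  shows "precell_rec Z e (Suc k) N I ((\<lambda>x. x @ [PInf]) ` B)"
proof -
  let ?A = "(\<lambda>x. x @ [PInf]) ` B"
  have B: "butlast ` ?A = B" by (simp add: image_image)
  have I: "I \<subseteq> {..k}" "I - {k} = I" using precell_rec_subset[OF assms(1)] assms(2) by force+
  have "affine_map I B (\<lambda>_. PInf)" "nonneg_map B (\<lambda>_. PInf)" "0 < last N"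
    using assms(4) by (auto simp: affine_map_def nonneg_map_def)
  moreover have "largely_continuous k B (\<lambda>_. PInf)" by (rule largely_continuous_const)
  moreover have "?A = {a \<in> FI Z (Suc k) I. butlast a \<in> B \<and>
      ext_le PInf (last a) \<and> ext_le (last a) PInf \<and> cong_ext Z e (last a) 0 (last N)}"
  proof (intro equalityI subsetI)
    fix a assume "a \<in> ?A"
    then show "a \<in> {a \<in> FI Z (Suc k) I. butlast a \<in> B \<and>
      ext_le PInf (last a) \<and> ext_le (last a) PInf \<and> cong_ext Z e (last a) 0 (last N)}"
      using precell_rec_FI[OF assms(1)] by (auto simp: cong_ext_def intro!: snoc_in_FI_PInf)
  next
    fix a assume "a \<in> {a \<in> FI Z (Suc k) I. butlast a \<in> B \<and>
      ext_le PInf (last a) \<and> ext_le (last a) PInf \<and> cong_ext Z e (last a) 0 (last N)}"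
    then have a: "a \<in> FI Z (Suc k) I" and B: "butlast a \<in> B" by blast+
    have "butlast a @ [PInf] = a" by (rule FI_snoc_PInf_eq[OF a assms(2)])
    then show "a \<in> ?A" using B by (metis image_eqI)
  qed
  ultimately show ?thesis unfolding precell_rec.simps B I(2) using assms(1,3) I(1) by blast
qed

text \<open>If the last coordinate moves with a slope \<open>r\<close> between the slopes of the two
  bounds, both inequalities persist along the ray. Passing to a multiple of the direction makes the
  last entry integral and divisible by \<open>n\<close>, so the residue class persists too.\<close>

lemma lift_recession:
  assumes A: "A = fibred Z e k I n \<rho> (butlast ` A) b \<alpha> \<nu>" and k: "k \<in> I" "I \<subseteq> {..<Suc k}" "1 \<le> n"
    and B: "butlast ` A \<subseteq> FI Z k (I - {k})"
    and y: "y \<in> recession Z k (I - {k}) (butlast ` A)" and r: "0 \<le> r" "lam \<alpha> (I - {k}) y \<le> r"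
    and nu: "(\<forall>x\<in>butlast ` A. \<nu> x = PInf) \<or> 
      (\<exists>b' \<beta>. (\<forall>x\<in>butlast ` A. \<nu> x = Fin (b' + lin \<beta> (I - {k}) x)) \<and> r \<le> lam \<beta> (I - {k}) y)"
  shows "\<exists>y'\<in>recession Z (Suc k) I A. \<exists>D>0. (\<forall>i\<in>I - {k}. y' i = D * y i) \<and> of_nat (y' k) = of_nat D * r"
proof -
  let ?I = "I - {k}"
  have I': "?I \<subseteq> {..<k}" using k(2) by auto
  obtain a0 d where d: "0 < d" "r = of_int a0 / of_nat d" by (rule rat_obtain)
  have "0 \<le> a0" using r(1) d by (simp add: zero_le_divide_iff)
  then obtain j where j: "a0 = int j" by (rule nonneg_int_cases)
  \<comment> \<open>With \<open>r = j / d\<close>, the multiple is \<open>D = n * d\<close>, and the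
    last entry \<open>n * j\<close> equals \<open>D * r\<close>.\<close>
  define y' where "y' i = (if i = k then n * j else n * d * y i)" for i
  define t' where "t' t = nmul (n * d) t" for t :: 'a
  have nj: "nmul (n * j) t = qmul r (t' t)" for t :: 'a
    using d by (simp add: t'_def qmul_nmul' qmul_of_nat[symmetric] j mult.commute)
  have bl: "butlast (move (Suc k) I a y' t) = move k ?I (butlast a) y (t' t)" if "a \<in> A" for a t
    unfolding move_def pt_Suc
  proof (simp, rule pt_cong)
    fix i assume "i < k" "i \<in> I - {k}"
    moreover have "length a = Suc k" using that A FI_length unfolding fibred_def by blast
    ultimately show "val a i + nmul (y' i) t = val (butlast a) i + nmul (y i) (t' t)"
      using nmul_mult[of "y i" "n * d" t] by (simp add: y'_def t'_def val_butlast mult.commute)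
  qed
  have vk: "val (move (Suc k) I a y' t) k = val a k + nmul (n * j) t" for a t
    using k(1) by (simp add: y'_def)
  have "y' \<in> recession Z (Suc k) I A"
    unfolding recession_def
  proof (intro CollectI conjI allI impI ballI)
    show "y' i = 0" if "i \<notin> I" for i using that k(1) recessionD(1)[OF y, of i] by (auto simp: y'_def)
    fix a t assume a: "a \<in> A" and t: "t \<in> Z" "0 \<le> t"
    have a': "butlast a \<in> butlast ` A" using a by blast
    have aF: "a \<in> FI Z (Suc k) I" "b + lin \<alpha> ?I (butlast a) \<le> val a k"
      "ext_le (Fin (val a k)) (\<nu> (butlast a))" "val a k - nmul \<rho> e \<in> nmul n ` Z"
      using a A unfolding fibred_def by blast+
    have t': "t' t \<in> Z" "0 \<le> t' t" unfolding t'_def by (intro Z_nmul nmul_nonneg t)+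
    have in': "move k ?I (butlast a) y (t' t) \<in> butlast ` A" using recessionD(2)[OF y a' t'] .
    have "move (Suc k) I a y' t \<in> FI Z (Suc k) I"
      unfolding move_def using k(2) FI_nth_in(2)[OF aF(1)] t by (intro pt_in_FI Z_add Z_nmul) auto
    moreover have "b + lin \<alpha> ?I (move k ?I (butlast a) y (t' t)) \<le> val a k + nmul (n * j) t"
    proof -
      have "qmul (lam \<alpha> ?I y) (t' t) \<le> nmul (n * j) t"
        unfolding nj using q.scale_left_diff_distrib[of r "lam \<alpha> ?I y" "t' t"] 
          qmul_nonneg[of "r - lam \<alpha> ?I y" "t' t"] r t' by simp
      then show ?thesis unfolding lin_move[OF I'] using add_mono[OF aF(2)] by (simp add: add.assoc)
    qed
    moreover have "ext_le (Fin (val a k + nmul (n * j) t)) (\<nu> (move k ?I (butlast a) y (t' t)))"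
      using nu
    proof
      assume "\<forall>x\<in>butlast ` A. \<nu> x = PInf"
      then have "\<nu> (move k ?I (butlast a) y (t' t)) = PInf" using in' by blast
      then show ?thesis by simp
    next
      assume "\<exists>b' \<beta>. (\<forall>x\<in>butlast ` A. \<nu> x = Fin (b' + lin \<beta> ?I x)) \<and> r \<le> lam \<beta> ?I y"
      then obtain b' \<beta> where nu': "\<And>x. x \<in> butlast ` A \<Longrightarrow> \<nu> x = Fin (b' + lin \<beta> ?I x)" "r \<le> lam \<beta> ?I y"
        by blast
      have "nmul (n * j) t \<le> qmul (lam \<beta> ?I y) (t' t)"
        unfolding nj using q.scale_left_diff_distrib[of "lam \<beta> ?I y" r "t' t"] 
          qmul_nonneg[of "lam \<beta> ?I y - r" "t' t"] nu'(2) t' by simp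
      moreover have "val a k \<le> b' + lin \<beta> ?I (butlast a)" using aF(3) nu'(1)[OF a'] by simp
      ultimately have "val a k + nmul (n * j) t \<le> b' + lin \<beta> ?I (butlast a) + qmul (lam \<beta> ?I y) (t' t)"
        by (intro add_mono)
      then show ?thesis unfolding nu'(1)[OF in'] lin_move[OF I'] by (simp add: add.assoc)
    qed
    moreover have "val a k + nmul (n * j) t - nmul \<rho> e \<in> nmul n ` Z"
    proof -
      obtain w where "w \<in> Z" "val a k - nmul \<rho> e = nmul n w" using aF(4) by blast
      then have "w + nmul j t \<in> Z" "val a k + nmul (n * j) t - nmul \<rho> e = nmul n (w + nmul j t)"
        using t by (auto simp: nmul_mult nmul_add_right Z_add Z_nmul algebra_simps nmul_commute[of j n])
      then show ?thesis by blast
    qed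
    ultimately show "move (Suc k) I a y' t \<in> A" 
      using in' by (subst A, unfold fibred_def) (simp only: mem_Collect_eq bl[OF a] vk)
  qed
  moreover have "of_nat (y' k) = (of_nat (n * d) :: rat) * r" using d j by (simp add: y'_def)
  moreover have "0 < n * d" using k d by simp
  ultimately show ?thesis by (intro bexI[of _ y'] exI[of _ "n * d"]) (auto simp: y'_def)
qed

end

section \<open>A Farkas lemma for precells\<close>

context zgroup_hull
begin

lemma recession_PInf:
  assumes "y \<in> recession Z k I B" "I \<subseteq> {..<k}" "B \<subseteq> FI Z k I"
  shows "y \<in> recession Z (Suc k) I ((\<lambda>x. x @ [PInf]) ` B)"
  unfolding recession_def
proof (intro CollectI conjI allI impI ballI)
  fix a t assume a: "a \<in> (\<lambda>x. x @ [PInf]) ` B" and t: "t \<in> Z" "0 \<le> t"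
  then obtain x where x: "x \<in> B" "a = x @ [PInf]" by blast
  have len: "length x = k" using FI_length x(1) assms(3) by blast
  have "k \<notin> I" "I - {k} = I" using assms(2) by auto
  then have "move (Suc k) I a y t = move k I x y t @ [PInf]"
    unfolding move_def pt_Suc x(2) using len by (auto intro!: pt_cong)
  then show "move (Suc k) I a y t \<in> (\<lambda>x. x @ [PInf]) ` B" using recessionD(2)[OF assms(1) x(1) t] by simp
qed (use recessionD(1)[OF assms(1)] in simp)

text \<open>By Fourier--Motzkin elimination of the last coordinate.\<close>

lemma farkas:
  assumes "precell_rec Z e m N I A" "\<forall>i<length N. 1 \<le> N ! i"
  shows "\<exists>G. finite G \<and> G \<subseteq> recession Z m I A \<and> 
    (\<forall>\<alpha>. (\<forall>y\<in>G. lam \<alpha> I y \<le> 0) \<longrightarrow> (\<exists>b. \<forall>x\<in>A. lin \<alpha> I x \<le> b))"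
  using assms
proof (induction m arbitrary: N I A)
  case 0
  then have "A = {[]}" "I = {}" by auto
  then show ?case by (intro exI[of _ "{}"]) (auto simp: lin_def)
next
  case (Suc k)
  note pre = Suc.prems(1)
  have len: "length N = Suc k" using precell_rec_length[OF pre] .
  have N: "\<forall>i<length (butlast N). 1 \<le> butlast N ! i" using Suc.prems(2) len by (simp add: nth_butlast)
  have "last N = N ! k" using len by (cases N rule: rev_cases) auto
  then have n: "1 \<le> last N" using Suc.prems(2) len by simp
  show ?case
  proof (cases "k \<in> I")
    case False
    note pre' = precell_rec_PInfE[OF pre False]
    obtain G where G: "finite G" "G \<subseteq> recession Z k I (butlast ` A)"
      "\<And>\<alpha>. \<forall>y\<in>G. lam \<alpha> I y \<le> 0 \<Longrightarrow> \<exists>b. \<forall>x\<in>butlast ` A. lin \<alpha> I x \<le> b"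
      using Suc.IH[OF pre'(1) N] by blast
    note B = precell_rec_FI[OF pre'(1)] and I = precell_rec_subset[OF pre'(1)]
    have "G \<subseteq> recession Z (Suc k) I A" using G(2) recession_PInf[OF _ I B] pre'(2) by auto
    moreover have "\<exists>b. \<forall>x\<in>A. lin \<alpha> I x \<le> b" if lam: "\<forall>y\<in>G. lam \<alpha> I y \<le> 0" for \<alpha>
    proof -
      obtain b where b: "\<And>x. x \<in> butlast ` A \<Longrightarrow> lin \<alpha> I x \<le> b" using G(3)[OF lam] by blast
      have "lin \<alpha> I a \<le> b" if a: "a \<in> A" for a
      proof -
        have "length a = Suc k" using FI_length precell_rec_FI[OF pre] a by blast
        then have "lin \<alpha> I a = lin \<alpha> I (butlast a)" using I by (intro lin_cong) (auto simp: val_butlast)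
        then show ?thesis using b a by simp
      qed
      then show ?thesis by blast
    qed
    ultimately show ?thesis using G(1) by blast
  next
    case True
    let ?I = "I - {k}" and ?B = "butlast ` A"
    obtain b \<alpha> \<nu> \<rho> where pre': "precell_rec Z e k (butlast N) ?I ?B"
      and mu: "\<forall>x\<in>?B. 0 \<le> b + lin \<alpha> ?I x"
      and "largely_continuous k ?B (\<lambda>x. Fin (b + lin \<alpha> ?I x))"
      and nu: "affine_map ?I ?B \<nu>" and "nonneg_map ?B \<nu>" "largely_continuous k ?B \<nu>" "\<rho> < last N"
      and A: "A = fibred Z e k I (last N) \<rho> ?B b \<alpha> \<nu>"
      by (rule precell_rec_fibredE[OF pre True])
    note B = precell_rec_FI[OF pre'] and I' = precell_rec_subset[OF pre'] and I = precell_rec_subset[OF pre]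
    have fin: "finite ?I" "finite I" using I' I by (auto intro: finite_subset)
    obtain G where G: "finite G" "G \<subseteq> recession Z k ?I ?B"
      and Gb: "\<And>\<alpha>. \<forall>y\<in>G. lam \<alpha> ?I y \<le> 0 \<Longrightarrow> \<exists>b. \<forall>x\<in>?B. lin \<alpha> ?I x \<le> b"
      using Suc.IH[OF pre' N] by blast
    obtain x0 where x0: "x0 \<in> ?B" using precell_rec_nonempty[OF pre'] by blast
    have pos: "0 \<le> lam \<alpha> ?I y" if y: "y \<in> recession Z k ?I ?B" for y
    proof (rule nonneg_slope)
      fix t assume "t \<in> Z" "0 \<le> t"
      then have "move k ?I x0 y t \<in> ?B" using recessionD(2)[OF y x0] by blast
      then have "0 \<le> b + lin \<alpha> ?I (move k ?I x0 y t)" using mu by blast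
      then show "0 \<le> (b + lin \<alpha> ?I x0) + qmul (lam \<alpha> ?I y) t" 
        by (simp add: lin_move[OF I'] add.assoc)
    qed
    \<comment> \<open>\<open>G'\<close> contains, up to positive multiples, a lift of every
      generator of the socle; the last entry of the lift follows the slope of
      \<open>\<gamma>\<close>.\<close>
    let ?lifts = "\<lambda>G' \<gamma>. \<forall>y\<in>G. \<exists>y'\<in>G'. \<exists>D>0. (\<forall>i\<in>?I. y' i = D * y i) \<and> (of_nat (y' k) :: rat) = of_nat D * lam \<gamma> ?I y"
    have lam_split: "lam \<delta> I y = lam \<delta> ?I y + \<delta> k * of_nat (y k)" for \<delta> y
    proof -
      have "lam \<delta> I y = \<delta> k * of_nat (y k) + lam \<delta> ?I y" 
        unfolding lam_def by (rule sum.remove[OF fin(2) True])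
      then show ?thesis by (rule trans) (rule add.commute)
    qed
    have lin_split: "lin \<delta> I a = lin \<delta> ?I (butlast a) + qmul (\<delta> k) (val a k)" if a: "a \<in> A" for \<delta> a
    proof -
      have len: "length a = Suc k" using FI_length precell_rec_FI[OF pre] a by blast
      have "lin \<delta> ?I (butlast a) = lin \<delta> ?I a" 
      proof (rule lin_cong)
        fix i assume "i \<in> ?I"
        then have "i < k" using I' by blast
        then show "val (butlast a) i = val a i" using len by (intro val_butlast) simp
      qed
      moreover have "lin \<delta> I a = qmul (\<delta> k) (val a k) + lin \<delta> ?I a" 
        unfolding lin_def by (rule sum.remove[OF fin(2) True])
      ultimately show ?thesis by (simp only: add.commute)
    qed
    \<comment> \<open>The elimination: the last coordinate is replaced by the bound
      \<open>c + lin \<gamma>\<close>. The resulting form on the socle has non-positive slopes on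
      \<open>G\<close>, because up to positive factors these are the slopes of
      \<open>\<delta>\<close> along the lifts.\<close>
    have bound: "\<exists>b. \<forall>x\<in>A. lin \<delta> I x \<le> b" 
      if lifts: "?lifts G' \<gamma>" and lam: "\<forall>y\<in>G'. lam \<delta> I y \<le> 0" 
        and le: "\<And>a. a \<in> A \<Longrightarrow> qmul (\<delta> k) (val a k) \<le> qmul (\<delta> k) (c + lin \<gamma> ?I (butlast a))" for G' \<gamma> \<delta> c
    proof -
      have "lam (\<lambda>i. \<delta> i + \<delta> k * \<gamma> i) ?I y \<le> 0" if y: "y \<in> G" for y
      proof -
        obtain y' D where y': "y' \<in> G'" "0 < D" "\<forall>i\<in>?I. y' i = D * y i" 
          "(of_nat (y' k) :: rat) = of_nat D * lam \<gamma> ?I y" using lifts y by blast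
        have "lam \<delta> ?I y' = lam \<delta> ?I (\<lambda>i. D * y i)" using y'(3) by (intro lam_cong) blast
        then have "lam \<delta> I y' = of_nat D * (lam \<delta> ?I y + \<delta> k * lam \<gamma> ?I y)"
          unfolding lam_split[of \<delta> y'] lam_scale y'(4) by (simp add: algebra_simps)
        moreover have "lam \<delta> I y' \<le> 0" using lam y'(1) by blast
        ultimately show ?thesis using y'(2) unfolding lam_add_left by (simp add: mult_le_0_iff)
      qed
      then obtain b1 where b1: "\<And>x. x \<in> ?B \<Longrightarrow> lin (\<lambda>i. \<delta> i + \<delta> k * \<gamma> i) ?I x \<le> b1" 
        using Gb by blast
      have "lin \<delta> I a \<le> b1 + qmul (\<delta> k) c" if a: "a \<in> A" for a
      proof -
        have "lin \<delta> I a \<le> lin \<delta> ?I (butlast a) + qmul (\<delta> k) (c + lin \<gamma> ?I (butlast a))"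
          unfolding lin_split[OF a] using le[OF a] by (rule add_left_mono)
        also have "\<dots> = lin (\<lambda>i. \<delta> i + \<delta> k * \<gamma> i) ?I (butlast a) + qmul (\<delta> k) c"
          unfolding lin_add_left q.scale_right_distrib by (simp add: add_ac)
        also have "\<dots> \<le> b1 + qmul (\<delta> k) c" using b1 a by (intro add_right_mono) blast
        finally show ?thesis .
      qed
      then show ?thesis by blast
    qed
    note lift = lift_recession[OF A True I n B]
    have mu_le: "b + lin \<alpha> ?I (butlast a) \<le> val a k" 
      and le_nu: "ext_le (Fin (val a k)) (\<nu> (butlast a))" if "a \<in> A" for a
      using that A unfolding fibred_def by blast+
    let ?rec = "recession Z (Suc k) I A"
    have choose: "\<exists>G'. finite G' \<and> G' \<subseteq> ?rec \<and> ?lifts G' \<gamma>" if lifts: "?lifts ?rec \<gamma>" for \<gamma>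
    proof -
      obtain L where L: "\<forall>y\<in>G. L y \<in> ?rec \<and> 
        (\<exists>D>0. (\<forall>i\<in>?I. L y i = D * y i) \<and> (of_nat (L y k) :: rat) = of_nat D * lam \<gamma> ?I y)"
        using lifts by (metis (no_types, lifting))
      then have "L ` G \<subseteq> ?rec" by blast
      moreover have "?lifts (L ` G) \<gamma>" using L by blast
      ultimately show ?thesis using G(1) by blast
    qed
    show ?thesis
    proof (cases "\<forall>x\<in>?B. \<nu> x = PInf")
      case inf: True
      have "?lifts ?rec \<alpha>" using lift[OF _ pos order.refl] inf G(2) by blast
      from choose[OF this] obtain L where L: "finite L" "L \<subseteq> ?rec" "?lifts L \<alpha>" by blast
      \<comment> \<open>The vertical direction. It exists because the fibres are unbounded, and it
        forces \<open>\<delta> k \<le> 0\<close>, so that only the lower bound matters.\<close>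
      obtain v D where v: "v \<in> ?rec" "0 < D" "\<forall>i\<in>?I. v i = D * 0" "(of_nat (v k) :: rat) = of_nat D * 1"
        using lift[OF recession_zero[OF B], of 1] inf by (auto simp: lam_def)
      have "\<exists>b. \<forall>x\<in>A. lin \<delta> I x \<le> b" if lam: "\<forall>y\<in>insert v L. lam \<delta> I y \<le> 0" for \<delta>
      proof (rule bound[where G' = "L" and \<gamma> = \<alpha> and c = b])
        show "?lifts L \<alpha>" by (rule L(3))
        show "\<forall>y\<in>L. lam \<delta> I y \<le> 0" using lam by blast
        have "lam \<delta> ?I v = 0" using v(3) by (simp add: lam_def)
        then have "\<delta> k * of_nat D \<le> 0" using lam v(4) lam_split[of \<delta> v] by simp
        then have "\<delta> k \<le> 0" using v(2) by (simp add: mult_le_0_iff)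
        then show "qmul (\<delta> k) (val a k) \<le> qmul (\<delta> k) (b + lin \<alpha> ?I (butlast a))" if "a \<in> A" for a
          using mu_le[OF that] by (rule qmul_antimono)
      qed
      then show ?thesis using L v(1) by (intro exI[of _ "insert v L"]) auto
    next
      case False
      then obtain b' \<beta> where nu': "\<And>x. x \<in> ?B \<Longrightarrow> \<nu> x = Fin (b' + lin \<beta> ?I x)"
        using nu unfolding affine_map_iff by blast
      have le_nu': "val a k \<le> b' + lin \<beta> ?I (butlast a)" if "a \<in> A" for a
        using le_nu[OF that] nu'[of "butlast a"] that by simp
      \<comment> \<open>The fibres stay nonempty along a ray of the socle, so the lower bound cannot
        outgrow the upper one. Hence both slopes are admissible in
        \<open>lift_recession\<close>.\<close>
      have slope: "lam \<alpha> ?I y \<le> lam \<beta> ?I y" if y: "y \<in> recession Z k ?I ?B" for y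
      proof -
        have "0 \<le> lam \<beta> ?I y - lam \<alpha> ?I y"
        proof (rule nonneg_slope)
          fix t assume "t \<in> Z" "0 \<le> t"
          then have "move k ?I x0 y t \<in> ?B" using recessionD(2)[OF y x0] by blast
          then obtain a where "move k ?I x0 y t = butlast a" "a \<in> A" by (rule imageE)
          then have "b + lin \<alpha> ?I (move k ?I x0 y t) \<le> b' + lin \<beta> ?I (move k ?I x0 y t)"
            using mu_le[of a] le_nu'[of a] by simp
          then show "b + lin \<alpha> ?I x0 \<le> (b' + lin \<beta> ?I x0) + qmul (lam \<beta> ?I y - lam \<alpha> ?I y) t"
            unfolding lin_move[OF I'] q.scale_left_diff_distrib by (simp add: algebra_simps)
        qed
        then show ?thesis by simp
      qed
      have rec: "y \<in> recession Z k ?I ?B" if "y \<in> G" for y using G(2) that by blast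
      have "?lifts ?rec \<alpha>" using lift[OF rec pos[OF rec] order.refl] slope[OF rec] nu' by blast
      from choose[OF this] obtain L where L: "finite L" "L \<subseteq> ?rec" "?lifts L \<alpha>" by blast
      have "?lifts ?rec \<beta>"
        using lift[OF rec order.trans[OF pos[OF rec] slope[OF rec]] slope[OF rec]] nu' by blast
      from choose[OF this] obtain M where M: "finite M" "M \<subseteq> ?rec" "?lifts M \<beta>" by blast
      \<comment> \<open>The sign of \<open>\<delta> k\<close> decides which bound limits
        \<open>qmul (\<delta> k) (val a k)\<close> from above.\<close>
      have "\<exists>b. \<forall>x\<in>A. lin \<delta> I x \<le> b" if lam: "\<forall>y\<in>L \<union> M. lam \<delta> I y \<le> 0" for \<delta>
      proof (cases "\<delta> k \<le> 0")
        case True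
        show ?thesis
        proof (rule bound[where G' = "L" and \<gamma> = \<alpha> and c = b])
          show "?lifts L \<alpha>" by (rule L(3))
          show "\<forall>y\<in>L. lam \<delta> I y \<le> 0" using lam by blast
          show "qmul (\<delta> k) (val a k) \<le> qmul (\<delta> k) (b + lin \<alpha> ?I (butlast a))" if "a \<in> A" for a
            using True mu_le[OF that] by (rule qmul_antimono)
        qed
      next
        case False
        then have "0 \<le> \<delta> k" by simp
        show ?thesis
        proof (rule bound[where G' = "M" and \<gamma> = \<beta> and c = b'])
          show "?lifts M \<beta>" by (rule M(3))
          show "\<forall>y\<in>M. lam \<delta> I y \<le> 0" using lam by blast
          show "qmul (\<delta> k) (val a k) \<le> qmul (\<delta> k) (b' + lin \<beta> ?I (butlast a))" if "a \<in> A" for a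
            using \<open>0 \<le> \<delta> k\<close> le_nu'[OF that] by (rule qmul_mono)
        qed
      qed
      then show ?thesis using L M by (intro exI[of _ "L \<union> M"]) auto
    qed
  qed
qed

end

section \<open>Faces and limits along rays\<close>

text \<open>Along a ray in direction \<open>y\<close> the coordinates in \<open>J\<close> stay fixed
  and those in \<open>I - J\<close> tend to \<open>PInf\<close>, so the ray converges to the
  projection of its origin to \<open>J\<close>.\<close>

definition escapes :: "(nat \<Rightarrow> nat) \<Rightarrow> nat set \<Rightarrow> nat set \<Rightarrow> bool" where
  "escapes y I J \<longleftrightarrow> J \<subseteq> I \<and> (\<forall>i\<in>I. y i = 0 \<longleftrightarrow> i \<in> J)"

text \<open>The constant \<open>c\<close> is treated as a coordinate with index \<open>0\<close>, so indices are shifted by one.\<close>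

definition coord :: "'a::{linorder,zero} \<Rightarrow> 'a ext list \<Rightarrow> nat \<Rightarrow> 'a" where
  "coord c x i = (case i of 0 \<Rightarrow> c | Suc j \<Rightarrow> max c (val x j))"

lemma coord_simps [simp]: "coord c x 0 = c" "coord c x (Suc j) = max c (val x j)"
  by (simp_all add: coord_def)

lemma coord_ge: "c \<le> coord c x i"
  by (cases i) auto

lemma finite_bounded:
  fixes f :: "'b \<Rightarrow> 'a::linorder"
  assumes "finite S" shows "\<exists>w. \<forall>i\<in>S. f i \<le> w"
  using assms
proof (induction S)
  case (insert x S)
  then obtain w where "\<forall>i\<in>S. f i \<le> w" by blast
  then have "\<forall>i\<in>insert x S. f i \<le> max w (f x)" by (simp add: le_max_iff_disj)
  then show ?case by blast
qed simp

lemma finite_bounded_nat: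
  fixes f :: "'b \<Rightarrow> rat"
  assumes "finite S" shows "\<exists>K::nat. \<forall>i\<in>S. f i \<le> of_nat K"
proof -
  obtain w where "\<forall>i\<in>S. f i \<le> w" using finite_bounded[OF assms] by blast
  moreover obtain K :: nat where "w \<le> of_nat K" using real_arch_simple by blast
  ultimately show ?thesis by (meson order.trans)
qed

lemma lam_indicator:
  assumes "V \<subseteq> I" "finite I" shows "lam (\<lambda>j. if j \<in> V then 1 else 0) I y = of_nat (\<Sum>j\<in>V. y j)"
  using assms by (simp add: lam_def if_distrib[of "\<lambda>r. r * _"] sum.inter_restrict[symmetric] Int_absorb1 cong: if_cong)

lemma lam_single:
  assumes "i \<in> I" "finite I" shows "lam (\<lambda>j. if j = i then 1 else 0) I y = of_nat (y i)"
  using assms by (simp add: lam_def if_distrib[of "\<lambda>r. r * _"] cong: if_cong)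

context zgroup_hull
begin

lemma lin_indicator:
  assumes "V \<subseteq> I" "finite I" shows "lin (\<lambda>j. if j \<in> V then 1 else 0) I (x :: 'a ext list) = (\<Sum>j\<in>V. val x j)"
  using assms by (simp add: lin_def if_distrib[of "\<lambda>r. qmul r _"] sum.inter_restrict[symmetric] Int_absorb1 cong: if_cong)

lemma lin_single:
  assumes "i \<in> I" "finite I" shows "lin (\<lambda>j. if j = i then q else 0) I (x :: 'a ext list) = qmul q (val x i)"
  using assms by (simp add: lin_def if_distrib[of "\<lambda>r. qmul r _"] cong: if_cong)

lemma uniform_large:
  assumes "finite S" "\<And>i. i \<in> S \<Longrightarrow> \<exists>T\<in>Z. 0 \<le> T \<and> (\<forall>t\<ge>T. P i t)"
  shows "\<exists>T\<in>Z. 0 \<le> T \<and> (\<forall>t\<ge>T. \<forall>i\<in>S. P i t)"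
  using assms
proof (induction S)
  case empty
  then show ?case using Z_zero by blast
next
  case (insert j S)
  have "\<exists>T\<in>Z. 0 \<le> T \<and> (\<forall>t\<ge>T. \<forall>i\<in>S. P i t)" by (rule insert.IH) (rule insert.prems, simp)
  then obtain T where T: "T \<in> Z" "0 \<le> T" "\<forall>t\<ge>T. \<forall>i\<in>S. P i t" by blast
  have "\<exists>T\<in>Z. 0 \<le> T \<and> (\<forall>t\<ge>T. P j t)" by (rule insert.prems) simp
  then obtain T' where T': "T' \<in> Z" "0 \<le> T'" "\<forall>t\<ge>T'. P j t" by blast
  have "max T T' \<in> Z" "0 \<le> max T T'" using T T' by (auto simp: max_def)
  moreover have "\<forall>t\<ge>max T T'. \<forall>i\<in>insert j S. P i t" using T(3) T'(3) by simp
  ultimately show ?case by blast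
qed

lemma escapes_coordinates_large:
  assumes "escapes y I J" "finite I"
  shows "\<exists>T\<in>Z. 0 \<le> T \<and> (\<forall>t\<ge>T. \<forall>i\<in>I - J. w < val x i + nmul (y i) t)"
proof (rule uniform_large)
  show "\<exists>T\<in>Z. 0 \<le> T \<and> (\<forall>t\<ge>T. w < val x i + nmul (y i) t)" if "i \<in> I - J" for i
    using that assms(1) by (intro large_coordinate) (auto simp: escapes_def Suc_le_eq)
qed (use assms in simp)

lemma ray_in_nbhd:
  assumes J: "escapes y I J" and I: "I \<subseteq> {..<m}" 
    and U: "\<forall>i<m. U i \<in> basic_nbhd (pt m J (val (x::'a ext list)) ! i)"
  shows "\<exists>T\<in>Z. 0 \<le> T \<and> (\<forall>t\<ge>T. \<forall>i\<in>{..<m}. move m I x y t ! i \<in> U i)"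
proof (rule uniform_large)
  fix i assume "i \<in> {..<m}"
  then have i: "i < m" by simp
  consider "i \<in> J" | "i \<in> I - J" | "i \<notin> I" by blast
  then show "\<exists>T\<in>Z. 0 \<le> T \<and> (\<forall>t\<ge>T. move m I x y t ! i \<in> U i)"
  proof cases
    case 1
    then have "i \<in> I" "y i = 0" using J by (auto simp: escapes_def)
    then have "move m I x y t ! i = pt m J (val x) ! i" for t using 1 i by (simp add: move_def nth_pt)
    then have "move m I x y t ! i \<in> U i" for t using U i basic_nbhd_self by metis
    then show ?thesis using Z_zero by blast
  next
    case 2
    then have "U i \<in> basic_nbhd PInf" using U i by (auto simp: nth_pt)
    then obtain a where a: "\<forall>z>a. Fin z \<in> U i" using basic_nbhd_PInfD by blast
    have "1 \<le> y i" using 2 J by (auto simp: escapes_def Suc_le_eq)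
    then obtain T where T: "T \<in> Z" "0 \<le> T" "\<forall>t\<ge>T. a < val x i + nmul (y i) t" 
      using large_coordinate by blast
    have "move m I x y t ! i \<in> U i" if "T \<le> t" for t
      using 2 i T(3) a that by (simp add: move_def nth_pt)
    then show ?thesis using T by blast
  next
    case 3
    then have "i \<notin> J" using J by (auto simp: escapes_def)
    then have "move m I x y t ! i = pt m J (val x) ! i" for t using 3 i by (simp add: move_def nth_pt)
    then have "move m I x y t ! i \<in> U i" for t using U i basic_nbhd_self by metis
    then show ?thesis using Z_zero by blast
  qed
qed simp

lemma ray_limit_in_clos:
  assumes J: "escapes y I J" and I: "I \<subseteq> {..<m}" 
    and ray: "\<forall>t\<in>Z. 0 \<le> t \<longrightarrow> move m I (x::'a ext list) y t \<in> A"
  shows "pt m J (val x) \<in> clos m A"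
  unfolding clos_def
proof (intro CollectI conjI allI impI)
  fix U :: "nat \<Rightarrow> 'a ext set" assume "\<forall>i<m. U i \<in> basic_nbhd (pt m J (val x) ! i)"
  then obtain T where "T \<in> Z" "0 \<le> T" "\<forall>t\<ge>T. \<forall>i\<in>{..<m}. move m I x y t ! i \<in> U i"
    using ray_in_nbhd[OF J I] by blast
  then show "\<exists>a\<in>A. \<forall>i<m. a ! i \<in> U i" using ray by blast
qed simp

text \<open>Continuity of \<open>g\<close> at \<open>d\<close> is tested on the ray, where the form
  is its initial value plus the slope times \<open>t\<close>. This is constant or eventually exceeds
  every element, and basic neighbourhoods separate points, so \<open>g d\<close> is
  determined.\<close>

lemma limit_along_ray:
  assumes g: "cont_on m (clos m A) g" "\<forall>a\<in>A. g a = Fin (b + lin \<alpha> I a)" and A: "A \<subseteq> FI Z m I"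
    and J: "escapes y I J" and I: "I \<subseteq> {..<m}" 
    and ray: "\<forall>t\<in>Z. 0 \<le> t \<longrightarrow> move m I (x::'a ext list) y t \<in> A"
    and d: "pt m J (val x) = d"
  shows "lam \<alpha> I y = 0 \<Longrightarrow> g d = Fin (b + lin \<alpha> I x)" "0 < lam \<alpha> I y \<Longrightarrow> g d = PInf"
proof -
  let ?h = "b + lin \<alpha> I x"
  have dc: "d \<in> clos m A" using ray_limit_in_clos[OF J I ray] d by blast
  have ev: "\<exists>T\<in>Z. 0 \<le> T \<and> (\<forall>t\<in>Z. T \<le> t \<longrightarrow> Fin (?h + qmul (lam \<alpha> I y) t) \<in> V)" if V: "V \<in> basic_nbhd (g d)" for V
  proof -
    obtain U where U: "\<forall>i<m. U i \<in> basic_nbhd (d ! i)" "\<forall>y\<in>clos m A. (\<forall>i<m. y ! i \<in> U i) \<longrightarrow> g y \<in> V"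
      using g(1) dc V unfolding cont_on_def by blast
    obtain T where T: "T \<in> Z" "0 \<le> T" "\<forall>t\<ge>T. \<forall>i\<in>{..<m}. move m I x y t ! i \<in> U i"
      using ray_in_nbhd[OF J I, of U x] U(1) d by blast
    have "Fin (?h + qmul (lam \<alpha> I y) t) \<in> V" if t: "t \<in> Z" "T \<le> t" for t
    proof -
      have "move m I x y t \<in> A" using bspec[OF ray t(1)] T(2) t(2) by simp
      moreover from this have "move m I x y t \<in> clos m A" using subset_clos[OF A] by blast
      ultimately have "g (move m I x y t) \<in> V" "g (move m I x y t) = Fin (b + lin \<alpha> I (move m I x y t))"
        using U(2) T(3) t(2) g(2) by blast+
      then show ?thesis by (simp add: lin_move[OF I] add.assoc)
    qed
    then show ?thesis using T by blast
  qed
  show "g d = Fin ?h" if "lam \<alpha> I y = 0"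
  proof -
    have in_V: "Fin ?h \<in> V" if V: "V \<in> basic_nbhd (g d)" for V
    proof -
      obtain T where "T \<in> Z" "\<forall>t\<in>Z. T \<le> t \<longrightarrow> Fin (?h + qmul (lam \<alpha> I y) t) \<in> V" using ev[OF V] by blast
      then have "Fin (?h + qmul (lam \<alpha> I y) T) \<in> V" by blast
      then show ?thesis using \<open>lam \<alpha> I y = 0\<close> by simp
    qed
    show ?thesis
    proof (cases "g d")
      case (Fin w)
      have "\<not> w < ?h" using in_V[unfolded Fin, OF basic_nbhd_Fin[of "w - e" w ?h]] e_pos by auto
      moreover have "\<not> ?h < w" using in_V[unfolded Fin, OF basic_nbhd_Fin[of ?h w "w + e"]] e_pos by auto
      ultimately show ?thesis using Fin by simp
    next
      case PInf
      then show ?thesis using in_V[unfolded PInf, OF basic_nbhd_PInf[of ?h]] by simp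
    qed
  qed
  show "g d = PInf" if pos: "0 < lam \<alpha> I y"
  proof (cases "g d")
    case (Fin w)
    have "{y. ext_less (Fin (w - e)) y \<and> ext_less y (Fin (w + e))} \<in> basic_nbhd (g d)"
      unfolding Fin using e_pos by (intro basic_nbhd_Fin) auto
    from ev[OF this] obtain T where T: "T \<in> Z" "\<forall>t\<in>Z. T \<le> t \<longrightarrow> ?h + qmul (lam \<alpha> I y) t < w + e" by auto
    obtain T' where T': "T' \<in> Z" "\<forall>t\<ge>T'. w + e - ?h \<le> qmul (lam \<alpha> I y) t" 
      using large_multiple[OF pos] by blast
    have "max T T' \<in> Z" using T T' by (simp add: max_def)
    then have "?h + qmul (lam \<alpha> I y) (max T T') < w + e" using T(2) by simp
    moreover have "w + e - ?h \<le> qmul (lam \<alpha> I y) (max T T')" using T'(2) by simp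
    ultimately show ?thesis by (simp add: algebra_simps)
  qed
qed

text \<open>Both rays compute the value of one continuous extension at one limit point. Large
  continuity of the given maps is exploited in this form.\<close>

lemma largely_continuous_rays:
  assumes f: "largely_continuous m A (\<lambda>x. Fin (b + lin \<alpha> I x))" and A: "A \<subseteq> FI Z m I" and I: "I \<subseteq> {..<m}"
    and J: "escapes y I J" "escapes y' I J"
    and ray: "\<forall>t\<in>Z. 0 \<le> t \<longrightarrow> move m I (x::'a ext list) y t \<in> A"
      "\<forall>t\<in>Z. 0 \<le> t \<longrightarrow> move m I x' y' t \<in> A"
    and d: "pt m J (val x) = pt m J (val x')" 
    and pos: "0 \<le> lam \<alpha> I y" "0 \<le> lam \<alpha> I y'"
  shows "(lam \<alpha> I y = 0 \<and> lam \<alpha> I y' = 0 \<and> lin \<alpha> I x = lin \<alpha> I x') \<or> (0 < lam \<alpha> I y \<and> 0 < lam \<alpha> I y')"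
proof -
  obtain g where g: "cont_on m (clos m A) g" "\<forall>a\<in>A. g a = Fin (b + lin \<alpha> I a)"
    using f by (auto simp: largely_continuous_def)
  note 1 = limit_along_ray[OF g A J(1) I ray(1) d] and 2 = limit_along_ray[OF g A J(2) I ray(2) refl]
  consider "lam \<alpha> I y = 0" | "0 < lam \<alpha> I y" using pos by linarith
  then show ?thesis
  proof cases
    case y: 1
    then have "lam \<alpha> I y' = 0" using 1(1)[OF y] 2(2) pos by fastforce
    then show ?thesis using 1(1) 2(1) y by simp
  next
    case y: 2
    then have "0 < lam \<alpha> I y'" using 1(2)[OF y] 2(1) pos by fastforce
    then show ?thesis using y by simp
  qed
qed

text \<open>Around a finite coordinate of \<open>b\<close> the neighbourhood is chosen to contain no
  other element of \<open>Z\<close>, so an approximating point agrees with \<open>b\<close> there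
  exactly; at an infinite coordinate it exceeds the prescribed \<open>c\<close>.\<close>

lemma clos_approx:
  assumes B: "B \<subseteq> FI Z m I" and b: "b \<in> clos m B"
  shows "supp b \<subseteq> I" "\<exists>x\<in>B. b = pt m (supp b) (val x) \<and> (\<forall>i\<in>I - supp b. c < val x i)"
proof -
  have len: "length b = m" using b by (rule clos_length)
  obtain lo hi where iso: "\<And>w. lo w < w \<and> w < hi w \<and> (\<forall>z\<in>Z. lo w < z \<longrightarrow> z < hi w \<longrightarrow> z = w)"
  proof -
    have "\<exists>l h. l < w \<and> w < h \<and> (\<forall>z\<in>Z. l < z \<longrightarrow> z < h \<longrightarrow> z = w)" for w
    proof -
      obtain l h where "l < w" "w < h" "\<And>z. z \<in> Z \<Longrightarrow> l < z \<Longrightarrow> z < h \<Longrightarrow> z = w" 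
        using isolated[of w thesis] by blast
      then show ?thesis by blast
    qed
    then show ?thesis using that by metis
  qed
  define U where "U i = (case b ! i of Fin w \<Rightarrow> {y. ext_less (Fin (lo w)) y \<and> ext_less y (Fin (hi w))}
    | PInf \<Rightarrow> {y. ext_less (Fin c) y})" for i
  have "U i \<in> basic_nbhd (b ! i)" for i
    using iso by (cases "b ! i") (simp_all add: U_def basic_nbhd_PInf basic_nbhd_Fin)
  then obtain x where x: "x \<in> B" "\<forall>i<m. x ! i \<in> U i" using b unfolding clos_def by blast
  have xF: "x \<in> FI Z m I" using x(1) B by blast
  have fin: "i \<in> I \<and> b ! i = Fin (val x i)" if i: "i \<in> supp b" for i
  proof -
    have im: "i < m" "b ! i \<noteq> PInf" using i len by (auto simp: supp_def)
    then obtain w where w: "b ! i = Fin w" by (cases "b ! i") auto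
    then have xi: "ext_less (Fin (lo w)) (x ! i)" "ext_less (x ! i) (Fin (hi w))" 
      using x(2) im by (auto simp: U_def)
    then have iI: "i \<in> I" using FI_nth_notin[OF xF] im(1) by force
    then have "x ! i = Fin (val x i)" "val x i \<in> Z" using FI_nth_in[OF xF] by blast+
    then have "val x i = w" using xi iso[of w] by simp
    then show ?thesis using w iI by simp
  qed
  show "supp b \<subseteq> I" using fin by blast
  have "b = pt m (supp b) (val x)"
  proof (rule nth_equalityI)
    show "b ! i = pt m (supp b) (val x) ! i" if "i < length b" for i
      using fin[of i] that len by (auto simp: nth_pt) (simp add: supp_def)
  qed (simp add: len)
  moreover have "c < val x i" if i: "i \<in> I - supp b" for i
  proof -
    have im: "i < m" using i FI_subset[OF xF] by auto
    then have "b ! i = PInf" using i len by (auto simp: supp_def)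
    then have "ext_less (Fin c) (x ! i)" using x(2) im by (auto simp: U_def)
    then show ?thesis using FI_nth_in(1)[OF xF] i by simp
  qed
  ultimately show "\<exists>x\<in>B. b = pt m (supp b) (val x) \<and> (\<forall>i\<in>I - supp b. c < val x i)" using x(1) by blast
qed

text \<open>The candidate is the sum of all generators vanishing on the support \<open>J\<close> of
  \<open>b\<close>. If it vanished at some \<open>i\<close> in \<open>I - J\<close>, then coordinate
  \<open>i\<close> minus \<open>K\<close> times the sum over \<open>J\<close> would have
  non-positive slope on every generator and be bounded by \<open>farkas\<close>. But near
  \<open>b\<close> coordinate \<open>i\<close> is arbitrarily large while those in \<open>J\<close>
  are fixed.\<close>

lemma face_escapes:
  assumes pre: "precell_rec Z e m N I B" "\<forall>i<length N. 1 \<le> N ! i" and b: "b \<in> clos m B"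
  shows "\<exists>y\<in>recession Z m I B. escapes y I (supp b)"
proof -
  note B = precell_rec_FI[OF pre(1)] and I = precell_rec_subset[OF pre(1)]
  have fin: "finite I" using I finite_subset by blast
  let ?J = "supp b"
  have J: "?J \<subseteq> I" using clos_approx(1)[OF B b] .
  obtain G where G: "finite G" "G \<subseteq> recession Z m I B"
      and Gb: "\<And>\<alpha>. \<forall>y\<in>G. lam \<alpha> I y \<le> 0 \<Longrightarrow> \<exists>w. \<forall>x\<in>B. lin \<alpha> I x \<le> w"
    using farkas[OF pre] by blast
  define G0 where "G0 = {y\<in>G. \<forall>j\<in>?J. y j = 0}"
  define y0 where "y0 i = (\<Sum>y\<in>G0. y i)" for i
  have G0: "finite G0" "G0 \<subseteq> recession Z m I B" using G by (auto simp: G0_def)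
  have "y0 \<in> recession Z m I B" using recession_sum[OF G0 B] by (simp add: y0_def[abs_def])
  moreover have "y0 i \<noteq> 0" if i: "i \<in> I - ?J" for i
  proof
    assume "y0 i = 0"
    then have yi: "y i = 0" if "y \<in> G0" for y using that G0(1) by (simp add: y0_def)
    \<comment> \<open>\<open>K\<close> dominates the entry at \<open>i\<close> of every generator,
      and a generator outside \<open>G0\<close> has entries on \<open>?J\<close> with sum at least
      1.\<close>
    obtain K :: nat where K: "\<forall>y\<in>G. (of_nat (y i) :: rat) \<le> of_nat K" using finite_bounded_nat[OF G(1), of "\<lambda>y. of_nat (y i)"] by blast
    let ?\<alpha> = "\<lambda>j. (if j = i then 1 else 0) + (- of_nat K) * (if j \<in> ?J then 1 else 0 :: rat)"
    have "lam ?\<alpha> I y \<le> 0" if y: "y \<in> G" for y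
    proof -
      have 1: "lam (\<lambda>j. if j = i then 1 else 0) I y = of_nat (y i)"
        using i fin by (intro lam_single) simp_all
      have 2: "lam (\<lambda>j. if j \<in> ?J then 1 else 0) I y = of_nat (\<Sum>j\<in>?J. y j)"
        using J fin by (rule lam_indicator)
      show ?thesis
      proof (cases "y \<in> G0")
        case True
        then show ?thesis unfolding lam_add_left 1 2 by (simp add: yi[OF True] sum_nonneg)
      next
        case False
        then have "(\<Sum>j\<in>?J. y j) \<noteq> 0" using y J fin by (auto simp: G0_def finite_subset)
        then have "K * 1 \<le> K * (\<Sum>j\<in>?J. y j)" by (intro mult_le_mono2) simp
        moreover have "y i \<le> K * 1" using K y by simp
        ultimately have "y i \<le> K * (\<Sum>j\<in>?J. y j)" by (rule order.trans[rotated])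
        then have "(of_nat (y i) :: rat) \<le> of_nat (K * (\<Sum>j\<in>?J. y j))" by (simp only: of_nat_le_iff)
        then show ?thesis unfolding lam_add_left 1 2 by simp
      qed
    qed
    then obtain w where w: "\<forall>x\<in>B. lin ?\<alpha> I x \<le> w" using Gb by blast
    obtain x0 where x0: "x0 \<in> B" "b = pt m ?J (val x0)" using clos_approx(2)[OF B b] by blast
    have l: "lin ?\<alpha> I x = val x i - nmul K (\<Sum>j\<in>?J. val x j)" for x :: "'a ext list"
    proof -
      have 1: "lin (\<lambda>j. if j = i then 1 else 0) I x = val x i"
        using i fin by (simp add: lin_single)
      have 2: "lin (\<lambda>j. if j \<in> ?J then 1 else 0) I x = (\<Sum>j\<in>?J. val x j)"
        using J fin by (rule lin_indicator)
      show ?thesis unfolding lin_add_left 1 2 by (simp add: qmul_of_nat q.scale_minus_left)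
    qed
    obtain x where x: "x \<in> B" "b = pt m ?J (val x)" 
      "\<forall>i\<in>I - ?J. w + nmul K (\<Sum>j\<in>?J. val x0 j) < val x i" 
      using clos_approx(2)[OF B b] by blast
    have "val x j = val x0 j" if "j \<in> ?J" for j
      using x(2) x0(2) that J I pt_eq_iff[of m ?J "val x" "val x0"] by auto
    then have "(\<Sum>j\<in>?J. val x j) = (\<Sum>j\<in>?J. val x0 j)" by simp
    moreover have "val x i - nmul K (\<Sum>j\<in>?J. val x j) \<le> w" using w x(1) l by simp
    ultimately show False using x(3) i by (simp add: algebra_simps not_less[symmetric])
  qed
  moreover have "y0 i = 0" if "i \<in> ?J" for i using that by (simp add: y0_def G0_def)
  ultimately have "y0 \<in> recession Z m I B" "escapes y0 I ?J" unfolding escapes_def using J by blast+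
  then show ?thesis by blast
qed

text \<open>Let \<open>V\<close> be the coordinates that vanish in all generators of slope zero.
  Every generator of positive slope moves some coordinate in \<open>V\<close>, so the map minus a
  multiple of the sum over \<open>V\<close> has non-positive slopes. Conversely, for
  \<open>i\<close> in \<open>V\<close> coordinate \<open>i\<close> minus a multiple of the map has
  non-positive slopes. By \<open>farkas\<close> both differences are bounded, and a large
  \<open>c\<close> absorbs the bounds.\<close>

lemma comparison:
  assumes pre: "precell_rec Z e m N I A" "\<forall>i<length N. 1 \<le> N ! i" 
    and nonneg: "\<forall>x\<in>A. 0 \<le> b + lin \<alpha> I x" and cont: "largely_continuous m A (\<lambda>x. Fin (b + lin \<alpha> I x))"
  shows "\<exists>K\<ge>1. \<exists>V\<subseteq>I. \<exists>c0\<ge>0. \<forall>c\<ge>c0. \<forall>x\<in>A. 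
    (\<exists>i\<in>insert 0 (Suc ` V). b + lin \<alpha> I x \<le> nmul K (coord c x i)) \<and> 
    (\<forall>i\<in>V. coord c x (Suc i) \<le> nmul K (max (b + lin \<alpha> I x) c))"
proof -
  note A = precell_rec_FI[OF pre(1)] and I = precell_rec_subset[OF pre(1)]
  have fin: "finite I" using I finite_subset by blast
  obtain x0 where x0: "x0 \<in> A" using precell_rec_nonempty[OF pre(1)] by blast
  obtain G where G: "finite G" "G \<subseteq> recession Z m I A"
      and Gb: "\<And>\<alpha>. \<forall>y\<in>G. lam \<alpha> I y \<le> 0 \<Longrightarrow> \<exists>w. \<forall>x\<in>A. lin \<alpha> I x \<le> w"
    using farkas[OF pre] by blast
  have pos: "0 \<le> lam \<alpha> I y" if y: "y \<in> recession Z m I A" for y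
  proof (rule nonneg_slope)
    fix t assume "t \<in> Z" "0 \<le> t"
    then have "move m I x0 y t \<in> A" using recessionD(2)[OF y x0] by blast
    then have "0 \<le> b + lin \<alpha> I (move m I x0 y t)" using nonneg by blast
    then show "0 \<le> (b + lin \<alpha> I x0) + qmul (lam \<alpha> I y) t" by (simp add: lin_move[OF I] add.assoc)
  qed
  define G0 where "G0 = {y\<in>G. lam \<alpha> I y = 0}"
  define y0 where "y0 i = (\<Sum>y\<in>G0. y i)" for i
  define V where "V = {i\<in>I. y0 i = 0}"
  have V: "V \<subseteq> I" "finite V" using fin by (auto simp: V_def)
  have G0: "finite G0" "G0 \<subseteq> recession Z m I A" using G by (auto simp: G0_def)
  have y0: "y0 \<in> recession Z m I A" using recession_sum[OF G0 A] by (simp add: y0_def[abs_def])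
  have lam_y0: "lam \<alpha> I y0 = 0" using lam_sum[of \<alpha> I G0] by (simp add: y0_def[abs_def] G0_def)
  \<comment> \<open>Otherwise the rays along \<open>y0\<close> and \<open>y + y0\<close> from
    \<open>x0\<close> have the same limit, with finite part \<open>V\<close>, while the map has
    slope zero along one and positive slope along the other. Large continuity forbids this.\<close>
  have ex_V: "\<exists>i\<in>V. y i \<noteq> 0" if y: "y \<in> G" "0 < lam \<alpha> I y" for y
  proof (rule ccontr)
    assume "\<not> (\<exists>i\<in>V. y i \<noteq> 0)"
    then have "escapes (\<lambda>i. y i + y0 i) I V" "escapes y0 I V" by (auto simp: escapes_def V_def)
    moreover have yr: "(\<lambda>i. y i + y0 i) \<in> recession Z m I A" using recession_add y G(2) y0 by blast
    moreover have "lam \<alpha> I (\<lambda>i. y i + y0 i) = lam \<alpha> I y" by (simp add: lam_add lam_y0)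
    ultimately show False 
      using largely_continuous_rays[OF cont A I, of "\<lambda>i. y i + y0 i" V y0 x0 x0] lam_y0 y(2) 
        recessionD(2)[OF yr x0] recessionD(2)[OF y0 x0] by simp
  qed
  obtain K1 :: nat where K1: "\<forall>y\<in>G. lam \<alpha> I y \<le> of_nat K1" using finite_bounded_nat[OF G(1), of "lam \<alpha> I"] by blast
  let ?\<alpha>1 = "\<lambda>j. \<alpha> j + (- of_nat K1) * (if j \<in> V then 1 else 0 :: rat)"
  have lamV: "lam (\<lambda>j. if j \<in> V then 1 else 0) I y = of_nat (\<Sum>j\<in>V. y j)" for y
    using V(1) fin by (rule lam_indicator)
  have "lam ?\<alpha>1 I y \<le> 0" if y: "y \<in> G" for y
  proof (cases "lam \<alpha> I y = 0")
    case True
    then show ?thesis unfolding lam_add_left lamV by (simp add: sum_nonneg)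
  next
    case False
    then have "0 < lam \<alpha> I y" using pos y G(2) by (metis order.strict_iff_order subsetD)
    then have "(\<Sum>j\<in>V. y j) \<noteq> 0" using ex_V[OF y] V(2) by auto
    then have "K1 * 1 \<le> K1 * (\<Sum>j\<in>V. y j)" by (intro mult_le_mono2) simp
    then have "(of_nat K1 :: rat) \<le> of_nat (K1 * (\<Sum>j\<in>V. y j))" by (simp only: of_nat_le_iff mult_1_right)
    moreover have "lam \<alpha> I y \<le> of_nat K1" using K1 y by blast
    ultimately show ?thesis unfolding lam_add_left lamV by simp
  qed
  then obtain b1 where b1: "\<And>x. x \<in> A \<Longrightarrow> lin ?\<alpha>1 I x \<le> b1" using Gb by blast
  have upper: "b + lin \<alpha> I x \<le> b + b1 + nmul K1 (\<Sum>j\<in>V. val x j)" if "x \<in> A" for x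
  proof -
    have "lin (\<lambda>j. if j \<in> V then 1 else 0) I x = (\<Sum>j\<in>V. val x j)"
      using V(1) fin by (rule lin_indicator)
    then show ?thesis using b1[OF that] unfolding lin_add_left 
      by (simp add: qmul_of_nat q.scale_minus_left algebra_simps)
  qed
  \<comment> \<open>The ratio is only relevant for positive slope; division by slope zero yields 0,
    and such generators vanish on \<open>V\<close>.\<close>
  obtain K2 :: nat where K2: "\<forall>p\<in>G \<times> V. of_nat (fst p (snd p)) / lam \<alpha> I (fst p) \<le> of_nat K2"
    using finite_bounded_nat[of "G \<times> V" "\<lambda>p. of_nat (fst p (snd p)) / lam \<alpha> I (fst p)"] G(1) V(2) by blast
  have "\<exists>w. \<forall>x\<in>A. val x i \<le> w + nmul K2 (b + lin \<alpha> I x)" if i: "i \<in> V" for i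
  proof -
    let ?\<alpha>2 = "\<lambda>j. (if j = i then 1 else 0) + (- of_nat K2) * \<alpha> j"
    have iI: "i \<in> I" using i V by blast
    have "lam ?\<alpha>2 I y \<le> 0" if y: "y \<in> G" for y
    proof -
      have 1: "lam (\<lambda>j. if j = i then 1 else 0) I y = of_nat (y i)"
        using iI fin by (rule lam_single)
      show ?thesis
      proof (cases "lam \<alpha> I y = 0")
        case True
        then have "y \<in> G0" using y by (simp add: G0_def)
        moreover have "y0 i = 0" using i by (simp add: V_def)
        ultimately have "y i = 0" using G0(1) by (simp add: y0_def)
        then show ?thesis unfolding lam_add_left 1 using True by simp
      next
        case False
        then have p: "0 < lam \<alpha> I y" using pos y G(2) by (metis order.strict_iff_order subsetD)
        have "of_nat (y i) / lam \<alpha> I y \<le> of_nat K2" using bspec[OF K2, of "(y, i)"] y i by simp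
        then have "of_nat (y i) \<le> of_nat K2 * lam \<alpha> I y" using p by (simp add: divide_le_eq)
        then show ?thesis unfolding lam_add_left 1 by simp
      qed
    qed
    then obtain w where w: "\<forall>x\<in>A. lin ?\<alpha>2 I x \<le> w" using Gb by blast
    have "val x i \<le> (w - nmul K2 b) + nmul K2 (b + lin \<alpha> I x)" if "x \<in> A" for x
    proof -
      have "lin (\<lambda>j. if j = i then 1 else 0) I x = val x i"
        using iI fin by (simp add: lin_single)
      moreover have "lin ?\<alpha>2 I x \<le> w" using w that by blast
      ultimately show ?thesis unfolding lin_add_left 
        by (simp add: qmul_of_nat q.scale_minus_left nmul_add_right algebra_simps)
    qed
    then show ?thesis by blast
  qed
  then obtain w2 where w2: "\<And>i x. i \<in> V \<Longrightarrow> x \<in> A \<Longrightarrow> val x i \<le> w2 i + nmul K2 (b + lin \<alpha> I x)" by metis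
  obtain w3 where w3: "\<forall>i\<in>V. w2 i \<le> w3" using finite_bounded[OF V(2)] by blast
  \<comment> \<open>Above this threshold \<open>c\<close> dominates the additive constants of both
    estimates; this is a purpose of truncating coordinates at \<open>c\<close>.\<close>
  define c0 where "c0 = max 0 (max (b + b1) w3)"
  define K where "K = max (Suc (K1 * card V)) (Suc K2)"
  have "(\<exists>i\<in>insert 0 (Suc ` V). b + lin \<alpha> I x \<le> nmul K (coord c x i)) \<and> 
    (\<forall>i\<in>V. coord c x (Suc i) \<le> nmul K (max (b + lin \<alpha> I x) c))" if c: "c0 \<le> c" and x: "x \<in> A" for c x
  proof
    have c': "0 \<le> c" "b + b1 \<le> c" "w3 \<le> c" using c by (auto simp: c0_def)
    let ?S = "coord c x ` insert 0 (Suc ` V)"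
    have finS: "finite ?S" "?S \<noteq> {}" using V(2) by auto
    from Max_in[OF finS] obtain i where i: "Max ?S = coord c x i" "i \<in> insert 0 (Suc ` V)" by (rule imageE)
    have le: "coord c x j \<le> coord c x i" if "j \<in> insert 0 (Suc ` V)" for j
      unfolding i(1)[symmetric] using that finS(1) by (intro Max_ge) auto
    have "val x j \<le> coord c x i" if "j \<in> V" for j
      using le[of "Suc j"] that by simp
    then have "(\<Sum>j\<in>V. val x j) \<le> (\<Sum>j\<in>V. coord c x i)" by (rule sum_mono)
    also have "(\<Sum>j\<in>V. coord c x i) = nmul (card V) (coord c x i)"
      using V(2) by (induction V) (simp_all add: nmul_Suc)
    finally have "nmul K1 (\<Sum>j\<in>V. val x j) \<le> nmul (K1 * card V) (coord c x i)"
      unfolding nmul_mult by (rule nmul_mono)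
    moreover have "b + b1 \<le> coord c x i" using c'(2) coord_ge order.trans by blast
    ultimately have "b + lin \<alpha> I x \<le> nmul (Suc (K1 * card V)) (coord c x i)"
      unfolding nmul_Suc using upper[OF x] by (meson add_mono order.trans)
    also have "\<dots> \<le> nmul K (coord c x i)"
      using c'(1) coord_ge[of c x i] by (intro nmul_mono_left) (auto simp: K_def)
    finally show "\<exists>i\<in>insert 0 (Suc ` V). b + lin \<alpha> I x \<le> nmul K (coord c x i)" using i(2) by blast
    show "\<forall>i\<in>V. coord c x (Suc i) \<le> nmul K (max (b + lin \<alpha> I x) c)"
    proof
      fix i assume i: "i \<in> V"
      let ?M = "max (b + lin \<alpha> I x) c"
      have M: "0 \<le> ?M" using c'(1) by (simp add: le_max_iff_disj)
      have "val x i \<le> w2 i + nmul K2 (b + lin \<alpha> I x)" using w2 i x by blast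
      also have "w2 i \<le> ?M" using w3 i c'(3) by (metis le_max_iff_disj order.trans)
      also have "nmul K2 (b + lin \<alpha> I x) \<le> nmul K2 ?M" by (intro nmul_mono) simp
      finally have "val x i \<le> nmul (Suc K2) ?M" unfolding nmul_Suc by simp
      also have "\<dots> \<le> nmul K ?M" using M by (intro nmul_mono_left) (auto simp: K_def)
      finally have "val x i \<le> nmul K ?M" .
      moreover have "c \<le> nmul K ?M" using M le_nmul[of K ?M] by (simp add: K_def)
      ultimately show "coord c x (Suc i) \<le> nmul K ?M" by simp
    qed
  qed
  moreover have "0 \<le> c0" "1 \<le> K" by (auto simp: c0_def K_def)
  ultimately show ?thesis using V(1) by blast
qed

end

section \<open>Separated pieces\<close>

definition idx :: "nat set \<Rightarrow> nat set" where
  "idx I = insert 0 (Suc ` I)"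

text \<open>The truncated coordinates on \<open>B\<close> form blocks, ordered by the rank \<open>r\<close>: within a block they are 
  comparable up to the factor \<open>l\<close>, and different blocks are far apart compared with these factors.\<close>

definition separated :: "(nat \<Rightarrow> nat) \<Rightarrow> 'a::linordered_ab_group_add \<Rightarrow> nat set \<Rightarrow> 'a ext list set \<Rightarrow> 
    (nat \<Rightarrow> nat) \<Rightarrow> (nat \<Rightarrow> nat) \<Rightarrow> bool" where
  "separated M c I B r l \<longleftrightarrow> r 0 = 0 \<and> (\<forall>i\<in>idx I. 1 \<le> l i) \<and> 
     (\<forall>i\<in>idx I. \<forall>j\<in>idx I. r i = r j \<longrightarrow> l i = l j) \<and>
     (\<forall>x\<in>B. \<forall>i\<in>idx I. \<forall>j\<in>idx I. 
       (r i = r j \<longrightarrow> coord c x i \<le> nmul (l i) (coord c x j)) \<and>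
       (r i < r j \<longrightarrow> nmul (M (max (l i) (l j))) (coord c x i) \<le> coord c x j))"

lemma separatedD:
  assumes "separated M c I B r l"
  shows "r 0 = 0" "i \<in> idx I \<Longrightarrow> 1 \<le> l i" "i \<in> idx I \<Longrightarrow> j \<in> idx I \<Longrightarrow> r i = r j \<Longrightarrow> l i = l j"
    "x \<in> B \<Longrightarrow> i \<in> idx I \<Longrightarrow> j \<in> idx I \<Longrightarrow> r i = r j \<Longrightarrow> coord c x i \<le> nmul (l i) (coord c x j)"
    "x \<in> B \<Longrightarrow> i \<in> idx I \<Longrightarrow> j \<in> idx I \<Longrightarrow> r i < r j \<Longrightarrow> 
      nmul (M (max (l i) (l j))) (coord c x i) \<le> coord c x j"
  using assms unfolding separated_def by blast+

text \<open>Choosing the least index makes the representative depend on the block alone, so two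
  pieces with the same finite blocks on a common face cut at the same levels. Under separation,
  block 0 is represented by the constant \<open>c\<close>.\<close>

definition rep :: "nat set \<Rightarrow> (nat \<Rightarrow> nat) \<Rightarrow> nat \<Rightarrow> nat" where
  "rep I r \<kappa> = (LEAST i. i \<in> idx I \<and> r i = \<kappa>)"

text \<open>The position of a new coordinate \<open>z\<close> relative to the blocks: \<open>2\<kappa>\<close> if \<open>z\<close> is comparable with 
  block \<open>\<kappa>\<close>, and \<open>2\<kappa>+1\<close> if it lies strictly between block \<open>\<kappa>\<close> and the next one.\<close>

definition key :: "(nat \<Rightarrow> nat) \<Rightarrow> 'a::linordered_ab_group_add \<Rightarrow> nat set \<Rightarrow> (nat \<Rightarrow> nat) \<Rightarrow> (nat \<Rightarrow> nat) \<Rightarrow> 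
    'a ext list \<Rightarrow> 'a \<Rightarrow> nat" where
  "key s c I r l x z = 
     (let \<kappa> = Max {\<kappa>\<in>r ` idx I. \<kappa> = 0 \<or> coord c x (rep I r \<kappa>) < nmul (s (l (rep I r \<kappa>))) z}
      in if z \<le> nmul (s (l (rep I r \<kappa>))) (coord c x (rep I r \<kappa>)) then 2 * \<kappa> else 2 * \<kappa> + 1)"

text \<open>A coordinate beyond this factor from a block counts as separate from it, which requires
  the summand with \<open>M l\<close>. The summand \<open>3 * K\<close> places a bound comparable up
  to \<open>K * l\<close> inside the band of its block with a margin, and 3 leaves room for the
  residues.\<close>

definition cut :: "(nat \<Rightarrow> nat) \<Rightarrow> nat \<Rightarrow> nat \<Rightarrow> nat" where
  "cut M K l = l * (M l + 3 * K + 3)"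

text \<open>After a coordinate joins a block, factors are at most \<open>l * cut M K l\<close>, and
  comparing through the representative costs another \<open>cut\<close>; this explains the product
  with \<open>M\<close>. The product of \<open>cut\<close> with \<open>cut + 2\<close> keeps the
  bands of different blocks apart by a full slice, the one with \<open>K * l\<close> keeps a bound
  out of foreign bands, and \<open>K + 1\<close> keeps higher blocks above \<open>c\<close>.\<close>

definition gap :: "(nat \<Rightarrow> nat) \<Rightarrow> nat \<Rightarrow> nat \<Rightarrow> nat" where
  "gap M K l = cut M K l * (M (l * cut M K l) + cut M K l + 2 + K * l) + K + 1"

lemma nmul_trans:
  fixes a :: "'a::linordered_ab_group_add"
  assumes "a \<le> nmul m b" "b \<le> nmul q d" shows "a \<le> nmul (m * q) d"
  unfolding nmul_mult using assms(1) nmul_mono[OF assms(2)] by (rule order.trans)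

lemma nmul_absorb:
  fixes a :: "'a::linordered_ab_group_add"
  assumes "a \<le> nmul m b" "nmul q b \<le> d" "s * m \<le> q" "0 \<le> b" shows "nmul s a \<le> d"
proof -
  have "nmul s a \<le> nmul (s * m) b" unfolding nmul_mult by (rule nmul_mono[OF assms(1)])
  also have "\<dots> \<le> nmul q b" by (rule nmul_mono_left[OF assms(3,4)])
  finally show ?thesis using assms(2) by (rule order.trans)
qed

text \<open>Separation holds for \<open>gap M K\<close>, not just for \<open>M\<close>; the surplus
  is spent when one coordinate is added. As all levels are at least \<open>c\<close>, the width
  \<open>nmul n e\<close> is at most any level.\<close>

locale separated_piece = zgroup_hull Z e for Z :: "'a::linordered_ab_group_add set" and e +
  fixes M :: "nat \<Rightarrow> nat" and K n k :: nat and c :: 'a and H :: "nat set" and B :: "'a ext list set"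
    and r l :: "nat \<Rightarrow> nat"
  assumes M: "mono M" "\<And>i. 1 \<le> M i" and K: "1 \<le> K" and n: "1 \<le> n" 
    and c: "c \<in> Z" "0 < c" "nmul n e \<le> c"
    and sep: "separated (gap M K) c H B r l" and B: "B \<subseteq> FI Z k H" "B \<noteq> {}"
begin

abbreviation "ranks \<equiv> r ` idx H"
abbreviation "ht \<kappa> \<equiv> l (rep H r \<kappa>)"
abbreviation "sc \<kappa> \<equiv> cut M K (ht \<kappa>)"
abbreviation "g x \<kappa> \<equiv> coord c x (rep H r \<kappa>)"

lemma H: "H \<subseteq> {..<k}" "finite H" "finite ranks"
proof -
  show 1: "H \<subseteq> {..<k}" using B FI_subset by blast
  then show "finite H" by (rule finite_subset) simp
  then show "finite ranks" by (simp add: idx_def)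
qed

lemma cut_mono: "i \<le> j \<Longrightarrow> cut M K i \<le> cut M K j"
  unfolding cut_def using M(1) by (intro mult_le_mono add_le_mono) (auto dest: monoD)

lemma cut_ge: "M i * i \<le> cut M K i" "3 * (K * i) \<le> cut M K i" "1 \<le> i \<Longrightarrow> 3 \<le> cut M K i" 
  "i \<le> cut M K i" "1 \<le> i \<Longrightarrow> 1 \<le> cut M K i"
proof -
  show "M i * i \<le> cut M K i" "3 * (K * i) \<le> cut M K i" "i \<le> cut M K i" 
    by (simp_all add: cut_def algebra_simps)
  show 3: "3 \<le> cut M K i" if "1 \<le> i" 
    using mult_le_mono[OF that, of 3 "M i + 3 * K + 3"] by (simp add: cut_def)
  show "1 \<le> cut M K i" if "1 \<le> i" using 3[OF that] by simp
qed

lemma gap_ge: 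
  "cut M K i * M (i * cut M K i) \<le> gap M K i" "cut M K i * (cut M K i + 2) \<le> gap M K i"
  "cut M K i * (K * i) \<le> gap M K i" "K + 1 \<le> gap M K i"
  by (simp_all add: gap_def algebra_simps)

lemma rep: 
  assumes "\<kappa> \<in> ranks" shows "rep H r \<kappa> \<in> idx H" "r (rep H r \<kappa>) = \<kappa>"
proof -
  obtain i where "i \<in> idx H \<and> r i = \<kappa>" using assms by blast
  then have "rep H r \<kappa> \<in> idx H \<and> r (rep H r \<kappa>) = \<kappa>" unfolding rep_def by (rule LeastI)
  then show "rep H r \<kappa> \<in> idx H" "r (rep H r \<kappa>) = \<kappa>" by auto
qed

lemma rep_0 [simp]: "rep H r 0 = 0"
  unfolding rep_def using separatedD(1)[OF sep] by (intro Least_equality) (auto simp: idx_def)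

lemma zero_rank: "0 \<in> ranks"
  using separatedD(1)[OF sep] by (force simp: idx_def)

lemma ht_ge: "\<kappa> \<in> ranks \<Longrightarrow> 1 \<le> ht \<kappa>"
  using rep separatedD(2)[OF sep] by blast

lemma sc_ge: 
  assumes "\<kappa> \<in> ranks" shows "3 * (K * ht \<kappa>) \<le> sc \<kappa>" "3 \<le> sc \<kappa>" "1 \<le> sc \<kappa>" "0 < sc \<kappa>" "0 < K * ht \<kappa>"
    "1 \<le> K * ht \<kappa>"
  using cut_ge[of "ht \<kappa>"] ht_ge[OF assms] K by auto

lemma g_ge: "c \<le> g x \<kappa>" "0 < g x \<kappa>" "0 \<le> g x \<kappa>"
  using coord_ge[of c x] c(2) by (meson order.strict_trans2 less_imp_le)+

lemma coord_in_Z: assumes "x \<in> B" "i \<in> idx H" shows "coord c x i \<in> Z"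
proof (cases i)
  case (Suc j)
  then have "val x j \<in> Z" using assms B FI_nth_in(2) by (fastforce simp: idx_def)
  then show ?thesis using Suc c(1) by (simp add: max_def)
qed (use c in simp)

lemma g_gap: 
  assumes "x \<in> B" "\<kappa> \<in> ranks" "\<kappa>' \<in> ranks" "\<kappa> < \<kappa>'" 
  shows "nmul (gap M K (max (ht \<kappa>) (ht \<kappa>'))) (g x \<kappa>) \<le> g x \<kappa>'"
  using separatedD(5)[OF sep assms(1) rep(1)[OF assms(2)] rep(1)[OF assms(3)]] 
    rep(2)[OF assms(2)] rep(2)[OF assms(3)] assms(4) by simp

lemma gap_scales: 
  assumes "\<kappa> \<in> ranks" "\<kappa>' \<in> ranks"
  shows "sc \<kappa>' * (K * ht \<kappa>) \<le> gap M K (max (ht \<kappa>) (ht \<kappa>'))" "sc \<kappa>' * (sc \<kappa> + 2) \<le> gap M K (max (ht \<kappa>) (ht \<kappa>'))"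
    "K + 1 \<le> gap M K (max (ht \<kappa>) (ht \<kappa>'))"
proof -
  let ?m = "max (ht \<kappa>) (ht \<kappa>')"
  have "sc \<kappa>' * (K * ht \<kappa>) \<le> cut M K ?m * (K * ?m)"
    by (intro mult_le_mono cut_mono) auto
  then show "sc \<kappa>' * (K * ht \<kappa>) \<le> gap M K ?m" using gap_ge(3) by (rule order.trans)
  have "sc \<kappa>' * (sc \<kappa> + 2) \<le> cut M K ?m * (cut M K ?m + 2)"
    by (intro mult_le_mono add_le_mono cut_mono) auto
  then show "sc \<kappa>' * (sc \<kappa> + 2) \<le> gap M K ?m" using gap_ge(2) by (rule order.trans)
  show "K + 1 \<le> gap M K ?m" by (rule gap_ge(4))
qed

lemma g_gap_le:
  assumes "x \<in> B" "\<kappa> \<in> ranks" "\<kappa>' \<in> ranks" "\<kappa> < \<kappa>'" "q \<le> gap M K (max (ht \<kappa>) (ht \<kappa>'))" 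
  shows "nmul q (g x \<kappa>) \<le> g x \<kappa>'"
  using nmul_mono_left[OF assms(5) g_ge(3)] g_gap[OF assms(1-4)] by (rule order.trans)

lemma g_gaps:
  assumes "x \<in> B" "\<kappa> \<in> ranks" "\<kappa>' \<in> ranks" "\<kappa> < \<kappa>'"
  shows g_gap_K: "nmul (sc \<kappa>' * (K * ht \<kappa>)) (g x \<kappa>) \<le> g x \<kappa>'"
    and g_gap_K': "nmul (sc \<kappa> * (K * ht \<kappa>')) (g x \<kappa>) \<le> g x \<kappa>'"
    and g_gap_sc: "nmul (sc \<kappa>' * (sc \<kappa> + 2)) (g x \<kappa>) \<le> g x \<kappa>'"
    and g_gap_1: "nmul (K + 1) (g x \<kappa>) \<le> g x \<kappa>'"
  using gap_scales[OF assms(2,3)] gap_scales(1)[OF assms(3,2)] 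
  by (auto intro!: g_gap_le[OF assms] simp only: max.commute)

lemma coord_g:
  assumes "x \<in> B" "i \<in> idx H"
  shows "ht (r i) = l i" "coord c x i \<le> nmul (l i) (g x (r i))" "g x (r i) \<le> nmul (l i) (coord c x i)"
proof -
  have r: "r i \<in> ranks" using assms(2) by blast
  show 1: "ht (r i) = l i" using separatedD(3)[OF sep rep(1)[OF r] assms(2)] rep(2)[OF r] by blast
  show "coord c x i \<le> nmul (l i) (g x (r i))"
    using separatedD(4)[OF sep assms(1,2) rep(1)[OF r]] rep(2)[OF r] by simp
  show "g x (r i) \<le> nmul (l i) (coord c x i)"
    using separatedD(4)[OF sep assms(1) rep(1)[OF r] assms(2)] rep(2)[OF r] 1 by simp
qed

lemma key_cases:
  fixes x :: "'a ext list" and z :: 'a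
  obtains \<kappa> where "\<kappa> \<in> ranks" "\<kappa> = 0 \<or> g x \<kappa> < nmul (sc \<kappa>) z" 
    "\<And>\<kappa>'. \<kappa>' \<in> ranks \<Longrightarrow> \<kappa> < \<kappa>' \<Longrightarrow> nmul (sc \<kappa>') z \<le> g x \<kappa>'"
    "key (cut M K) c H r l x z = (if z \<le> nmul (sc \<kappa>) (g x \<kappa>) then 2 * \<kappa> else 2 * \<kappa> + 1)"
proof -
  let ?S = "{\<kappa>\<in>ranks. \<kappa> = 0 \<or> g x \<kappa> < nmul (sc \<kappa>) z}"
  have S: "finite ?S" "?S \<noteq> {}" using H(3) zero_rank by auto
  have "Max ?S \<in> ?S" using S by (rule Max_in)
  moreover have "nmul (sc \<kappa>') z \<le> g x \<kappa>'" if "\<kappa>' \<in> ranks" "Max ?S < \<kappa>'" for \<kappa>'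
  proof (rule ccontr)
    assume "\<not> ?thesis"
    then have "\<kappa>' \<in> ?S" using that(1) by (simp add: not_le)
    then show False using Max_ge[OF S(1)] that(2) by (simp add: not_le[symmetric])
  qed
  ultimately show ?thesis using that[of "Max ?S"] by (simp add: key_def Let_def)
qed

lemma key_in: "key (cut M K) c H r l x z div 2 \<in> ranks"
proof -
  obtain \<kappa> where "\<kappa> \<in> ranks" "key (cut M K) c H r l x z = (if z \<le> nmul (sc \<kappa>) (g x \<kappa>) then 2 * \<kappa> else 2 * \<kappa> + 1)"
    using key_cases[of x z] by metis
  then show ?thesis by (cases "z \<le> nmul (sc \<kappa>) (g x \<kappa>)") auto
qed

text \<open>The conditions determine the rank: of two candidates, the smaller one would put
  \<open>z\<close> below the lower cut of the larger one, which the larger one excludes.\<close>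

lemma key_iff:
  assumes "\<kappa> \<in> ranks"
  shows "key (cut M K) c H r l x z = 2 * \<kappa> \<longleftrightarrow> (\<kappa> = 0 \<or> g x \<kappa> < nmul (sc \<kappa>) z) \<and>
      (\<forall>\<kappa>'\<in>ranks. \<kappa> < \<kappa>' \<longrightarrow> nmul (sc \<kappa>') z \<le> g x \<kappa>') \<and> z \<le> nmul (sc \<kappa>) (g x \<kappa>)" (is ?even)
    and "key (cut M K) c H r l x z = 2 * \<kappa> + 1 \<longleftrightarrow> (\<kappa> = 0 \<or> g x \<kappa> < nmul (sc \<kappa>) z) \<and>
      (\<forall>\<kappa>'\<in>ranks. \<kappa> < \<kappa>' \<longrightarrow> nmul (sc \<kappa>') z \<le> g x \<kappa>') \<and> nmul (sc \<kappa>) (g x \<kappa>) < z" (is ?odd)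
proof -
  obtain \<tau> where 1: "\<tau> \<in> ranks" "\<tau> = 0 \<or> g x \<tau> < nmul (sc \<tau>) z" 
    and 2: "\<And>\<kappa>'. \<kappa>' \<in> ranks \<Longrightarrow> \<tau> < \<kappa>' \<Longrightarrow> nmul (sc \<kappa>') z \<le> g x \<kappa>'"
    and 3: "key (cut M K) c H r l x z = (if z \<le> nmul (sc \<tau>) (g x \<tau>) then 2 * \<tau> else 2 * \<tau> + 1)"
    by (rule key_cases[of x z]) blast
  have eq: "\<kappa> = \<tau>" if "\<kappa> = 0 \<or> g x \<kappa> < nmul (sc \<kappa>) z" "\<forall>\<kappa>'\<in>ranks. \<kappa> < \<kappa>' \<longrightarrow> nmul (sc \<kappa>') z \<le> g x \<kappa>'"
  proof (cases \<kappa> \<tau> rule: linorder_cases)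
    case less
    then have "nmul (sc \<tau>) z \<le> g x \<tau>" using that(2) 1(1) by blast
    then show ?thesis using 1(2) less by auto
  next
    case greater
    then have "nmul (sc \<kappa>) z \<le> g x \<kappa>" using 2 assms by blast
    then show ?thesis using that(1) greater by auto
  qed
  have double: "2 * \<tau> = 2 * \<kappa> \<longleftrightarrow> \<tau> = \<kappa>" "2 * \<tau> \<noteq> 2 * \<kappa> + 1" "2 * \<tau> + 1 \<noteq> 2 * \<kappa>" 
    "2 * \<tau> + 1 = 2 * \<kappa> + 1 \<longleftrightarrow> \<tau> = \<kappa>" by presburger+
  show ?even
  proof
    assume "key (cut M K) c H r l x z = 2 * \<kappa>"
    then have "\<tau> = \<kappa>" "z \<le> nmul (sc \<tau>) (g x \<tau>)" unfolding 3 using double by (auto split: if_splits)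
    then show "(\<kappa> = 0 \<or> g x \<kappa> < nmul (sc \<kappa>) z) \<and>
      (\<forall>\<kappa>'\<in>ranks. \<kappa> < \<kappa>' \<longrightarrow> nmul (sc \<kappa>') z \<le> g x \<kappa>') \<and> z \<le> nmul (sc \<kappa>) (g x \<kappa>)" using 1 2 by blast
  next
    assume *: "(\<kappa> = 0 \<or> g x \<kappa> < nmul (sc \<kappa>) z) \<and>
      (\<forall>\<kappa>'\<in>ranks. \<kappa> < \<kappa>' \<longrightarrow> nmul (sc \<kappa>') z \<le> g x \<kappa>') \<and> z \<le> nmul (sc \<kappa>) (g x \<kappa>)"
    then have "\<kappa> = \<tau>" using eq by blast
    then show "key (cut M K) c H r l x z = 2 * \<kappa>" unfolding 3 using * by simp
  qed
  show ?odd
  proof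
    assume "key (cut M K) c H r l x z = 2 * \<kappa> + 1"
    then have "\<tau> = \<kappa>" "\<not> z \<le> nmul (sc \<tau>) (g x \<tau>)" unfolding 3 using double by (auto split: if_splits)
    then show "(\<kappa> = 0 \<or> g x \<kappa> < nmul (sc \<kappa>) z) \<and>
      (\<forall>\<kappa>'\<in>ranks. \<kappa> < \<kappa>' \<longrightarrow> nmul (sc \<kappa>') z \<le> g x \<kappa>') \<and> nmul (sc \<kappa>) (g x \<kappa>) < z" 
      using 1 2 not_le by blast
  next
    assume *: "(\<kappa> = 0 \<or> g x \<kappa> < nmul (sc \<kappa>) z) \<and>
      (\<forall>\<kappa>'\<in>ranks. \<kappa> < \<kappa>' \<longrightarrow> nmul (sc \<kappa>') z \<le> g x \<kappa>') \<and> nmul (sc \<kappa>) (g x \<kappa>) < z"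
    then have "\<kappa> = \<tau>" using eq by blast
    then show "key (cut M K) c H r l x z = 2 * \<kappa> + 1" unfolding 3 using * by (simp add: not_le[symmetric])
  qed
qed

text \<open>The block is the one of highest rank met by \<open>V\<close>, counting the constant: it
  dominates the other coordinates in \<open>V\<close>, so it controls \<open>f\<close> from above,
  and any of its members in \<open>V\<close> controls \<open>f\<close> from below.\<close>

lemma comparable_with_block:
  fixes f :: "'a ext list \<Rightarrow> 'a"
  assumes V: "V \<subseteq> H" and nonneg: "\<And>x. x \<in> B \<Longrightarrow> 0 \<le> f x"
    and up: "\<And>x. x \<in> B \<Longrightarrow> \<exists>i\<in>idx V. f x \<le> nmul K (coord c x i)"
    and lo: "\<And>x i. x \<in> B \<Longrightarrow> i \<in> V \<Longrightarrow> coord c x (Suc i) \<le> nmul K (max (f x) c)"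
  shows "\<exists>p\<in>ranks. \<forall>x\<in>B. f x \<le> nmul (K * ht p) (g x p) \<and> (p \<noteq> 0 \<longrightarrow> g x p \<le> nmul (K * ht p) (f x))"
proof -
  let ?p = "Max (r ` idx V)"
  have VH: "idx V \<subseteq> idx H" using V by (auto simp: idx_def)
  have "finite V" using V H(2) by (rule finite_subset)
  then have fin: "finite (r ` idx V)" "r ` idx V \<noteq> {}" by (auto simp: idx_def)
  have p_in: "?p \<in> r ` idx V" using fin by (rule Max_in)
  then have p: "?p \<in> ranks" using VH by blast
  have "f x \<le> nmul (K * ht ?p) (g x ?p)" if x: "x \<in> B" for x
  proof -
    obtain i where i: "i \<in> idx V" "f x \<le> nmul K (coord c x i)" using up[OF x] by blast
    have iH: "i \<in> idx H" using i(1) VH by blast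
    have "r i \<le> ?p" using fin(1) i(1) by simp
    then consider "r i = ?p" | "r i < ?p" by linarith
    then have "coord c x i \<le> nmul (ht ?p) (g x ?p)"
    proof cases
      case 1
      then show ?thesis using coord_g[OF x iH] by simp
    next
      case 2
      have "nmul 1 (coord c x i) \<le> g x ?p"
      proof (rule nmul_absorb[OF coord_g(2)[OF x iH]])
        show "nmul (sc ?p * (K * ht (r i))) (g x (r i)) \<le> g x ?p" using g_gap_K[OF x _ p 2] iH by blast
        have "1 * l i \<le> sc ?p * K * l i" using sc_ge(3)[OF p] K by (intro mult_le_mono1) (simp add: Suc_le_eq)
        then show "1 * l i \<le> sc ?p * (K * ht (r i))" using coord_g(1)[OF x iH] by (simp add: mult.assoc)
      qed (rule g_ge(3))
      also have "g x ?p \<le> nmul (ht ?p) (g x ?p)" using ht_ge[OF p] g_ge(3) by (rule le_nmul)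
      finally show ?thesis by simp
    qed
    with i(2) show ?thesis by (rule nmul_trans)
  qed
  moreover have "g x ?p \<le> nmul (K * ht ?p) (f x)" if x: "x \<in> B" and p0: "?p \<noteq> 0" for x
  proof -
    obtain i where i: "i \<in> idx V" "r i = ?p" using p_in by (metis imageE)
    then have "i \<noteq> 0" using p0 separatedD(1)[OF sep] by metis
    then obtain j where j: "i = Suc j" "j \<in> V" using i(1) by (auto simp: idx_def)
    have iH: "i \<in> idx H" using i(1) VH by blast
    have "nmul (K + 1) (g x 0) \<le> g x ?p" using g_gap_1[OF x zero_rank p] p0 by simp
    have le: "coord c x i \<le> nmul K (max (f x) c)" using lo[OF x j(2)] j(1) by simp
    \<comment> \<open>Otherwise a coordinate of rank \<open>?p\<close> would be at most
      \<open>nmul K c\<close>, against the gap of at least \<open>K + 1\<close> above the block of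
      \<open>c\<close>.\<close>
    have "c < f x"
    proof (rule ccontr)
      assume "\<not> c < f x"
      then have "coord c x i \<le> nmul K c" using le by (simp add: max_def not_less split: if_splits)
      moreover have "nmul (gap M K (max (l 0) (l i))) c \<le> coord c x i"
        using separatedD(5)[OF sep x _ iH, of 0] i(2) p0 separatedD(1)[OF sep] by (simp add: idx_def)
      moreover have "nmul (K + 1) c \<le> nmul (gap M K (max (l 0) (l i))) c"
        using gap_ge(4) c(2) by (intro nmul_mono_left) auto
      ultimately have "nmul (K + 1) c \<le> nmul K c" by (meson order.trans)
      then show False using c(2) by (simp add: nmul_Suc)
    qed
    then have "coord c x i \<le> nmul K (f x)" using le by (simp add: max_def split: if_splits)
    then have "g x ?p \<le> nmul (l i * K) (f x)" using coord_g(3)[OF x iH] i(2) by (intro nmul_trans) auto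
    then show ?thesis using coord_g(1)[OF x iH] i(2) by (simp add: mult.commute)
  qed
  ultimately show ?thesis using p by blast
qed

end

section \<open>Slicing the fibres\<close>

context zgroup_hull
begin

text \<open>With a positive coefficient, the extension by \<open>PInf\<close> at \<open>PInf\<close>
  pulls basic neighbourhoods back to basic neighbourhoods. The nonconstant bounds created by cutting
  are of this kind.\<close>

lemma largely_continuous_coord:
  assumes B: "B \<subseteq> FI Z k H" and i: "i \<in> H" "i < k" and q: "0 < r"
  shows "largely_continuous k B (\<lambda>x. Fin (w + qmul r (val x i)))"
proof -
  define h where "h y = (case y of Fin v \<Rightarrow> Fin (w + qmul r v) | PInf \<Rightarrow> PInf)" for y
  have h1: "ext_less (Fin a) (h y) \<longleftrightarrow> ext_less (Fin (qmul (1 / r) (a - w))) y" for a y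
  proof (cases y)
    case (Fin v)
    have "a < w + qmul r v \<longleftrightarrow> \<not> qmul r v \<le> a - w" by (simp add: not_le algebra_simps)
    also have "\<dots> \<longleftrightarrow> qmul (1 / r) (a - w) < v" 
      using le_qmul_iff_le[OF q, of v "a - w"] by (simp add: not_le[symmetric])
    finally show ?thesis by (simp add: h_def Fin)
  qed (simp add: h_def)
  have h2: "ext_less (h y) (Fin a) \<longleftrightarrow> ext_less y (Fin (qmul (1 / r) (a - w)))" for a y
  proof (cases y)
    case (Fin v)
    have "w + qmul r v < a \<longleftrightarrow> \<not> a - w \<le> qmul r v" by (simp add: not_le algebra_simps)
    also have "\<dots> \<longleftrightarrow> v < qmul (1 / r) (a - w)" 
      using qmul_le_iff_le[OF q, of "a - w" v] by (simp add: not_le[symmetric])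
    finally show ?thesis by (simp add: h_def Fin)
  qed (simp add: h_def)
  have nb: "{y. h y \<in> V} \<in> basic_nbhd y0" if V: "V \<in> basic_nbhd (h y0)" for V y0
  proof -
    have y0: "h y0 \<in> V" using V by (rule basic_nbhd_self)
    consider a b where "V = {y. ext_less (Fin a) y \<and> ext_less y (Fin b)}" | a where "V = {y. ext_less (Fin a) y}"
      using V unfolding basic_nbhd_def by blast
    then show ?thesis
    proof cases
      case (1 a b)
      then have "{y. h y \<in> V} = {y. ext_less (Fin (qmul (1 / r) (a - w))) y \<and> ext_less y (Fin (qmul (1 / r) (b - w)))}"
        by (simp add: h1 h2)
      then show ?thesis using y0 unfolding basic_nbhd_def by blast
    next
      case (2 a)
      then have "{y. h y \<in> V} = {y. ext_less (Fin (qmul (1 / r) (a - w))) y}" by (simp add: h1)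
      then show ?thesis using y0 unfolding basic_nbhd_def by blast
    qed
  qed
  have "cont_on k (clos k B) (\<lambda>x. h (x ! i))"
    unfolding cont_on_def
  proof (intro ballI)
    fix x :: "'a ext list" and V assume V: "V \<in> basic_nbhd (h (x ! i))"
    obtain U where U: "\<And>w :: 'a ext. U w \<in> basic_nbhd w" using basic_nbhd_ex by metis
    let ?U = "\<lambda>j. if j = i then {y. h y \<in> V} else U (x ! j)"
    have "\<forall>j<k. ?U j \<in> basic_nbhd (x ! j)" using U nb[OF V] by simp
    moreover have "h (y ! i) \<in> V" if "\<forall>j<k. y ! j \<in> ?U j" for y
      using that[rule_format, OF i(2)] by simp
    ultimately show "\<exists>U. (\<forall>j<k. U j \<in> basic_nbhd (x ! j)) \<and> 
      (\<forall>y\<in>clos k B. (\<forall>j<k. y ! j \<in> U j) \<longrightarrow> h (y ! i) \<in> V)" by (intro exI[of _ ?U]) blast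
  qed
  then have "largely_continuous k B (\<lambda>x. h (x ! i))" by (rule largely_continuousI)
  then show ?thesis
  proof (rule largely_continuous_cong)
    fix x assume "x \<in> B"
    then have "x ! i = Fin (val x i)" using FI_nth_in(1) B i(1) by blast
    then show "h (x ! i) = Fin (w + qmul r (val x i))" by (simp add: h_def)
  qed
qed

end

definition affine_lc :: "nat \<Rightarrow> nat set \<Rightarrow> 'a::linordered_ab_group_add ext list set \<Rightarrow> ('a ext list \<Rightarrow> 'a) \<Rightarrow> bool" where
  "affine_lc k H B f \<longleftrightarrow> (\<exists>b \<alpha>. \<forall>x\<in>B. f x = b + lin \<alpha> H x) \<and> largely_continuous k B (\<lambda>x. Fin (f x))"

definition affine_lc_ext :: "nat \<Rightarrow> nat set \<Rightarrow> 'a::linordered_ab_group_add ext list set \<Rightarrow> ('a ext list \<Rightarrow> 'a ext) \<Rightarrow> bool" where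
  "affine_lc_ext k H B f \<longleftrightarrow> (\<forall>x\<in>B. f x = PInf) \<or> (\<exists>h. affine_lc k H B h \<and> (\<forall>x\<in>B. 0 \<le> h x \<and> f x = Fin (h x)))"

lemma affine_lc_extI: "affine_lc k H B h \<Longrightarrow> (\<And>x. x \<in> B \<Longrightarrow> 0 \<le> h x) \<Longrightarrow> affine_lc_ext k H B (\<lambda>x. Fin (h x))"
  unfolding affine_lc_ext_def by blast

context separated_piece
begin

lemma g_in_Z: "x \<in> B \<Longrightarrow> \<kappa> \<in> ranks \<Longrightarrow> g x \<kappa> \<in> Z"
  using coord_in_Z rep(1) by blast

text \<open>Truncation at \<open>c\<close> would destroy affinity, but for nonzero rank the gap
  forces the representative strictly above \<open>c\<close>, so the maximum is the coordinate
  itself.\<close>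

lemma affine_lc_level:
  assumes "\<kappa> \<in> ranks" "0 < q"
  shows "affine_lc k H B (\<lambda>x. w + qmul q (g x \<kappa>))"
proof (cases "rep H r \<kappa>")
  case 0
  have "lin (\<lambda>_. 0) H x = 0" for x :: "'a ext list" by (simp add: lin_def)
  then have "\<forall>x\<in>B. w + qmul q (g x \<kappa>) = (w + qmul q c) + lin (\<lambda>_. 0) H x" by (simp add: 0)
  moreover have "largely_continuous k B (\<lambda>x. Fin (w + qmul q (g x \<kappa>)))" 
    unfolding 0 coord_simps by (rule largely_continuous_const)
  ultimately show ?thesis unfolding affine_lc_def by blast
next
  case (Suc i)
  have i: "i \<in> H" "i < k" using rep(1)[OF assms(1)] Suc H(1) by (auto simp: idx_def)
  have "\<kappa> \<noteq> 0" using Suc by (metis rep_0 nat.distinct(1))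
  have g: "g x \<kappa> = val x i" if "x \<in> B" for x
  proof -
    have "nmul (K + 1) c \<le> g x \<kappa>" using g_gap_1[OF that zero_rank assms(1)] \<open>\<kappa> \<noteq> 0\<close> by simp
    moreover have "c < nmul (K + 1) c" using nmul_strict_mono[OF c(2), of K] K by (simp add: nmul_Suc)
    ultimately have "c < max c (val x i)" unfolding Suc coord_simps by (rule order.strict_trans2[rotated])
    then show ?thesis unfolding Suc coord_simps by (simp add: max_def split: if_splits)
  qed
  have "lin (\<lambda>j. if j = i then q else 0) H x = qmul q (val x i)" for x :: "'a ext list"
    using i(1) H(2) by (rule lin_single)
  then have "\<forall>x\<in>B. w + qmul q (g x \<kappa>) = w + lin (\<lambda>j. if j = i then q else 0) H x" using g by simp
  moreover have "largely_continuous k B (\<lambda>x. Fin (w + qmul q (g x \<kappa>)))"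
    by (rule largely_continuous_cong[OF largely_continuous_coord[OF B(1) i assms(2)]]) (simp add: g)
  ultimately show ?thesis unfolding affine_lc_def by blast
qed

lemma affine_lc_nmul_level: "\<kappa> \<in> ranks \<Longrightarrow> 0 < s \<Longrightarrow> affine_lc k H B (\<lambda>x. nmul s (g x \<kappa>) + w)"
  using affine_lc_level[of \<kappa> "of_nat s" w] by (simp add: qmul_of_nat add.commute)

lemma affine_lc_div_level: "\<kappa> \<in> ranks \<Longrightarrow> 0 < s \<Longrightarrow> affine_lc k H B (\<lambda>x. qmul (1 / of_nat s) (g x \<kappa> + w))"
  using affine_lc_level[of \<kappa> "1 / of_nat s" "qmul (1 / of_nat s) w"] by (simp add: q.scale_right_distrib add.commute)

lemma div_le_iff: "0 < s \<Longrightarrow> qmul (1 / of_nat s) (v::'a) \<le> z \<longleftrightarrow> v \<le> nmul s z"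
  and le_div_iff: "0 < s \<Longrightarrow> z \<le> qmul (1 / of_nat s) (v::'a) \<longleftrightarrow> nmul s z \<le> v"
  using qmul_le_iff_le[of "of_nat s" v z] le_qmul_iff_le[of "of_nat s" z v] by (simp_all add: qmul_of_nat)

text \<open>Turns the strict inequalities of \<open>key\<close> into the non-strict ones that define
  precells.\<close>

lemma Z_less_iff: "u \<in> Z \<Longrightarrow> v \<in> Z \<Longrightarrow> u < v \<longleftrightarrow> u + e \<le> v"
  using Z_less_imp_le e_pos by (metis add.right_neutral add_strict_left_mono order.strict_trans2)

lemma e_le_c: "e \<le> c"
  using e_least c by blast

text \<open>Because of the product of \<open>cut\<close> with \<open>cut + 2\<close> in
  \<open>gap\<close>, the upper cut of a block lies below the lower cuts of all higher blocks. A
  slice of even key is therefore limited from above by its own block only.\<close>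

lemma level_above:
  assumes "x \<in> B" "\<kappa> \<in> ranks" "\<kappa>' \<in> ranks" "\<kappa> < \<kappa>'" "z \<le> nmul (sc \<kappa>) (g x \<kappa>)" 
  shows "nmul (sc \<kappa>') z \<le> g x \<kappa>'"
  by (rule nmul_absorb[OF assms(5) g_gap_sc[OF assms(1-4)] _ g_ge(3)]) simp

end

locale slice = separated_piece +
  fixes \<mu> :: "'a ext list \<Rightarrow> 'a" and \<nu> :: "'a ext list \<Rightarrow> 'a ext" and p :: nat
  assumes mu: "affine_lc k H B \<mu>" "\<And>x. x \<in> B \<Longrightarrow> 0 \<le> \<mu> x" 
    and p: "p \<in> ranks" "\<And>x. x \<in> B \<Longrightarrow> \<mu> x \<le> nmul (K * ht p) (g x p)"
      "\<And>x. x \<in> B \<Longrightarrow> p \<noteq> 0 \<Longrightarrow> g x p \<le> nmul (K * ht p) (\<mu> x)"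
    and nu: "(\<forall>x\<in>B. \<nu> x = PInf) \<or> (\<exists>f q. affine_lc k H B f \<and> (\<forall>x\<in>B. 0 \<le> f x \<and> \<nu> x = Fin (f x)) \<and> q \<in> ranks \<and>
       (\<forall>x\<in>B. f x \<le> nmul (K * ht q) (g x q) \<and> (q \<noteq> 0 \<longrightarrow> g x q \<le> nmul (K * ht q) (f x))))"
begin

lemma mu_below:
  assumes "x \<in> B" "\<kappa> \<in> ranks" "p < \<kappa>" shows "nmul (sc \<kappa>) (\<mu> x) \<le> g x \<kappa>"
  by (rule nmul_absorb[OF p(2)[OF assms(1)] g_gap_K[OF assms(1) p(1) assms(2,3)] order.refl g_ge(3)])

text \<open>The lower bound is at most \<open>K * ht \<kappa>\<close> levels, and one more level,
  being at least \<open>c\<close>, accommodates \<open>nmul n e\<close>. So a slice from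
  \<open>\<mu>\<close> to an upper cut meets every residue class.\<close>

lemma mu_level:
  assumes x: "x \<in> B" and \<kappa>: "\<kappa> \<in> ranks" "p \<le> \<kappa>" shows "\<mu> x + nmul n e \<le> nmul (sc \<kappa>) (g x \<kappa>)"
proof -
  have ne: "nmul n e \<le> g x \<kappa>" using c(3) g_ge(1) by (rule order.trans)
  have "\<mu> x \<le> nmul (K * ht \<kappa>) (g x \<kappa>)"
  proof (cases "\<kappa> = p")
    case False
    have "\<mu> x \<le> nmul (sc \<kappa>) (\<mu> x)" using le_nmul[OF sc_ge(3)[OF \<kappa>(1)] mu(2)[OF x]] .
    also have "\<dots> \<le> g x \<kappa>" using mu_below[OF x \<kappa>(1)] False \<kappa>(2) by simp
    also have "\<dots> \<le> nmul (K * ht \<kappa>) (g x \<kappa>)" using le_nmul[OF sc_ge(6)[OF \<kappa>(1)] g_ge(3)] .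
    finally show ?thesis .
  qed (use p(2)[OF x] in simp)
  then have "\<mu> x + nmul n e \<le> nmul (K * ht \<kappa> + 1) (g x \<kappa>)" 
    unfolding nmul_add nmul_1 using ne by (rule add_mono)
  also have "\<dots> \<le> nmul (sc \<kappa>) (g x \<kappa>)" using sc_ge(1,6)[OF \<kappa>(1)] by (intro nmul_mono_left g_ge) linarith
  finally show ?thesis .
qed

lemma mu_above:
  assumes x: "x \<in> B" and p0: "p \<noteq> 0" and z: "\<mu> x \<le> z" shows "g x p < nmul (sc p) z"
proof -
  have le: "g x p \<le> nmul (K * ht p) z" using p(3)[OF x p0] nmul_mono[OF z] by (rule order.trans)
  have z0: "0 \<le> z" using mu(2)[OF x] z by (rule order.trans)
  have "g x p < g x p + g x p" using g_ge(2) by simp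
  also have "\<dots> \<le> nmul (K * ht p + K * ht p) z" unfolding nmul_add using le le by (rule add_mono)
  also have "\<dots> \<le> nmul (sc p) z" using sc_ge(1)[OF p(1)] z0 by (intro nmul_mono_left) simp_all
  finally show ?thesis .
qed

text \<open>Each end of a slice is either an original bound or a cut. Which of the two is binding
  depends only on the positions of \<open>\<mu>\<close> and \<open>\<nu>\<close> among the blocks,
  hence is the same over all of \<open>B\<close>. Cuts of different blocks, and a bound and a cut of
  its block, are at least \<open>nmul n e\<close> apart. Only the uncut fibre from
  \<open>\<mu>\<close> to \<open>\<nu>\<close> may be narrower, and its projection is full for
  another reason.\<close>

lemma slice_bounds:
  assumes x0: "x0 \<in> B" "\<mu> x0 \<le> z0" "ext_le (Fin z0) (\<nu> x0)" 
  shows "\<exists>lo up. affine_lc k H B lo \<and> (\<forall>x\<in>B. 0 \<le> lo x) \<and> affine_lc_ext k H B up \<and>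
    (\<forall>x\<in>B. \<forall>z\<in>Z. (\<mu> x \<le> z \<and> ext_le (Fin z) (\<nu> x) \<and> key (cut M K) c H r l x z = key (cut M K) c H r l x0 z0) \<longleftrightarrow> 
       (lo x \<le> z \<and> ext_le (Fin z) (up x))) \<and>
    ((lo = \<mu> \<and> up = \<nu>) \<or> (\<forall>x\<in>B. ext_le (Fin (lo x + nmul n e)) (up x)))"
proof -
  define \<kappa> where "\<kappa> = key (cut M K) c H r l x0 z0 div 2"
  have \<kappa>: "\<kappa> \<in> ranks" using key_in by (simp add: \<kappa>_def)
  let ?key = "\<lambda>x z. key (cut M K) c H r l x z"
  have eo: "?key x0 z0 = 2 * \<kappa> \<or> ?key x0 z0 = 2 * \<kappa> + 1" unfolding \<kappa>_def by presburger
  then have k0: "\<kappa> = 0 \<or> g x0 \<kappa> < nmul (sc \<kappa>) z0" "\<forall>\<kappa>'\<in>ranks. \<kappa> < \<kappa>' \<longrightarrow> nmul (sc \<kappa>') z0 \<le> g x0 \<kappa>'"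
    using key_iff[OF \<kappa>, of x0 z0] by blast+
  \<comment> \<open>For \<open>p \<noteq> 0\<close>, everything above \<open>\<mu>\<close> is above
    the lower cut of block \<open>p\<close>, so a key below block \<open>p\<close> does not
    occur.\<close>
  have p\<kappa>: "p \<le> \<kappa>"
  proof (rule ccontr)
    assume "\<not> p \<le> \<kappa>"
    then have "g x0 p < nmul (sc p) z0" "nmul (sc p) z0 \<le> g x0 p" using mu_above[OF x0(1) _ x0(2)] k0(2) p(1) by auto
    then show False by simp
  qed
  note s = sc_ge[OF \<kappa>]
  have nonneg_level: "0 \<le> nmul (sc \<kappa>') (g x \<kappa>')" for x \<kappa>' by (intro nmul_nonneg g_ge)
  consider (inf) "\<forall>x\<in>B. \<nu> x = PInf" | 
    (fin) f q where "affine_lc k H B f" "\<forall>x\<in>B. 0 \<le> f x \<and> \<nu> x = Fin (f x)" "q \<in> ranks"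
       "\<forall>x\<in>B. f x \<le> nmul (K * ht q) (g x q) \<and> (q \<noteq> 0 \<longrightarrow> g x q \<le> nmul (K * ht q) (f x))"
    using nu by blast
  note nu_cases = this
  have nu_ext: "affine_lc_ext k H B \<nu>" using nu unfolding affine_lc_ext_def by blast
  \<comment> \<open>\<open>top\<close> says that \<open>\<nu>\<close> fails to reach the upper cut
    somewhere. As a finite \<open>\<nu>\<close> is comparable with a single block, it then stays
    below that cut everywhere, which is \<open>nu_top\<close>.\<close>
  define top where "top \<longleftrightarrow> (\<exists>x\<in>B. \<not> ext_le (Fin (nmul (sc \<kappa>) (g x \<kappa>))) (\<nu> x))"
  have nu_top: "z \<le> nmul (sc \<kappa>) (g x \<kappa>)" if tp: "top" and x: "x \<in> B" and z: "ext_le (Fin z) (\<nu> x)" for x z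
    using nu_cases
  proof cases
    case inf
    then show ?thesis using tp by (auto simp: top_def)
  next
    case (fin f q)
    have nu_f: "\<And>x. x \<in> B \<Longrightarrow> \<nu> x = Fin (f x)" using fin(2) by blast
    have "q \<le> \<kappa>"
    proof (rule ccontr)
      assume "\<not> q \<le> \<kappa>"
      then have q\<kappa>: "\<kappa> < q" "q \<noteq> 0" by auto
      have "nmul (sc \<kappa>) (g x \<kappa>) \<le> f x" if x: "x \<in> B" for x
      proof -
        have "nmul (K * ht q) (nmul (sc \<kappa>) (g x \<kappa>)) \<le> g x q" 
          using g_gap_K'[OF x \<kappa> fin(3) q\<kappa>(1)] unfolding nmul_mult[symmetric] by (simp add: mult.commute)
        also have "\<dots> \<le> nmul (K * ht q) (f x)" using fin(4) x q\<kappa>(2) by blast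
        finally show ?thesis using nmul_le_iff[OF sc_ge(5)[OF fin(3)]] by blast
      qed
      then show False using tp nu_f by (auto simp: top_def)
    qed
    have "z \<le> nmul (K * ht q) (g x q)" using z nu_f[OF x] fin(4) x by (auto intro: order.trans)
    also have "\<dots> \<le> nmul (sc \<kappa>) (g x \<kappa>)"
    proof (cases "q = \<kappa>")
      case True
      show ?thesis unfolding True using s(1) by (intro nmul_mono_left g_ge) linarith
    next
      case False
      then have "nmul (sc \<kappa> * (K * ht q)) (g x q) \<le> g x \<kappa>" using \<open>q \<le> \<kappa>\<close> g_gap_K[OF x fin(3) \<kappa>] by simp
      moreover have "nmul (K * ht q) (g x q) \<le> nmul (sc \<kappa> * (K * ht q)) (g x q)"
        using s(3) by (intro nmul_mono_left g_ge) simp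
      moreover have "g x \<kappa> \<le> nmul (sc \<kappa>) (g x \<kappa>)" using le_nmul[OF s(3) g_ge(3)] .
      ultimately show ?thesis by (meson order.trans)
    qed
    finally show ?thesis .
  qed
  show ?thesis using eo
  proof
    assume key: "?key x0 z0 = 2 * \<kappa>"
    have key_even: "?key x z = 2 * \<kappa> \<longleftrightarrow> (\<kappa> = 0 \<or> g x \<kappa> < nmul (sc \<kappa>) z) \<and> z \<le> nmul (sc \<kappa>) (g x \<kappa>)" if "x \<in> B" for x z
      using key_iff(1)[OF \<kappa>, of x z] level_above[OF that \<kappa>, of _ z] by blast
    \<comment> \<open>The summand \<open>e\<close> encodes the strict inequality at the lower cut.
      For \<open>\<kappa> = p\<close> that cut is implied by \<open>\<mu>\<close>; for larger
      \<open>\<kappa>\<close> the cut implies \<open>\<mu>\<close>.\<close>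
    define lo where "lo = (if \<kappa> = p then \<mu> else (\<lambda>x. qmul (1 / of_nat (sc \<kappa>)) (g x \<kappa> + e)))"
    define up where "up = (if top then \<nu> else (\<lambda>x. Fin (nmul (sc \<kappa>) (g x \<kappa>) + 0)))"
    have ge: "0 \<le> g x \<kappa> + e" for x using g_ge(3) e_pos by (meson add_nonneg_nonneg less_imp_le)
    have lo1: "affine_lc k H B lo" using mu(1) affine_lc_div_level[OF \<kappa> s(4)] by (simp add: lo_def)
    have lo2: "\<forall>x\<in>B. 0 \<le> lo x" using mu(2) ge by (simp add: lo_def qmul_nonneg)
    have up1: "affine_lc_ext k H B up"
      using nu_ext affine_lc_extI[OF affine_lc_nmul_level[OF \<kappa> s(4), of 0]] nonneg_level by (simp add: up_def)
    have lower: "(\<mu> x \<le> z \<and> (\<kappa> = 0 \<or> g x \<kappa> < nmul (sc \<kappa>) z)) \<longleftrightarrow> lo x \<le> z" if x: "x \<in> B" and z: "z \<in> Z" for x z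
    proof (cases "\<kappa> = p")
      case True
      then show ?thesis using mu_above[OF x, of z] by (auto simp: lo_def)
    next
      case False
      then have \<kappa>p: "p < \<kappa>" using p\<kappa> by simp
      have "\<mu> x \<le> z" if "g x \<kappa> < nmul (sc \<kappa>) z"
      proof -
        have "nmul (sc \<kappa>) (\<mu> x) < nmul (sc \<kappa>) z" using mu_below[OF x \<kappa> \<kappa>p] that by (rule order.strict_trans1)
        then show ?thesis by (rule nmul_less_iff[OF s(4), THEN iffD1, THEN less_imp_le])
      qed
      moreover have "g x \<kappa> < nmul (sc \<kappa>) z \<longleftrightarrow> g x \<kappa> + e \<le> nmul (sc \<kappa>) z"
        using g_in_Z[OF x \<kappa>] Z_nmul[OF z] by (rule Z_less_iff)
      ultimately show ?thesis using \<kappa>p div_le_iff[OF s(4), of "g x \<kappa> + e" z] by (auto simp: lo_def)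
    qed
    have upper: "(ext_le (Fin z) (\<nu> x) \<and> z \<le> nmul (sc \<kappa>) (g x \<kappa>)) \<longleftrightarrow> ext_le (Fin z) (up x)" if x: "x \<in> B" for x z
    proof (cases top)
      case True
      then show ?thesis using nu_top[OF True x] by (auto simp: up_def)
    next
      case False
      then have "ext_le (Fin (nmul (sc \<kappa>) (g x \<kappa>))) (\<nu> x)" using x by (auto simp: top_def)
      then have "z \<le> nmul (sc \<kappa>) (g x \<kappa>) \<Longrightarrow> ext_le (Fin z) (\<nu> x)" by (cases "\<nu> x") auto
      then show ?thesis using False by (auto simp: up_def)
    qed
    have "(lo = \<mu> \<and> up = \<nu>) \<or> (\<forall>x\<in>B. ext_le (Fin (lo x + nmul n e)) (up x))"
    proof (cases "\<kappa> = p")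
      case True
      show ?thesis
      proof (cases top)
        case tp: True
        then show ?thesis using True by (simp add: lo_def up_def)
      next
        case False
        then show ?thesis using True mu_level[OF _ \<kappa> p\<kappa>] by (simp add: lo_def up_def)
      qed
    next
      case False
      then have \<kappa>p: "p < \<kappa>" using p\<kappa> by simp
      \<comment> \<open>Each of the two shifts costs at most one further level, which accounts for
        the factor 3 in \<open>cut\<close>.\<close>
      have three: "g x \<kappa> + e + nmul (sc \<kappa>) (nmul n e) \<le> nmul 3 (g x \<kappa>)" if x: "x \<in> B" for x
      proof -
        have "e \<le> g x \<kappa>" using e_le_c g_ge(1) by (rule order.trans)
        moreover have "nmul (sc \<kappa>) (nmul n e) \<le> g x \<kappa>"
        proof (rule nmul_absorb[of _ 1])
          show "nmul n e \<le> nmul 1 (g x p)" using c(3) g_ge(1)[of x p] by simp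
          show "nmul (sc \<kappa> * (sc p + 2)) (g x p) \<le> g x \<kappa>" by (rule g_gap_sc[OF x p(1) \<kappa> \<kappa>p])
        qed (simp_all add: g_ge)
        ultimately have "g x \<kappa> + e + nmul (sc \<kappa>) (nmul n e) \<le> g x \<kappa> + g x \<kappa> + g x \<kappa>" by (intro add_mono order.refl)
        then show ?thesis by (simp add: numeral_3_eq_3 nmul_Suc add.assoc)
      qed
      have scale: "qmul (1 / of_nat (sc \<kappa>)) (g x \<kappa> + e) + nmul n e \<le> h" 
        if x: "x \<in> B" and h: "nmul 3 (g x \<kappa>) \<le> nmul (sc \<kappa>) h" for x h
      proof -
        have "g x \<kappa> + e \<le> nmul (sc \<kappa>) h - nmul (sc \<kappa>) (nmul n e)"
          using order.trans[OF three[OF x] h] by (simp add: algebra_simps)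
        then have "qmul (1 / of_nat (sc \<kappa>)) (g x \<kappa> + e) \<le> h - nmul n e"
          unfolding div_le_iff[OF s(4)] nmul_diff_right .
        then show ?thesis by (simp add: algebra_simps)
      qed
      have "ext_le (Fin (lo x + nmul n e)) (up x)" if x: "x \<in> B" for x
      proof (cases top)
        case True
        show ?thesis using nu_cases
        proof cases
          case inf
          then show ?thesis using True x by (simp add: up_def)
        next
          case (fin f q)
          \<comment> \<open>The block \<open>q\<close> of \<open>\<nu>\<close> must be
            \<open>\<kappa>\<close>: a higher one would carry \<open>\<nu>\<close> past the upper
            cut, against \<open>top\<close>; a lower one would keep \<open>z0\<close> below the
            lower cut.\<close>
          have "\<not> \<kappa> < q"
          proof
            assume q\<kappa>: "\<kappa> < q"
            obtain x1 where x1: "x1 \<in> B" "\<not> nmul (sc \<kappa>) (g x1 \<kappa>) \<le> f x1" using True fin(2) by (auto simp: top_def)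
            have "nmul (K * ht q) (nmul (sc \<kappa>) (g x1 \<kappa>)) \<le> g x1 q" 
              using g_gap_K'[OF x1(1) \<kappa> fin(3) q\<kappa>] unfolding nmul_mult[symmetric] by (simp add: mult.commute)
            also have "\<dots> \<le> nmul (K * ht q) (f x1)" using fin(4) x1(1) q\<kappa> by auto
            finally show False using nmul_le_iff[OF sc_ge(5)[OF fin(3)]] x1(2) by blast
          qed
          moreover have "\<not> q < \<kappa>"
          proof
            assume q\<kappa>: "q < \<kappa>"
            have "z0 \<le> f x0" using x0(1,3) fin(2) by simp
            then have "z0 \<le> nmul (K * ht q) (g x0 q)" using fin(4) x0(1) by (meson order.trans)
            then have "nmul (sc \<kappa>) z0 \<le> g x0 \<kappa>" 
              using nmul_absorb[OF _ g_gap_K[OF x0(1) fin(3) \<kappa> q\<kappa>] order.refl g_ge(3)] by blast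
            then show False using k0(1) q\<kappa> by simp
          qed
          ultimately have q: "q = \<kappa>" by simp
          have f0: "0 \<le> f x" using fin(2) x by blast
          have "nmul 3 (g x \<kappa>) \<le> nmul 3 (nmul (K * ht \<kappa>) (f x))" 
            using fin(4) x q \<kappa>p by (intro nmul_mono) auto
          also have "\<dots> \<le> nmul (sc \<kappa>) (f x)" unfolding nmul_mult[symmetric] using s(1) f0 by (intro nmul_mono_left)
          finally show ?thesis using scale[OF x] \<kappa>p True fin(2) x by (simp add: lo_def up_def)
        qed
      next
        case False
        have "nmul 3 (g x \<kappa>) \<le> nmul (sc \<kappa>) (nmul (sc \<kappa>) (g x \<kappa>))"
          unfolding nmul_mult[symmetric] using mult_le_mono[OF s(2,3)] by (intro nmul_mono_left g_ge) simp
        then show ?thesis using scale[OF x] \<kappa>p False by (simp add: lo_def up_def)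
      qed
      then show ?thesis by blast
    qed
    moreover have "\<forall>x\<in>B. \<forall>z\<in>Z. (\<mu> x \<le> z \<and> ext_le (Fin z) (\<nu> x) \<and> ?key x z = ?key x0 z0) \<longleftrightarrow> 
       (lo x \<le> z \<and> ext_le (Fin z) (up x))"
      using lower upper key_even unfolding key by blast
    ultimately show ?thesis using lo1 lo2 up1 by blast
  next
    assume key: "?key x0 z0 = 2 * \<kappa> + 1"
    then have z0: "nmul (sc \<kappa>) (g x0 \<kappa>) < z0" using key_iff(2)[OF \<kappa>] by blast
    \<comment> \<open>The given point itself lies between \<open>\<nu>\<close> and the upper
      cut.\<close>
    have top: "\<not> top" using nu_top[OF _ x0(1,3)] z0 by (auto simp: not_le[symmetric])
    define lo where "lo = (\<lambda>x. nmul (sc \<kappa>) (g x \<kappa>) + e)"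
    have lo1: "affine_lc k H B lo" unfolding lo_def by (rule affine_lc_nmul_level[OF \<kappa> s(4)])
    have lo2: "\<forall>x\<in>B. 0 \<le> lo x" 
      unfolding lo_def using nonneg_level e_pos by (meson add_nonneg_nonneg less_imp_le)
    have lower: "\<mu> x \<le> z \<and> (\<kappa> = 0 \<or> g x \<kappa> < nmul (sc \<kappa>) z) \<and> nmul (sc \<kappa>) (g x \<kappa>) < z \<longleftrightarrow> lo x \<le> z" 
      if x: "x \<in> B" and z: "z \<in> Z" for x z
    proof -
      have "\<mu> x \<le> z" "g x \<kappa> < nmul (sc \<kappa>) z" if less: "nmul (sc \<kappa>) (g x \<kappa>) < z"
      proof -
        have "0 \<le> nmul n e" using e_pos by (intro nmul_nonneg) simp
        then have "\<mu> x \<le> nmul (sc \<kappa>) (g x \<kappa>)" 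
          using mu_level[OF x \<kappa> p\<kappa>] by (meson add_increasing2 order.refl order.trans le_add_same_cancel1)
        then show "\<mu> x \<le> z" using less by simp
        have "g x \<kappa> \<le> nmul (sc \<kappa>) (g x \<kappa>)" using le_nmul[OF s(3) g_ge(3)] .
        also note less
        also have "z \<le> nmul (sc \<kappa>) z" using nonneg_level less by (intro le_nmul s) (meson order.trans less_imp_le)
        finally show "g x \<kappa> < nmul (sc \<kappa>) z" .
      qed
      moreover have "nmul (sc \<kappa>) (g x \<kappa>) < z \<longleftrightarrow> lo x \<le> z"
        unfolding lo_def using Z_nmul[OF g_in_Z[OF x \<kappa>]] z by (rule Z_less_iff)
      ultimately show ?thesis by blast
    qed
    let ?R = "{\<kappa>'\<in>ranks. \<kappa> < \<kappa>'}"
    show ?thesis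
    proof (cases "?R = {}")
      case True
      \<comment> \<open>Above the highest block only unbounded fibres have points, since a finite
        \<open>\<nu>\<close> is inside the band of some block and could not exceed
        \<open>z0\<close>.\<close>
      have "\<forall>x\<in>B. \<nu> x = PInf" using nu_cases
      proof cases
        case (fin f q)
        have "q \<le> \<kappa>" using True fin(3) by (auto simp: not_less[symmetric])
        have "z0 \<le> f x0" using x0(1,3) fin(2) by simp
        then have "z0 \<le> nmul (K * ht q) (g x0 q)" using fin(4) x0(1) by (meson order.trans)
        also have "\<dots> \<le> nmul (sc q) (g x0 q)" using sc_ge(1)[OF fin(3)] by (intro nmul_mono_left g_ge) simp
        finally have z0q: "z0 \<le> nmul (sc q) (g x0 q)" .
        show ?thesis
        proof (cases "q = \<kappa>")
          case False
          then have "nmul (sc \<kappa>) z0 \<le> g x0 \<kappa>" using level_above[OF x0(1) fin(3) \<kappa> _ z0q] \<open>q \<le> \<kappa>\<close> by simp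
          then show ?thesis using k0(1) False \<open>q \<le> \<kappa>\<close> by auto
        qed (use z0 z0q in auto)
      qed
      moreover have "?key x z = 2 * \<kappa> + 1 \<longleftrightarrow> (\<kappa> = 0 \<or> g x \<kappa> < nmul (sc \<kappa>) z) \<and> nmul (sc \<kappa>) (g x \<kappa>) < z" for x z
        using key_iff(2)[OF \<kappa>, of x z] True by blast
      ultimately have "\<forall>x\<in>B. \<forall>z\<in>Z. (\<mu> x \<le> z \<and> ext_le (Fin z) (\<nu> x) \<and> ?key x z = ?key x0 z0) \<longleftrightarrow> 
       (lo x \<le> z \<and> ext_le (Fin z) PInf)"
        using lower unfolding key by simp
      moreover have "affine_lc_ext k H B (\<lambda>_. PInf)" by (simp add: affine_lc_ext_def)
      moreover have "\<forall>x\<in>B. ext_le (Fin (lo x + nmul n e)) PInf" by simp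
      ultimately show ?thesis using lo1 lo2 by (intro exI[of _ lo] exI[of _ "\<lambda>_. PInf"] conjI) blast+
    next
      case False
      \<comment> \<open>Only the next block limits the slice: below its lower cut one is below those
        of all higher blocks, and also below \<open>\<nu>\<close>.\<close>
      define \<tau> where "\<tau> = Min ?R"
      have R: "finite ?R" using H(3) by simp
      have "\<tau> \<in> ?R" using Min_in[OF R False] by (simp add: \<tau>_def)
      then have \<tau>: "\<tau> \<in> ranks" "\<kappa> < \<tau>" by auto
      have \<tau>_le: "\<tau> \<le> \<kappa>'" if "\<kappa>' \<in> ranks" "\<kappa> < \<kappa>'" for \<kappa>' using Min_le[OF R] that by (simp add: \<tau>_def)
      note t = sc_ge[OF \<tau>(1)]
      define h where "h = (\<lambda>x. qmul (1 / of_nat (sc \<tau>)) (g x \<tau> + 0))"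
      have h_iff: "z \<le> h x \<longleftrightarrow> nmul (sc \<tau>) z \<le> g x \<tau>" for x z
        unfolding h_def using le_div_iff[OF t(4)] by simp
      have h1: "affine_lc k H B h" unfolding h_def by (rule affine_lc_div_level[OF \<tau>(1) t(4)])
      have h2: "0 \<le> h x" for x unfolding h_iff using g_ge(3) by simp
      have above: "(\<forall>\<kappa>'\<in>ranks. \<kappa> < \<kappa>' \<longrightarrow> nmul (sc \<kappa>') z \<le> g x \<kappa>') \<longleftrightarrow> z \<le> h x" if x: "x \<in> B" and z: "0 \<le> z" for x z
      proof
        assume le: "z \<le> h x"
        then have "nmul (sc \<tau>) z \<le> g x \<tau>" by (simp add: h_iff)
        then have "z \<le> g x \<tau>" using le_nmul[OF t(3) z] by (rule order.trans[rotated])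
        then have z': "z \<le> nmul (sc \<tau>) (g x \<tau>)" using le_nmul[OF t(3) g_ge(3)] by (rule order.trans)
        show "\<forall>\<kappa>'\<in>ranks. \<kappa> < \<kappa>' \<longrightarrow> nmul (sc \<kappa>') z \<le> g x \<kappa>'"
        proof (intro ballI impI)
          fix \<kappa>' assume \<kappa>': "\<kappa>' \<in> ranks" "\<kappa> < \<kappa>'"
          show "nmul (sc \<kappa>') z \<le> g x \<kappa>'"
          proof (cases "\<kappa>' = \<tau>")
            case False
            then show ?thesis using level_above[OF x \<tau>(1) \<kappa>'(1) _ z'] \<tau>_le[OF \<kappa>'] by simp
          qed (use le in \<open>simp add: h_iff\<close>)
        qed
      next
        assume "\<forall>\<kappa>'\<in>ranks. \<kappa> < \<kappa>' \<longrightarrow> nmul (sc \<kappa>') z \<le> g x \<kappa>'"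
        then have "nmul (sc \<tau>) z \<le> g x \<tau>" using \<tau> by blast
        then show "z \<le> h x" by (simp only: h_iff)
      qed
      have nu_h: "ext_le (Fin z) (\<nu> x)" if x: "x \<in> B" and z: "0 \<le> z" "z \<le> h x" for x z
        using nu_cases
      proof cases
        case (fin f q)
        have "\<kappa> < q"
        proof (rule ccontr)
          assume "\<not> \<kappa> < q"
          have "z0 \<le> f x0" using x0(1,3) fin(2) by simp
          then have "z0 \<le> nmul (K * ht q) (g x0 q)" using fin(4) x0(1) by (meson order.trans)
          also have "\<dots> \<le> nmul (sc q) (g x0 q)" using sc_ge(1)[OF fin(3)] by (intro nmul_mono_left g_ge) simp
          finally have z0q: "z0 \<le> nmul (sc q) (g x0 q)" .
          show False
          proof (cases "q = \<kappa>")
            case False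
            then have "nmul (sc \<kappa>) z0 \<le> g x0 \<kappa>" using level_above[OF x0(1) fin(3) \<kappa> _ z0q] \<open>\<not> \<kappa> < q\<close> by simp
            then show ?thesis using k0(1) False \<open>\<not> \<kappa> < q\<close> by auto
          qed (use z0 z0q in auto)
        qed
        then have q: "nmul (sc q) z \<le> g x q" "q \<noteq> 0" using above[OF x z(1)] z(2) fin(3) by auto
        have "nmul (K * ht q) z \<le> nmul (sc q) z" using sc_ge(1)[OF fin(3)] z(1) by (intro nmul_mono_left) simp_all
        also note q(1)
        also have "g x q \<le> nmul (K * ht q) (f x)" using fin(4) x q(2) by blast
        finally have "z \<le> f x" using nmul_le_iff[OF sc_ge(5)[OF fin(3)]] by blast
        then show ?thesis using fin(2) x by simp
      qed (use x in simp)
      have "(\<mu> x \<le> z \<and> ext_le (Fin z) (\<nu> x) \<and> ?key x z = ?key x0 z0) \<longleftrightarrow> 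
        (lo x \<le> z \<and> ext_le (Fin z) (Fin (h x)))" if x: "x \<in> B" and z: "z \<in> Z" for x z
      proof (cases "lo x \<le> z")
        case True
        then have z0': "0 \<le> z" using lo2 x by (meson order.trans)
        show ?thesis 
          using lower[OF x z] True key_iff(2)[OF \<kappa>, of x z] above[OF x z0'] nu_h[OF x z0'] unfolding key by auto
      next
        case False
        then show ?thesis using lower[OF x z] key_iff(2)[OF \<kappa>, of x z] unfolding key by blast
      qed
      moreover have "\<forall>x\<in>B. ext_le (Fin (lo x + nmul n e)) (Fin (h x))"
      proof
        fix x assume x: "x \<in> B"
        \<comment> \<open>The 2 in the product of \<open>cut\<close> with \<open>cut + 2\<close>
          pays for these two shifts.\<close>
        have "e + nmul n e \<le> g x \<kappa> + g x \<kappa>"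
          using order.trans[OF e_le_c g_ge(1)] order.trans[OF c(3) g_ge(1)] by (rule add_mono)
        then have "lo x + nmul n e \<le> nmul (sc \<kappa> + 2) (g x \<kappa>)"
          unfolding lo_def nmul_add by (simp add: add.assoc numeral_2_eq_2 nmul_Suc)
        then have "nmul (sc \<tau>) (lo x + nmul n e) \<le> g x \<tau>"
          by (rule nmul_absorb[OF _ g_gap_sc[OF x \<kappa> \<tau>] order.refl g_ge(3)])
        then show "ext_le (Fin (lo x + nmul n e)) (Fin (h x))" by (simp add: h_iff)
      qed
      moreover have "affine_lc_ext k H B (\<lambda>x. Fin (h x))" using h1 h2 by (rule affine_lc_extI)
      ultimately show ?thesis using lo1 lo2 by (intro exI[of _ lo] exI[of _ "\<lambda>x. Fin (h x)"] conjI) blast+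
    qed
  qed
qed

end

section \<open>Slices as precells, their block structure, and the blocks visible on a face\<close>

lemma idx_mono: "J \<subseteq> I \<Longrightarrow> idx J \<subseteq> idx I"
  by (auto simp: idx_def)

lemma zero_idx [simp]: "0 \<in> idx I" and Suc_idx [simp]: "Suc i \<in> idx I \<longleftrightarrow> i \<in> I"
  by (auto simp: idx_def)

lemma coord_snoc: 
  assumes "i \<in> idx (I - {k})" "I \<subseteq> {..<Suc k}" "length a = Suc k"
  shows "coord c (butlast a) i = coord c a i"
proof (cases i)
  case (Suc j)
  then have "j < k" using assms(1,2) by auto
  then show ?thesis using Suc assms(3) by (simp add: val_butlast)
qed simp

lemma butlast_move:
  assumes "length u = Suc k"
  shows "butlast (move (Suc k) I u y t) = move k (I - {k}) (butlast u) (y(k := 0)) t"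
  unfolding move_def pt_Suc using assms by (auto simp: val_butlast intro!: pt_cong)

lemma recession_butlast:
  assumes y: "y \<in> recession Z (Suc k) I P" and P: "P \<subseteq> FI Z (Suc k) I"
  shows "y(k := 0) \<in> recession Z k (I - {k}) (butlast ` P)"
  unfolding recession_def
proof (intro CollectI conjI allI impI ballI)
  show "(y(k := 0)) i = 0" if "i \<notin> I - {k}" for i using that recessionD(1)[OF y] by auto
  fix x t assume x: "x \<in> butlast ` P" and t: "t \<in> Z" "0 \<le> t"
  obtain u where u: "x = butlast u" "u \<in> P" using x by (rule imageE)
  have len: "length u = Suc k" using u(2) P FI_length by blast
  have "move (Suc k) I u y t \<in> P" using recessionD(2)[OF y u(2) t] .
  then show "move k (I - {k}) x (y(k := 0)) t \<in> butlast ` P"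
    using butlast_move[OF len, of I y t] unfolding u(1) by (metis imageI)
qed

lemma escapes_butlast: "escapes y I J \<Longrightarrow> escapes (y(k := 0)) (I - {k}) (J - {k})"
  by (auto simp: escapes_def)

lemma affine_lc_extD:
  fixes Z :: "'a::linordered_ab_group_add set"
  assumes "zgroup_hull Z e" "affine_lc_ext k H B (f :: 'a ext list \<Rightarrow> 'a ext)"
  shows "affine_map H B f" "nonneg_map B f" "largely_continuous k B f"
proof -
  interpret zgroup_hull Z e by (rule assms(1))
  consider "\<forall>x\<in>B. f x = PInf" | h where "affine_lc k H B h" "\<forall>x\<in>B. 0 \<le> h x \<and> f x = Fin (h x)"
    using assms(2) unfolding affine_lc_ext_def by blast
  then have "affine_map H B f \<and> nonneg_map B f \<and> largely_continuous k B f"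
  proof cases
    case 1
    have "largely_continuous k B f" using largely_continuous_const by (rule largely_continuous_cong) (simp add: 1)
    then show ?thesis using 1 by (simp add: affine_map_iff nonneg_map_def)
  next
    case (2 h)
    have "largely_continuous k B (\<lambda>x. Fin (h x))" using 2(1) by (simp add: affine_lc_def)
    then have "largely_continuous k B f" by (rule largely_continuous_cong) (simp add: 2(2))
    moreover obtain b \<alpha> where "\<forall>x\<in>B. h x = b + lin \<alpha> H x" using 2(1) unfolding affine_lc_def by blast
    then have "affine_map H B f" unfolding affine_map_iff using 2(2) by metis
    ultimately show ?thesis using 2(2) by (simp add: nonneg_map_def)
  qed
  then show "affine_map H B f" "nonneg_map B f" "largely_continuous k B f" by auto
qed

text \<open>No fibre of the slice is empty: either it is the whole fibre of \<open>S\<close>, which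
  projects onto \<open>B\<close>, or it is wide enough to contain a point of the prescribed residue
  class.\<close>

lemma (in slice) piece_precell:
  assumes kI: "k \<in> I" and HI: "H = I - {k}" and N: "length N = Suc k" "last N = n" and \<rho>: "\<rho> < n"
    and pre: "precell_rec Z e k (butlast N) H B"
    and S: "S = {a \<in> FI Z (Suc k) I. butlast a \<in> B \<and> \<mu> (butlast a) \<le> val a k \<and>
       ext_le (Fin (val a k)) (\<nu> (butlast a)) \<and> val a k - nmul \<rho> e \<in> nmul n ` Z}"
    and full: "B \<subseteq> butlast ` S" and a0: "a0 \<in> S"
    and P: "P = {a \<in> S. key (cut M K) c H r l (butlast a) (val a k) = key (cut M K) c H r l (butlast a0) (val a0 k)}"
  shows "precell_rec Z e (Suc k) N I P" "butlast ` P = B"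
proof -
  have "butlast a0 \<in> B" "\<mu> (butlast a0) \<le> val a0 k" "ext_le (Fin (val a0 k)) (\<nu> (butlast a0))"
    using a0 unfolding S by blast+
  from slice_bounds[OF this] obtain lo up where 
    lo: "affine_lc k H B lo" "\<forall>x\<in>B. 0 \<le> lo x" and up: "affine_lc_ext k H B up"
    and iff: "\<forall>x\<in>B. \<forall>z\<in>Z. (\<mu> x \<le> z \<and> ext_le (Fin z) (\<nu> x) \<and> 
      key (cut M K) c H r l x z = key (cut M K) c H r l (butlast a0) (val a0 k)) \<longleftrightarrow> (lo x \<le> z \<and> ext_le (Fin z) (up x))"
    and width: "(lo = \<mu> \<and> up = \<nu>) \<or> (\<forall>x\<in>B. ext_le (Fin (lo x + nmul n e)) (up x))"
    by blast
  obtain b \<alpha> where b: "\<forall>x\<in>B. lo x = b + lin \<alpha> H x" using lo(1) unfolding affine_lc_def by blast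
  have lo_lc: "largely_continuous k B (\<lambda>x. Fin (b + lin \<alpha> H x))"
    using lo(1) unfolding affine_lc_def by (elim conjE largely_continuous_cong) (simp add: b)
  have P_eq: "P = {a \<in> FI Z (Suc k) I. butlast a \<in> B \<and> lo (butlast a) \<le> val a k \<and>
       ext_le (Fin (val a k)) (up (butlast a)) \<and> val a k - nmul \<rho> e \<in> nmul n ` Z}" (is "_ = ?P")
  proof -
    have "a \<in> P \<longleftrightarrow> a \<in> ?P" for a
    proof (cases "a \<in> FI Z (Suc k) I \<and> butlast a \<in> B")
      case True
      then have "val a k \<in> Z" using FI_nth_in(2) kI by blast
      then have "(\<mu> (butlast a) \<le> val a k \<and> ext_le (Fin (val a k)) (\<nu> (butlast a)) \<and> 
        key (cut M K) c H r l (butlast a) (val a k) = key (cut M K) c H r l (butlast a0) (val a0 k)) \<longleftrightarrow> 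
        (lo (butlast a) \<le> val a k \<and> ext_le (Fin (val a k)) (up (butlast a)))"
        using iff True by blast
      then show ?thesis unfolding P S using True by blast
    next
      case False
      then show ?thesis unfolding P S by blast
    qed
    then show ?thesis by blast
  qed
  have P_fib: "P = fibred Z e k I (last N) \<rho> B b \<alpha> up"
    unfolding P_eq fibred_def N(2) HI[symmetric] using b by (intro Collect_cong) auto
  have full': "B \<subseteq> butlast ` P"
    using width
  proof
    assume "lo = \<mu> \<and> up = \<nu>"
    then have "P = S" unfolding P_eq S by simp
    then show ?thesis using full by simp
  next
    assume w: "\<forall>x\<in>B. ext_le (Fin (lo x + nmul n e)) (up x)"
    show ?thesis
    proof
      fix x assume x: "x \<in> B"
      obtain h where h: "lo x + nmul n e \<le> h" "\<And>z. z \<le> h \<Longrightarrow> ext_le (Fin z) (up x)"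
      proof (cases "up x")
        case (Fin h)
        then show ?thesis using w x that[of h] by force
      next
        case PInf
        then show ?thesis using that[of "lo x + nmul n e"] by simp
      qed
      obtain z where z: "z \<in> Z" "lo x \<le> z" "z \<le> h" "z - nmul \<rho> e \<in> nmul n ` Z"
        using n h(1) by (rule residue_in_interval)
      have xF: "x \<in> FI Z k (I - {k})" using B(1) x HI by blast
      then have aF: "x @ [Fin z] \<in> FI Z (Suc k) I" using z(1) kI by (rule FI_snoc)
      have "val (x @ [Fin z]) k = z" using FI_length[OF xF] by simp
      then have "x @ [Fin z] \<in> P" unfolding P_eq using aF x z h(2) by simp
      then show "x \<in> butlast ` P" by (metis butlast_snoc imageI)
    qed
  qed
  show "precell_rec Z e (Suc k) N I P"
  proof (rule precell_rec_fibredI[OF _ kI N(1) _ _ _ _ _ _ P_fib full'])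
    show "precell_rec Z e k (butlast N) (I - {k}) B" using pre HI by simp
    show "0 \<le> b + lin \<alpha> (I - {k}) x" if "x \<in> B" for x using lo(2) b that HI by simp
    show "largely_continuous k B (\<lambda>x. Fin (b + lin \<alpha> (I - {k}) x))" using lo_lc HI by simp
    show "affine_map (I - {k}) B up" "nonneg_map B up" "largely_continuous k B up"
      using affine_lc_extD[OF zgroup_hull_axioms up] HI by auto
    show "\<rho> < last N" using \<rho> N(2) by simp
  qed
  show "butlast ` P = B" using full' unfolding P_eq by blast
qed

text \<open>Doubling the old ranks frees the odd ones for a block strictly between two old ones; the
  rank of the new coordinate is then its key.\<close>

definition new_rank :: "nat \<Rightarrow> nat \<Rightarrow> (nat \<Rightarrow> nat) \<Rightarrow> nat \<Rightarrow> nat" where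
  "new_rank k w r i = (if i = Suc k then w else 2 * r i)"

text \<open>An even key lets the new coordinate join block \<open>w div 2\<close>. All members of
  the enlarged block receive the factor \<open>l * s l\<close>, because a comparison with the new
  coordinate passes through the representative. An odd key creates a singleton block.\<close>

definition new_scale :: "(nat \<Rightarrow> nat) \<Rightarrow> nat set \<Rightarrow> nat \<Rightarrow> nat \<Rightarrow> (nat \<Rightarrow> nat) \<Rightarrow> (nat \<Rightarrow> nat) \<Rightarrow> nat \<Rightarrow> nat" where
  "new_scale s H k w r l i = 
    (if i = Suc k then (if even w then l (rep H r (w div 2)) * s (l (rep H r (w div 2))) else 1)
     else if 2 * r i = w then l i * s (l i) else l i)"

text \<open>Old gaps suffice for the enlarged factors, since \<open>gap M K\<close> dominates
  \<open>M\<close> at \<open>l * cut M K l\<close>. Gaps next to a joined block also have to pay the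
  factor \<open>cut\<close>; gaps next to a new singleton block come from \<open>cut\<close> itself
  when the neighbouring block is the adjacent one.\<close>

lemma (in separated_piece) separated_extend:
  assumes kI: "k \<in> I" and HI: "H = I - {k}" and I: "I \<subseteq> {..<Suc k}" and P: "P \<subseteq> FI Z (Suc k) I" and w: "w div 2 \<in> ranks"
    and key: "\<And>a. a \<in> P \<Longrightarrow> butlast a \<in> B \<and> key (cut M K) c H r l (butlast a) (val a k) = w"
  shows "separated M c I P (new_rank k w r) (new_scale (cut M K) H k w r l)"
proof -
  let ?r = "new_rank k w r" and ?l = "new_scale (cut M K) H k w r l" and ?s = "cut M K"
  define \<kappa> where "\<kappa> = w div 2"
  have \<kappa>: "\<kappa> \<in> ranks" using w by (simp add: \<kappa>_def)
  note s = sc_ge[OF \<kappa>] and L = ht_ge[OF \<kappa>]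
  have idx: "idx I = insert (Suc k) (idx H)" using kI HI by (auto simp: idx_def)
  have notin: "Suc k \<notin> idx H" using HI by simp
  have old: "?r i = 2 * r i" "?l i = (if 2 * r i = w then l i * ?s (l i) else l i)" if "i \<in> idx H" for i
    using that notin by (auto simp: new_rank_def new_scale_def)
  have new: "?r (Suc k) = w" "?l (Suc k) = (if even w then ht \<kappa> * sc \<kappa> else 1)"
    by (simp_all add: new_rank_def new_scale_def \<kappa>_def)
  have l1: "1 \<le> l i" if "i \<in> idx H" for i using separatedD(2)[OF sep that] .
  have old_le: "l i \<le> ?l i" "?l i \<le> l i * ?s (l i)" "1 \<le> ?l i" if "i \<in> idx H" for i
  proof -
    have "l i * 1 \<le> l i * ?s (l i)" using cut_ge(5)[OF l1[OF that]] by (intro mult_le_mono2)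
    then show "l i \<le> ?l i" "?l i \<le> l i * ?s (l i)" "1 \<le> ?l i" using old(2)[OF that] l1[OF that] by auto
  qed
  have new_le: "1 \<le> ?l (Suc k)" "?l (Suc k) \<le> ht \<kappa> * sc \<kappa>"
  proof -
    have "1 * 1 \<le> ht \<kappa> * sc \<kappa>" using L s(3) by (rule mult_le_mono)
    then show "1 \<le> ?l (Suc k)" "?l (Suc k) \<le> ht \<kappa> * sc \<kappa>" using new(2) by auto
  qed
  have prod_mono: "i * ?s i \<le> m * ?s m" if "i \<le> m" for i m using that cut_mono[OF that] by (rule mult_le_mono)
  have M_le: "M q \<le> M (m * ?s m)" if "q \<le> i * ?s i" "i \<le> m" for q i m
    using order.trans[OF that(1) prod_mono[OF that(2)]] by (rule monoD[OF M(1)])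
  have max_le: "M (max q q') \<le> M (m * ?s m)" if "q \<le> i * ?s i" "q' \<le> j * ?s j" "m = max i j" for q q' i j m
  proof (rule monoD[OF M(1)])
    have "q \<le> m * ?s m" using order.trans[OF that(1) prod_mono] that(3) by simp
    moreover have "q' \<le> m * ?s m" using order.trans[OF that(2) prod_mono] that(3) by simp
    ultimately show "max q q' \<le> m * ?s m" by simp
  qed
  have gap_M: "M (m * ?s m) \<le> gap M K m" if "1 \<le> m" for m
  proof -
    have "1 * M (m * ?s m) \<le> ?s m * M (m * ?s m)" using cut_ge(5)[OF that] by (rule mult_le_mono1)
    also note gap_ge(1)
    finally show ?thesis by simp
  qed
  have c_old: "coord c a i = coord c (butlast a) i" if "a \<in> P" "i \<in> idx H" for a i
  proof -
    have "length a = Suc k" using that(1) P FI_length by blast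
    then show ?thesis using that(2) I HI by (intro coord_snoc[symmetric]) simp_all
  qed
  have nonneg: "0 \<le> coord c a i" for a :: "'a ext list" and i using coord_ge[of c a i] c(2) by simp
  have old_gap: "nmul (M q) (coord c x i) \<le> coord c x j" 
    if "x \<in> B" "i \<in> idx H" "j \<in> idx H" "r i < r j" "M q \<le> M (max (l i) (l j) * ?s (max (l i) (l j)))" for x i j q
  proof -
    have m1: "1 \<le> max (l i) (l j)" using l1[OF that(2)] by simp
    have "M q \<le> gap M K (max (l i) (l j))" using that(5) gap_M[OF m1] by (rule order.trans)
    then have "nmul (M q) (coord c x i) \<le> nmul (gap M K (max (l i) (l j))) (coord c x i)"
      by (intro nmul_mono_left nonneg)
    then show ?thesis using separatedD(5)[OF sep that(1-4)] by (rule order.trans)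
  qed
  have even_z: "coord c a (Suc k) \<le> nmul (sc \<kappa>) (g (butlast a) \<kappa>)" "g (butlast a) \<kappa> \<le> nmul (sc \<kappa>) (coord c a (Suc k))"
    if a: "a \<in> P" and ev: "even w" for a
  proof -
    let ?x = "butlast a" and ?z = "val a k"
    have k: "\<kappa> = 0 \<or> g ?x \<kappa> < nmul (sc \<kappa>) ?z" "?z \<le> nmul (sc \<kappa>) (g ?x \<kappa>)"
      using key_iff(1)[OF \<kappa>, of ?x ?z] key[OF a] ev by (auto simp: \<kappa>_def)
    have "c \<le> nmul (sc \<kappa>) (g ?x \<kappa>)" using g_ge(1) le_nmul[OF s(3) g_ge(3)] by (rule order.trans)
    then show "coord c a (Suc k) \<le> nmul (sc \<kappa>) (g ?x \<kappa>)" using k(2) by simp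
    show "g ?x \<kappa> \<le> nmul (sc \<kappa>) (coord c a (Suc k))"
    proof (cases "\<kappa> = 0")
      case True
      then have "g ?x \<kappa> \<le> coord c a (Suc k)" by simp
      then show ?thesis using le_nmul[OF s(3) nonneg] by (rule order.trans)
    next
      case False
      then have "g ?x \<kappa> \<le> nmul (sc \<kappa>) ?z" using k(1) by simp
      also have "\<dots> \<le> nmul (sc \<kappa>) (coord c a (Suc k))" by (intro nmul_mono) simp
      finally show ?thesis .
    qed
  qed
  have odd_z: "coord c a (Suc k) = val a k" "nmul (sc \<kappa>) (g (butlast a) \<kappa>) < val a k"
    "\<And>\<kappa>'. \<kappa>' \<in> ranks \<Longrightarrow> \<kappa> < \<kappa>' \<Longrightarrow> nmul (sc \<kappa>') (val a k) \<le> g (butlast a) \<kappa>'"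
    if a: "a \<in> P" and od: "odd w" for a
  proof -
    let ?x = "butlast a" and ?z = "val a k"
    have "w = 2 * \<kappa> + 1" using od unfolding \<kappa>_def by presburger
    then have k: "nmul (sc \<kappa>) (g ?x \<kappa>) < ?z" "\<forall>\<kappa>'\<in>ranks. \<kappa> < \<kappa>' \<longrightarrow> nmul (sc \<kappa>') ?z \<le> g ?x \<kappa>'"
      using key_iff(2)[OF \<kappa>, of ?x ?z] key[OF a] by auto
    show "nmul (sc \<kappa>) (g ?x \<kappa>) < ?z" by (rule k(1))
    have "c \<le> nmul (sc \<kappa>) (g ?x \<kappa>)" using g_ge(1) le_nmul[OF s(3) g_ge(3)] by (rule order.trans)
    then have "c < ?z" using k(1) by (rule order.strict_trans1)
    then show "coord c a (Suc k) = ?z" by simp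
    show "nmul (sc \<kappa>') ?z \<le> g ?x \<kappa>'" if "\<kappa>' \<in> ranks" "\<kappa> < \<kappa>'" for \<kappa>' using k(2) that by blast
  qed
  have w_cases: "even w \<Longrightarrow> w = 2 * \<kappa>" "odd w \<Longrightarrow> w = 2 * \<kappa> + 1" unfolding \<kappa>_def by presburger+
  have same: "l i = ht \<kappa>" if "i \<in> idx H" "r i = \<kappa>" for i
    using separatedD(3)[OF sep that(1) rep(1)[OF \<kappa>]] rep(2)[OF \<kappa>] that(2) by simp
  have old_new_same: "coord c a i \<le> nmul (?l i) (coord c a (Suc k)) \<and> coord c a (Suc k) \<le> nmul (?l (Suc k)) (coord c a i)
     \<and> ?l i = ?l (Suc k)" if a: "a \<in> P" and i: "i \<in> idx H" "2 * r i = w" for a i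
  proof -
    have ev: "even w" and r: "r i = \<kappa>" using i(2) unfolding \<kappa>_def by presburger+
    note x = conjunct1[OF key[OF a]]
    have l: "?l i = ht \<kappa> * sc \<kappa>" "?l (Suc k) = ht \<kappa> * sc \<kappa>" using old(2)[OF i(1)] new(2) ev i(2) same[OF i(1) r] by auto
    have 1: "coord c a i \<le> nmul (ht \<kappa>) (g (butlast a) \<kappa>)" "g (butlast a) \<kappa> \<le> nmul (ht \<kappa>) (coord c a i)"
      using coord_g(2,3)[OF x i(1)] r same[OF i(1) r] c_old[OF a i(1)] by auto
    have "coord c a i \<le> nmul (ht \<kappa> * sc \<kappa>) (coord c a (Suc k))" using 1(1) even_z(2)[OF a ev] by (rule nmul_trans)
    moreover have "coord c a (Suc k) \<le> nmul (sc \<kappa> * ht \<kappa>) (coord c a i)" using even_z(1)[OF a ev] 1(2) by (rule nmul_trans)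
    ultimately show ?thesis using l by (simp add: mult.commute)
  qed
  have old_below: "nmul (M (max (?l i) (?l (Suc k)))) (coord c a i) \<le> coord c a (Suc k)" 
    if a: "a \<in> P" and i: "i \<in> idx H" "2 * r i < w" for a i
  proof (cases "even w")
    case True
    then have ri: "r i < \<kappa>" using i(2) w_cases(1) by simp
    note x = conjunct1[OF key[OF a]]
    \<comment> \<open>The comparison passes through the representative of block
      \<open>\<kappa>\<close> and loses the factor \<open>sc \<kappa>\<close>, which
      \<open>gap\<close> contains in the product with \<open>M\<close>.\<close>
    let ?m = "max (l i) (ht \<kappa>)"
    have "M (max (?l i) (?l (Suc k))) \<le> M (?m * ?s ?m)" using old_le(2)[OF i(1)] new_le(2) by (rule max_le) simp
    moreover have "sc \<kappa> \<le> ?s ?m" by (rule cut_mono) simp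
    ultimately have "sc \<kappa> * M (max (?l i) (?l (Suc k))) \<le> gap M K ?m"
      using order.trans[OF mult_le_mono gap_ge(1)[of ?m]] by blast
    then have "nmul (sc \<kappa> * M (max (?l i) (?l (Suc k)))) (coord c a i) \<le> nmul (gap M K ?m) (coord c a i)"
      by (intro nmul_mono_left nonneg)
    also have "\<dots> \<le> g (butlast a) \<kappa>"
      using separatedD(5)[OF sep x i(1) rep(1)[OF \<kappa>]] rep(2)[OF \<kappa>] ri c_old[OF a i(1)] by simp
    also have "\<dots> \<le> nmul (sc \<kappa>) (coord c a (Suc k))" by (rule even_z(2)[OF a True])
    finally show ?thesis unfolding nmul_mult nmul_le_iff[OF s(4)] .
  next
    case False
    note x = conjunct1[OF key[OF a]] and z = odd_z[OF a False]
    have li: "?l i = l i" using old(2)[OF i(1)] False by auto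
    have lk: "?l (Suc k) = 1" using new(2) False by simp
    have mx: "max (?l i) (?l (Suc k)) = l i" using li lk l1[OF i(1)] by simp
    have "r i \<le> \<kappa>" using i(2) w_cases(2)[OF False] by simp
    then consider "r i = \<kappa>" | "r i < \<kappa>" by linarith
    then have "nmul (M (l i)) (coord c a i) \<le> nmul (sc \<kappa>) (g (butlast a) \<kappa>)"
    proof cases
      case 1
      have "coord c a i \<le> nmul (l i) (g (butlast a) \<kappa>)" 
        using coord_g(2)[OF x i(1)] 1 c_old[OF a i(1)] by simp
      then have "nmul (M (l i)) (coord c a i) \<le> nmul (M (l i) * l i) (g (butlast a) \<kappa>)" 
        unfolding nmul_mult by (rule nmul_mono)
      also have "\<dots> \<le> nmul (sc \<kappa>) (g (butlast a) \<kappa>)" 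
        using cut_ge(1)[of "l i"] same[OF i(1) 1] by (intro nmul_mono_left g_ge) simp
      finally show ?thesis .
    next
      case 2
      have "l i \<le> l i * ?s (l i)" using old_le(1,2)[OF i(1)] by (rule order.trans)
      then have "M (l i) \<le> M (max (l i) (ht \<kappa>) * ?s (max (l i) (ht \<kappa>)))" by (rule M_le) simp
      then have "nmul (M (l i)) (coord c a i) \<le> g (butlast a) \<kappa>"
        using old_gap[OF x i(1) rep(1)[OF \<kappa>]] 2 rep(2)[OF \<kappa>] c_old[OF a i(1)] by simp
      then show ?thesis using le_nmul[OF s(3) g_ge(3)] by (rule order.trans)
    qed
    then show ?thesis using z(1,2) mx by simp
  qed
  have old_above: "nmul (M (max (?l (Suc k)) (?l j))) (coord c a (Suc k)) \<le> coord c a j" 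
    if a: "a \<in> P" and j: "j \<in> idx H" "w < 2 * r j" for a j
  proof -
    have rj: "\<kappa> < r j" using j(2) w_cases by (cases "even w") auto
    note x = conjunct1[OF key[OF a]]
    show ?thesis
    proof (cases "even w")
      case True
      let ?m = "max (ht \<kappa>) (l j)"
      have "M (max (?l (Suc k)) (?l j)) \<le> M (?m * ?s ?m)" using new_le(2) old_le(2)[OF j(1)] by (rule max_le) simp
      moreover have "sc \<kappa> \<le> ?s ?m" by (rule cut_mono) simp
      ultimately have "M (max (?l (Suc k)) (?l j)) * sc \<kappa> \<le> gap M K ?m"
        using order.trans[OF mult_le_mono gap_ge(1)[of ?m]] by (subst mult.commute) blast
      moreover have "nmul (gap M K ?m) (g (butlast a) \<kappa>) \<le> coord c a j"
        using separatedD(5)[OF sep x rep(1)[OF \<kappa>] j(1)] rep(2)[OF \<kappa>] rj c_old[OF a j(1)] by simp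
      ultimately show ?thesis by (intro nmul_absorb[OF even_z(1)[OF a True] _ _ g_ge(3)])
    next
      case False
      note z = odd_z[OF a False]
      have lj: "?l j = l j" using old(2)[OF j(1)] False by auto
      have lk: "?l (Suc k) = 1" using new(2) False by simp
      have mx: "max (?l (Suc k)) (?l j) = l j" using lj lk l1[OF j(1)] by simp
      have z0: "0 \<le> val a k" using nonneg[of a "Suc k"] z(1) by simp
      have rjr: "r j \<in> ranks" using j(1) by blast
      \<comment> \<open>Here the room comes from the cut: of \<open>l j * M (l j)\<close>, the
        factor \<open>l j\<close> pays for passing from the representative to
        \<open>j\<close>.\<close>
      have "l j * M (l j) \<le> sc (r j)" using coord_g(1)[OF x j(1)] cut_ge(1)[of "l j"] by (simp add: mult.commute)
      then have "nmul (l j * M (l j)) (val a k) \<le> nmul (sc (r j)) (val a k)" using z0 by (rule nmul_mono_left)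
      also have "\<dots> \<le> g (butlast a) (r j)" using z(3) rjr rj by blast
      also have "\<dots> \<le> nmul (l j) (coord c a j)" using coord_g(3)[OF x j(1)] c_old[OF a j(1)] by simp
      finally have "nmul (M (l j)) (val a k) \<le> coord c a j" 
        unfolding nmul_mult by (rule nmul_le_iff[THEN iffD1, rotated]) (use l1[OF j(1)] in simp)
      then show ?thesis using z(1) mx by simp
    qed
  qed
  have old_old: "(?r i = ?r j \<longrightarrow> coord c a i \<le> nmul (?l i) (coord c a j)) \<and>
     (?r i < ?r j \<longrightarrow> nmul (M (max (?l i) (?l j))) (coord c a i) \<le> coord c a j)"
    if a: "a \<in> P" and ij: "i \<in> idx H" "j \<in> idx H" for a i j
  proof (intro conjI impI)
    note x = conjunct1[OF key[OF a]]
    assume "?r i = ?r j"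
    then have "r i = r j" using old(1) ij by simp
    then have "coord c a i \<le> nmul (l i) (coord c a j)" 
      using separatedD(4)[OF sep x ij] c_old[OF a] ij by simp
    also have "\<dots> \<le> nmul (?l i) (coord c a j)" using old_le(1)[OF ij(1)] nonneg by (rule nmul_mono_left)
    finally show "coord c a i \<le> nmul (?l i) (coord c a j)" .
  next
    note x = conjunct1[OF key[OF a]]
    assume "?r i < ?r j"
    then have "r i < r j" using old(1) ij by simp
    moreover have "M (max (?l i) (?l j)) \<le> M (max (l i) (l j) * ?s (max (l i) (l j)))"
      using old_le(2)[OF ij(1)] old_le(2)[OF ij(2)] by (rule max_le) simp
    ultimately show "nmul (M (max (?l i) (?l j))) (coord c a i) \<le> coord c a j"
      using old_gap[OF x ij] c_old[OF a] ij by simp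
  qed
  show ?thesis
    unfolding separated_def
  proof (intro conjI ballI)
    show "?r 0 = 0" using old(1)[of 0] separatedD(1)[OF sep] by simp
    show "1 \<le> ?l i" if "i \<in> idx I" for i using that new_le(1) old_le(3) unfolding idx by blast
    fix i j assume i: "i \<in> idx I" and j: "j \<in> idx I"
    show "?r i = ?r j \<longrightarrow> ?l i = ?l j"
    proof
      assume eq: "?r i = ?r j"
      have on: "?l i = ?l (Suc k)" if "i \<in> idx H" "2 * r i = w" for i
      proof -
        have "even w" "r i = \<kappa>" using that(2) unfolding \<kappa>_def by presburger+
        then show ?thesis using old(2)[OF that(1)] new(2) that(2) same[OF that(1)] by simp
      qed
      show "?l i = ?l j"
      proof (cases "i = Suc k")
        case True
        show ?thesis
        proof (cases "j = Suc k")
          case False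
          then have "j \<in> idx H" using j idx by blast
          then show ?thesis using True eq new(1) old(1)[of j] on[of j] by simp
        qed (use True in simp)
      next
        case False
        then have iH: "i \<in> idx H" using i idx by blast
        show ?thesis
        proof (cases "j = Suc k")
          case True
          then show ?thesis using eq new(1) old(1)[OF iH] on[OF iH] by simp
        next
          case False
          then have jH: "j \<in> idx H" using j idx by blast
          have "r i = r j" using eq old(1) iH jH by simp
          then have "l i = l j" using separatedD(3)[OF sep iH jH] by blast
          then show ?thesis using \<open>r i = r j\<close> old(2)[OF iH] old(2)[OF jH] by simp
        qed
      qed
    qed
  next
    fix a i j assume a: "a \<in> P" and i: "i \<in> idx I" and j: "j \<in> idx I"
    have "(?r i = ?r j \<longrightarrow> coord c a i \<le> nmul (?l i) (coord c a j)) \<and>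
     (?r i < ?r j \<longrightarrow> nmul (M (max (?l i) (?l j))) (coord c a i) \<le> coord c a j)"
    proof (cases "i = Suc k")
      case True
      show ?thesis
      proof (cases "j = Suc k")
        case False
        then have jH: "j \<in> idx H" using j idx by blast
        show ?thesis unfolding True new(1) old(1)[OF jH]
        proof (intro conjI impI)
          assume "w = 2 * r j"
          from old_new_same[OF a jH this[symmetric]] 
          show "coord c a (Suc k) \<le> nmul (?l (Suc k)) (coord c a j)" by blast
        qed (rule old_above[OF a jH])
      next
        case jk: True
        have "coord c a (Suc k) \<le> nmul (?l (Suc k)) (coord c a (Suc k))" using new_le(1) nonneg by (rule le_nmul)
        then show ?thesis using True jk by (simp del: coord_simps)
      qed
    next
      case False
      then have iH: "i \<in> idx H" using i idx by blast
      show ?thesis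
      proof (cases "j = Suc k")
        case True
        show ?thesis unfolding True new(1) old(1)[OF iH]
        proof (intro conjI impI)
          assume "2 * r i = w"
          from old_new_same[OF a iH this] 
          show "coord c a i \<le> nmul (?l i) (coord c a (Suc k))" by blast
        qed (rule old_below[OF a iH])
      next
        case False
        then have "j \<in> idx H" using j idx by blast
        then show ?thesis using old_old[OF a iH] by blast
      qed
    qed
    then show "?r i = ?r j \<longrightarrow> coord c a i \<le> nmul (?l i) (coord c a j)" 
      "?r i < ?r j \<longrightarrow> nmul (M (max (?l i) (?l j))) (coord c a i) \<le> coord c a j" by blast+
  qed
qed

text \<open>Along the ray the coordinate \<open>i\<close> is fixed and \<open>j\<close> is
  unbounded, whereas \<open>r j \<le> r i\<close> would bound \<open>j\<close> by a fixed multiple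
  of \<open>i\<close>. So the finite coordinates of a face form an initial segment of the
  blocks.\<close>

lemma (in zgroup_hull) separated_lower:
  assumes sep: "separated M c I B r l" and M: "\<And>i. 1 \<le> M i" and c: "0 < c" and x: "x \<in> B" and I: "I \<subseteq> {..<m}"
    and y: "y \<in> recession Z m I B" "escapes y I J" and ij: "i \<in> idx J" "j \<in> idx I - idx J"
  shows "r i < r j"
proof (rule ccontr)
  assume "\<not> r i < r j"
  then consider "r j = r i" | "r j < r i" by linarith
  note cases = this
  have J: "J \<subseteq> I" using y(2) by (simp add: escapes_def)
  have iI: "i \<in> idx I" using ij(1) idx_mono[OF J] by blast
  obtain j' where j': "j = Suc j'" "j' \<in> I" "j' \<notin> J" using ij(2) by (cases j) auto
  have "y j' \<noteq> 0" using y(2) j' by (auto simp: escapes_def)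
  have fix_i: "coord c (move m I x y t) i = coord c x i" for t
  proof (cases i)
    case (Suc i')
    then have "i' \<in> J" "i' \<in> I" "i' < m" using ij(1) J I by auto
    then have "y i' = 0" using y(2) by (auto simp: escapes_def)
    then show ?thesis using Suc \<open>i' \<in> I\<close> \<open>i' < m\<close> by simp
  qed simp
  \<comment> \<open>This value bounds coordinate \<open>j\<close> both when it shares the block of
    \<open>i\<close> and when its block is lower.\<close>
  let ?W = "nmul (l j) (coord c x i)"
  have W: "coord c x i \<le> ?W" 
    using separatedD(2)[OF sep, of j] ij(2) coord_ge[of c x i] c by (intro le_nmul) auto
  obtain T where T: "T \<in> Z" "0 \<le> T" "\<forall>t\<ge>T. ?W < val x j' + nmul (y j') t" 
    using large_coordinate[of "y j'" ?W "val x j'"] \<open>y j' \<noteq> 0\<close> by (metis One_nat_def Suc_leI neq0_conv)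
  let ?x = "move m I x y T"
  have in_B: "?x \<in> B" using recessionD(2)[OF y(1) x T(1,2)] .
  have "val ?x j' \<le> coord c ?x j" using j'(1) by simp
  moreover have "?W < val ?x j'" using T(3) j'(2) I by auto
  moreover have "coord c ?x j \<le> ?W" using cases
  proof cases
    case 1
    then show ?thesis using separatedD(4)[OF sep in_B _ iI, of j] ij(2) fix_i[of T] by simp
  next
    case 2
    have "coord c ?x j \<le> nmul (M (max (l j) (l i))) (coord c ?x j)"
      using M coord_ge[of c ?x j] c by (intro le_nmul) auto
    also have "\<dots> \<le> coord c ?x i" using separatedD(5)[OF sep in_B _ iI 2] ij(2) by simp
    finally show ?thesis using W fix_i[of T] by simp
  qed
  ultimately show False by simp
qed

text \<open>By the rank inequality a block meeting \<open>idx J\<close> lies inside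
  \<open>idx J\<close>, so its representative can be read off from the finite coordinates.\<close>

lemma rep_visible:
  assumes "J \<subseteq> H" and lower: "\<And>i j. i \<in> idx J \<Longrightarrow> j \<in> idx H - idx J \<Longrightarrow> r i < r j" and "\<kappa> \<in> r ` idx J"
  shows "rep H r \<kappa> = rep J r \<kappa>" "rep J r \<kappa> \<in> idx J"
proof -
  obtain i0 where i0: "i0 \<in> idx J" "r i0 = \<kappa>" using assms(3) by blast
  have "(i \<in> idx H \<and> r i = \<kappa>) = (i \<in> idx J \<and> r i = \<kappa>)" for i
  proof (cases "i \<in> idx J")
    case True
    then show ?thesis using idx_mono[OF assms(1)] by blast
  next
    case False
    then have "r i \<noteq> \<kappa>" if "i \<in> idx H" using lower[OF i0(1), of i] i0(2) that by simp
    then show ?thesis using False by blast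
  qed
  then show "rep H r \<kappa> = rep J r \<kappa>" unfolding rep_def by presburger
  have "rep J r \<kappa> \<in> idx J \<and> r (rep J r \<kappa>) = \<kappa>" 
    unfolding rep_def using i0 by (intro LeastI[of "\<lambda>i. i \<in> idx J \<and> r i = \<kappa>" i0]) simp
  then show "rep J r \<kappa> \<in> idx J" by blast
qed

lemma rep_agree:
  assumes "\<And>i. i \<in> idx J \<Longrightarrow> r i = r' i" shows "rep J r \<kappa> = rep J r' \<kappa>"
proof -
  have "i \<in> idx J \<and> r i = \<kappa> \<longleftrightarrow> i \<in> idx J \<and> r' i = \<kappa>" for i using assms[of i] by auto
  then show ?thesis unfolding rep_def by presburger
qed

text \<open>A block that is not visible on \<open>J\<close> lies so far above \<open>z\<close> that
  it drops out of the maximum in \<open>key\<close>; what remains is data on which the two sides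
  agree.\<close>

lemma key_visible:
  fixes x x' :: "'a::linordered_ab_group_add ext list"
  assumes H: "finite H" "J \<subseteq> H" 
    and lower: "\<And>i j. i \<in> idx J \<Longrightarrow> j \<in> idx H - idx J \<Longrightarrow> r i < r j" "\<And>i j. i \<in> idx J \<Longrightarrow> j \<in> idx H - idx J \<Longrightarrow> r' i < r' j"
    and agree: "\<And>i. i \<in> idx J \<Longrightarrow> r i = r' i \<and> l i = l' i \<and> coord c x i = coord c x' i" and r0: "r 0 = 0"
    and far: "\<And>\<kappa>. \<kappa> \<in> r ` idx H \<Longrightarrow> \<kappa> \<notin> r ` idx J \<Longrightarrow> nmul (s (l (rep H r \<kappa>))) z \<le> coord c x (rep H r \<kappa>)"
      "\<And>\<kappa>. \<kappa> \<in> r' ` idx H \<Longrightarrow> \<kappa> \<notin> r' ` idx J \<Longrightarrow> nmul (s (l' (rep H r' \<kappa>))) z \<le> coord c x' (rep H r' \<kappa>)"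
  shows "key s c H r l x z = key s c H r' l' x' z"
proof -
  have sub: "idx J \<subseteq> idx H" using H(2) by (rule idx_mono)
  have im: "r ` idx J = r' ` idx J" using agree by (intro image_cong) auto
  have rep: "rep H r \<kappa> = rep H r' \<kappa> \<and> rep H r \<kappa> \<in> idx J" if "\<kappa> \<in> r ` idx J" for \<kappa>
  proof -
    have "rep H r \<kappa> = rep J r \<kappa>" "rep J r \<kappa> \<in> idx J" using rep_visible[OF H(2) lower(1) that] by auto
    moreover have "rep H r' \<kappa> = rep J r' \<kappa>" using rep_visible(1)[OF H(2) lower(2)] that im by auto
    moreover have "rep J r \<kappa> = rep J r' \<kappa>" using agree by (intro rep_agree) blast
    ultimately show ?thesis by simp
  qed
  let ?P = "\<lambda>\<kappa>. \<kappa> = 0 \<or> coord c x (rep H r \<kappa>) < nmul (s (l (rep H r \<kappa>))) z"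
  let ?P' = "\<lambda>\<kappa>. \<kappa> = 0 \<or> coord c x' (rep H r' \<kappa>) < nmul (s (l' (rep H r' \<kappa>))) z"
  have zero: "0 \<in> r ` idx J" using r0 by (metis image_eqI zero_idx)
  have vis: "\<kappa> \<in> r ` idx J" if "\<kappa> \<in> r ` idx H" "?P \<kappa>" for \<kappa>
    using far(1)[OF that(1)] that(2) zero by (auto simp: not_le[symmetric])
  have vis': "\<kappa> \<in> r ` idx J" if "\<kappa> \<in> r' ` idx H" "?P' \<kappa>" for \<kappa>
    using far(2)[OF that(1)] that(2) zero im by (auto simp: not_le[symmetric])
  have PP': "?P \<kappa> \<longleftrightarrow> ?P' \<kappa>" if "\<kappa> \<in> r ` idx J" for \<kappa>
    using rep[OF that] agree[of "rep H r \<kappa>"] by auto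
  have restrict: "{\<kappa>\<in>S. Q \<kappa>} = {\<kappa>\<in>S'. Q' \<kappa>}" 
    if "S' \<subseteq> S" "\<And>\<kappa>. \<kappa> \<in> S \<Longrightarrow> Q \<kappa> \<Longrightarrow> \<kappa> \<in> S'" "\<And>\<kappa>. \<kappa> \<in> S' \<Longrightarrow> Q \<kappa> \<longleftrightarrow> Q' \<kappa>" for S S' :: "nat set" and Q Q'
    using that by blast
  have S: "{\<kappa>\<in>r ` idx H. ?P \<kappa>} = {\<kappa>\<in>r ` idx J. ?P \<kappa>}" 
    by (rule restrict[OF image_mono[OF sub] vis refl])
  have S': "{\<kappa>\<in>r' ` idx H. ?P' \<kappa>} = {\<kappa>\<in>r ` idx J. ?P \<kappa>}"
  proof -
    have "r ` idx J \<subseteq> r' ` idx H" unfolding im by (rule image_mono[OF sub])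
    then show ?thesis by (rule restrict[OF _ vis' PP'[symmetric]])
  qed
  have "finite J" using H(2,1) by (rule finite_subset)
  then have "finite (idx J)" by (simp add: idx_def)
  then have "Max {\<kappa>\<in>r ` idx J. ?P \<kappa>} \<in> {\<kappa>\<in>r ` idx J. ?P \<kappa>}" using zero by (intro Max_in) auto
  then have m: "Max {\<kappa>\<in>r ` idx J. ?P \<kappa>} \<in> r ` idx J" (is "?m \<in> _") by blast
  have 1: "rep H r' ?m = rep H r ?m" by (rule rep[OF m, THEN conjunct1, symmetric])
  have in_J: "rep H r ?m \<in> idx J" by (rule rep[OF m, THEN conjunct2])
  note eq = agree[OF in_J, THEN conjunct2]
  have 2: "l' (rep H r ?m) = l (rep H r ?m)" by (rule eq[THEN conjunct1, symmetric])
  have 3: "coord c x' (rep H r ?m) = coord c x (rep H r ?m)" by (rule eq[THEN conjunct2, symmetric])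
  show ?thesis unfolding key_def Let_def S S' 1 2 3 by (rule refl)
qed

section \<open>Compatibility of slices along faces\<close>

text \<open>If the faces of two pieces with the same support meet, they coincide, and so do the block 
  structures on their finite coordinates.\<close>

definition compatible :: "'a::linordered_ab_group_add set \<Rightarrow> nat \<Rightarrow> nat set \<Rightarrow> 
    'a ext list set \<times> (nat \<Rightarrow> nat) \<times> (nat \<Rightarrow> nat) \<Rightarrow> 'a ext list set \<times> (nat \<Rightarrow> nat) \<times> (nat \<Rightarrow> nat) \<Rightarrow> bool" where
  "compatible Z m I = (\<lambda>(B, r, l) (B', r', l'). \<forall>J y y'. 
     y \<in> recession Z m I B \<longrightarrow> y' \<in> recession Z m I B' \<longrightarrow> escapes y I J \<longrightarrow> escapes y' I J \<longrightarrow>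
     (\<exists>x\<in>B. \<exists>x'\<in>B'. pt m J (val x) = pt m J (val x')) \<longrightarrow>
     (\<forall>x\<in>B. \<exists>x'\<in>B'. pt m J (val x) = pt m J (val x')) \<and> (\<forall>i\<in>idx J. r i = r' i \<and> l i = l' i))"

lemma compatibleD:
  assumes "compatible Z m I (B, r, l) (B', r', l')" "y \<in> recession Z m I B" "y' \<in> recession Z m I B'"
    "escapes y I J" "escapes y' I J" "x \<in> B" "x' \<in> B'" "pt m J (val x) = pt m J (val x')"
  shows "u \<in> B \<Longrightarrow> \<exists>u'\<in>B'. pt m J (val u) = pt m J (val u')" "i \<in> idx J \<Longrightarrow> r i = r' i \<and> l i = l' i"
  using assms unfolding compatible_def prod.case by blast+

text \<open>Every piece carries its ranks and factors, because the cuts in the next coordinate, and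
  hence compatibility there, depend on them.\<close>

definition decomposition where
  "decomposition Z e m N I A M c C \<longleftrightarrow> finite C \<and> 
     (\<forall>(B, r, l)\<in>C. precell_rec Z e m N I B \<and> separated M c I B r l) \<and>
     (\<forall>T\<in>C. \<forall>T'\<in>C. T \<noteq> T' \<longrightarrow> fst T \<inter> fst T' = {}) \<and> (\<Union>T\<in>C. fst T) = A \<and>
     (\<forall>T\<in>C. \<forall>T'\<in>C. compatible Z m I T T')"

text \<open>The estimate from \<open>comparison\<close> at a fixed \<open>c\<close>. As
  \<open>V\<close> is common to all points, it restricts to every piece of the socle with the same
  \<open>K\<close>.\<close>

definition tame :: "nat \<Rightarrow> nat set \<Rightarrow> 'a::linordered_ab_group_add \<Rightarrow> 'a ext list set \<Rightarrow> ('a ext list \<Rightarrow> 'a) \<Rightarrow> bool" where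
  "tame K H c B f \<longleftrightarrow> (\<exists>V\<subseteq>H. \<forall>x\<in>B. (\<exists>i\<in>idx V. f x \<le> nmul K (coord c x i)) \<and> 
     (\<forall>i\<in>V. coord c x (Suc i) \<le> nmul K (max (f x) c)))"

lemma tame_mono:
  assumes "tame K H c B f" "K \<le> K'" "B' \<subseteq> B" "0 \<le> c" shows "tame K' H c B' f"
proof -
  obtain V where V: "V \<subseteq> H" "\<And>x. x \<in> B \<Longrightarrow> (\<exists>i\<in>idx V. f x \<le> nmul K (coord c x i)) \<and> 
     (\<forall>i\<in>V. coord c x (Suc i) \<le> nmul K (max (f x) c))" using assms(1) unfolding tame_def by blast
  have "(\<exists>i\<in>idx V. f x \<le> nmul K' (coord c x i)) \<and> (\<forall>i\<in>V. coord c x (Suc i) \<le> nmul K' (max (f x) c))" 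
    if x: "x \<in> B'" for x
  proof (intro conjI ballI)
    have xB: "x \<in> B" using x assms(3) by blast
    then obtain i where i: "i \<in> idx V" "f x \<le> nmul K (coord c x i)" using V(2) by blast
    have "0 \<le> coord c x i" using assms(4) coord_ge by (rule order.trans)
    then have "f x \<le> nmul K' (coord c x i)" using i(2) nmul_mono_left[OF assms(2)] by (meson order.trans)
    then show "\<exists>i\<in>idx V. f x \<le> nmul K' (coord c x i)" using i(1) by blast
    fix j assume "j \<in> V"
    then have "coord c x (Suc j) \<le> nmul K (max (f x) c)" using V(2)[OF xB] by blast
    also have "\<dots> \<le> nmul K' (max (f x) c)" using assms(2,4) by (intro nmul_mono_left) (simp_all add: le_max_iff_disj)
    finally show "coord c x (Suc j) \<le> nmul K' (max (f x) c)" .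
  qed
  then show ?thesis unfolding tame_def using V(1) by blast
qed

lemma (in separated_piece) tame_block:
  assumes "tame K H c B f" "\<And>x. x \<in> B \<Longrightarrow> 0 \<le> f x"
  shows "\<exists>p\<in>ranks. \<forall>x\<in>B. f x \<le> nmul (K * ht p) (g x p) \<and> (p \<noteq> 0 \<longrightarrow> g x p \<le> nmul (K * ht p) (f x))"
proof -
  obtain V where V: "V \<subseteq> H" "\<forall>x\<in>B. (\<exists>i\<in>idx V. f x \<le> nmul K (coord c x i)) \<and> 
     (\<forall>i\<in>V. coord c x (Suc i) \<le> nmul K (max (f x) c))" using assms(1) unfolding tame_def by blast
  show ?thesis
    by (rule comparable_with_block[OF V(1) assms(2)]) (use V(2) in blast)+
qed

text \<open>The bounds are kept on the whole socle, before it is divided into pieces, so that their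
  limits along rays in different pieces can be compared.\<close>

locale fibration = zgroup_hull Z e for Z :: "'a::linordered_ab_group_add set" and e +
  fixes M :: "nat \<Rightarrow> nat" and K n k \<rho> :: nat and c :: 'a and I :: "nat set" and A :: "'a ext list set"
    and b :: 'a and \<alpha> :: "nat \<Rightarrow> rat" and \<nu> :: "'a ext list \<Rightarrow> 'a ext"
  assumes M: "mono M" "\<And>i. 1 \<le> M i" and K: "1 \<le> K" and n: "1 \<le> n" 
    and c: "c \<in> Z" "0 < c" "nmul n e \<le> c" and k: "k \<in> I" and I: "I \<subseteq> {..<Suc k}"
    and A: "A = fibred Z e k I n \<rho> (butlast ` A) b \<alpha> \<nu>" and FI_base: "butlast ` A \<subseteq> FI Z k (I - {k})"
    and mu: "\<And>x. x \<in> butlast ` A \<Longrightarrow> 0 \<le> b + lin \<alpha> (I - {k}) x"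
      "largely_continuous k (butlast ` A) (\<lambda>x. Fin (b + lin \<alpha> (I - {k}) x))"
    and nu: "affine_map (I - {k}) (butlast ` A) \<nu>" "nonneg_map (butlast ` A) \<nu>" "largely_continuous k (butlast ` A) \<nu>"
begin

abbreviation "H \<equiv> I - {k}"

definition piece :: "'a ext list set \<Rightarrow> (nat \<Rightarrow> nat) \<Rightarrow> (nat \<Rightarrow> nat) \<Rightarrow> nat \<Rightarrow> 'a ext list set" where
  "piece B r l w = {a \<in> A. butlast a \<in> B \<and> key (cut M K) c H r l (butlast a) (val a k) = w}"

lemma H: "H \<subseteq> {..<k}" "finite H"
proof -
  show 1: "H \<subseteq> {..<k}" using I by auto
  then show "finite H" by (rule finite_subset) simp
qed

lemma A_FI: "A \<subseteq> FI Z (Suc k) I"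
  using A unfolding fibred_def by blast

lemma A_D: 
  assumes "a \<in> A" 
  shows "length a = Suc k" "b + lin \<alpha> H (butlast a) \<le> val a k" "ext_le (Fin (val a k)) (\<nu> (butlast a))"
    "val a k - nmul \<rho> e \<in> nmul n ` Z" "val a k \<in> Z" "butlast a \<in> butlast ` A"
proof -
  have "a \<in> fibred Z e k I n \<rho> (butlast ` A) b \<alpha> \<nu>" using assms A by simp
  then have a: "a \<in> FI Z (Suc k) I" and rest: "b + lin \<alpha> H (butlast a) \<le> val a k" 
    "ext_le (Fin (val a k)) (\<nu> (butlast a))" "val a k - nmul \<rho> e \<in> nmul n ` Z" 
    unfolding fibred_def by blast+
  show "length a = Suc k" using FI_length[OF a] .
  show "val a k \<in> Z" using FI_nth_in(2)[OF a k] .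
  show "b + lin \<alpha> H (butlast a) \<le> val a k" "ext_le (Fin (val a k)) (\<nu> (butlast a))" 
    "val a k - nmul \<rho> e \<in> nmul n ` Z" by (fact rest)+
  show "butlast a \<in> butlast ` A" using assms by (rule imageI)
qed

lemma A_I: 
  assumes "x \<in> butlast ` A" "z \<in> Z" "b + lin \<alpha> H x \<le> z" "ext_le (Fin z) (\<nu> x)" "z - nmul \<rho> e \<in> nmul n ` Z"
  shows "x @ [Fin z] \<in> A"
proof -
  have x: "x \<in> FI Z k H" using assms(1) FI_base by blast
  have "val (x @ [Fin z]) k = z" using FI_length[OF x] by simp
  then have "x @ [Fin z] \<in> fibred Z e k I n \<rho> (butlast ` A) b \<alpha> \<nu>"
    unfolding fibred_def using FI_snoc[OF x assms(2) k] assms by simp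
  then show ?thesis using A by simp
qed

lemma piece_separated:
  assumes "separated (gap M K) c H B r l" "B \<subseteq> butlast ` A" "B \<noteq> {}"
  shows "separated_piece Z e M K n k c H B r l"
  by unfold_locales (use assms M K n c FI_base in auto)

lemma piece_good:
  assumes sep: "separated (gap M K) c H B r l" and B: "B \<subseteq> butlast ` A"
    and mu_tame: "tame K H c (butlast ` A) (\<lambda>x. b + lin \<alpha> H x)"
    and nu_tame: "(\<forall>x\<in>butlast ` A. \<nu> x = PInf) \<or> 
      (\<exists>b' \<beta>. (\<forall>x\<in>butlast ` A. \<nu> x = Fin (b' + lin \<beta> H x)) \<and> tame K H c (butlast ` A) (\<lambda>x. b' + lin \<beta> H x))"
    and N: "length N = Suc k" "last N = n" and \<rho>: "\<rho> < n"
    and pre: "precell_rec Z e k (butlast N) H B" and ne: "piece B r l w \<noteq> {}"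
  shows "precell_rec Z e (Suc k) N I (piece B r l w)" "butlast ` piece B r l w = B"
    "separated M c I (piece B r l w) (new_rank k w r) (new_scale (cut M K) H k w r l)" "w div 2 \<in> r ` idx H"
proof -
  have B0: "B \<noteq> {}" using ne by (auto simp: piece_def)
  interpret sp: separated_piece Z e M K n k c H B r l using sep B B0 by (rule piece_separated)
  let ?\<mu> = "\<lambda>x. b + lin \<alpha> H x"
  have mu0: "\<And>x. x \<in> B \<Longrightarrow> 0 \<le> ?\<mu> x" using mu(1) B by blast
  have "tame K H c B ?\<mu>" using mu_tame order.refl B less_imp_le[OF c(2)] by (rule tame_mono)
  from sp.tame_block[OF this mu0] obtain p where p: "p \<in> r ` idx H" 
    "\<forall>x\<in>B. ?\<mu> x \<le> nmul (K * l (rep H r p)) (coord c x (rep H r p)) \<and> 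
       (p \<noteq> 0 \<longrightarrow> coord c x (rep H r p) \<le> nmul (K * l (rep H r p)) (?\<mu> x))" by blast
  have mu_aff: "affine_lc k H B ?\<mu>" 
    unfolding affine_lc_def using largely_continuous_subset[OF mu(2) B] by blast
  have nu_aff: "(\<forall>x\<in>B. \<nu> x = PInf) \<or> (\<exists>f q. affine_lc k H B f \<and> (\<forall>x\<in>B. 0 \<le> f x \<and> \<nu> x = Fin (f x)) \<and> q \<in> r ` idx H \<and>
       (\<forall>x\<in>B. f x \<le> nmul (K * l (rep H r q)) (coord c x (rep H r q)) \<and> 
         (q \<noteq> 0 \<longrightarrow> coord c x (rep H r q) \<le> nmul (K * l (rep H r q)) (f x))))"
    using nu_tame
  proof
    assume inf: "\<forall>x\<in>butlast ` A. \<nu> x = PInf"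
    show ?thesis by (intro disjI1 ballI bspec[OF inf] subsetD[OF B])
  next
    assume "\<exists>b' \<beta>. (\<forall>x\<in>butlast ` A. \<nu> x = Fin (b' + lin \<beta> H x)) \<and> tame K H c (butlast ` A) (\<lambda>x. b' + lin \<beta> H x)"
    then obtain b' \<beta> where nu': "\<forall>x\<in>butlast ` A. \<nu> x = Fin (b' + lin \<beta> H x)" 
      and t: "tame K H c (butlast ` A) (\<lambda>x. b' + lin \<beta> H x)" by blast
    let ?f = "\<lambda>x. b' + lin \<beta> H x"
    have eq: "\<nu> x = Fin (?f x)" if "x \<in> B" for x using nu' B that by blast
    have f0: "0 \<le> ?f x" if "x \<in> B" for x
    proof -
      have "ext_le (Fin 0) (\<nu> x)" using nu(2) B that unfolding nonneg_map_def by blast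
      then show ?thesis using eq[OF that] by simp
    qed
    have lc: "largely_continuous k B (\<lambda>x. Fin (?f x))"
      using largely_continuous_subset[OF nu(3) B] eq by (rule largely_continuous_cong)
    then have aff: "affine_lc k H B ?f" unfolding affine_lc_def by blast
    have "tame K H c B ?f" using t order.refl B less_imp_le[OF c(2)] by (rule tame_mono)
    from sp.tame_block[OF this f0] obtain q where "q \<in> r ` idx H" 
      "\<forall>x\<in>B. ?f x \<le> nmul (K * l (rep H r q)) (coord c x (rep H r q)) \<and> 
        (q \<noteq> 0 \<longrightarrow> coord c x (rep H r q) \<le> nmul (K * l (rep H r q)) (?f x))" by blast
    then show ?thesis using aff f0 eq by blast
  qed
  interpret sl: slice Z e M K n k c H B r l ?\<mu> \<nu> p
    by unfold_locales (use mu_aff mu0 p nu_aff in blast)+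
  obtain a0 where a0: "a0 \<in> A" "butlast a0 \<in> B" "w = key (cut M K) c H r l (butlast a0) (val a0 k)"
    using ne unfolding piece_def by blast
  let ?S = "{a \<in> A. butlast a \<in> B}"
  have S: "?S = {a \<in> FI Z (Suc k) I. butlast a \<in> B \<and> ?\<mu> (butlast a) \<le> val a k \<and>
       ext_le (Fin (val a k)) (\<nu> (butlast a)) \<and> val a k - nmul \<rho> e \<in> nmul n ` Z}"
    by (subst A, unfold fibred_def) (use B in blast)
  have full: "B \<subseteq> butlast ` ?S" using B by blast
  have P: "piece B r l w = {a \<in> ?S. key (cut M K) c H r l (butlast a) (val a k) = key (cut M K) c H r l (butlast a0) (val a0 k)}"
    unfolding piece_def a0(3) by blast
  have a0S: "a0 \<in> ?S" using a0 by blast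
  show "precell_rec Z e (Suc k) N I (piece B r l w)" "butlast ` piece B r l w = B"
    by (rule sl.piece_precell[OF k refl N \<rho> pre S full a0S P])+
  show w: "w div 2 \<in> r ` idx H" unfolding a0(3) by (rule sp.key_in)
  show "separated M c I (piece B r l w) (new_rank k w r) (new_scale (cut M K) H k w r l)"
    by (rule sp.separated_extend[OF k refl I _ w]) (use A_FI in \<open>auto simp: piece_def\<close>)
qed

lemma ray_slope_nonneg:
  assumes "\<forall>t\<in>Z. 0 \<le> t \<longrightarrow> move k H x y t \<in> butlast ` A" "\<And>x. x \<in> butlast ` A \<Longrightarrow> 0 \<le> b' + lin \<beta> H x"
  shows "0 \<le> lam \<beta> H y"
proof (rule nonneg_slope)
  fix t assume "t \<in> Z" "0 \<le> t"
  then have "0 \<le> b' + lin \<beta> H (move k H x y t)" by (intro assms(2) assms(1)[rule_format])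
  then show "0 \<le> (b' + lin \<beta> H x) + qmul (lam \<beta> H y) t" by (simp add: lin_move[OF H(1)] add.assoc)
qed

text \<open>A block not visible on the face has a representative that escapes, so its level
  eventually exceeds any multiple of the fixed height \<open>z\<close>.\<close>

lemma far_levels:
  assumes sep: "separated (gap M K) c H B r l" and B: "B \<subseteq> butlast ` A" "B \<noteq> {}" and y: "escapes y H J"
  shows "\<exists>T\<in>Z. 0 \<le> T \<and> (\<forall>t\<ge>T. \<forall>\<kappa>\<in>r ` idx H. \<kappa> \<notin> r ` idx J \<longrightarrow> 
    nmul (cut M K (l (rep H r \<kappa>))) z \<le> coord c (move k H x y t) (rep H r \<kappa>))"
proof -
  interpret sp: separated_piece Z e M K n k c H B r l using sep B by (rule piece_separated)
  obtain W where W: "\<forall>\<kappa>\<in>r ` idx H. nmul (cut M K (l (rep H r \<kappa>))) z \<le> W" 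
    using finite_bounded[OF sp.H(3), of "\<lambda>\<kappa>. nmul (cut M K (l (rep H r \<kappa>))) z"] by blast
  obtain T where T: "T \<in> Z" "0 \<le> T" "\<forall>t\<ge>T. \<forall>i\<in>H - J. W < val x i + nmul (y i) t"
    using escapes_coordinates_large[OF y H(2)] by blast
  have "nmul (cut M K (l (rep H r \<kappa>))) z \<le> coord c (move k H x y t) (rep H r \<kappa>)" 
    if t: "T \<le> t" and \<kappa>: "\<kappa> \<in> r ` idx H" "\<kappa> \<notin> r ` idx J" for t \<kappa>
  proof -
    have 1: "rep H r \<kappa> \<in> idx H" "r (rep H r \<kappa>) = \<kappa>" using sp.rep[OF \<kappa>(1)] by auto
    have "rep H r \<kappa> \<notin> idx J" using 1(2) \<kappa>(2) by (metis imageI)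
    then obtain j where j: "rep H r \<kappa> = Suc j" "j \<in> H" "j \<notin> J" using 1(1) by (cases "rep H r \<kappa>") auto
    have "W < val x j + nmul (y j) t" using T(3) t j(2,3) by blast
    also have "\<dots> = val (move k H x y t) j" using j(2) H(1) by (intro val_move[symmetric]) auto
    also have "\<dots> \<le> coord c (move k H x y t) (Suc j)" by simp
    finally show ?thesis using W \<kappa>(1) j(1) by force
  qed
  then show ?thesis using T(1,2) by blast
qed

text \<open>Heights over a point of a face do not depend on the piece through which the face is approached.\<close>

lemma transfer:
  assumes sep: "separated (gap M K) c H B r l" and B: "B \<subseteq> butlast ` A"
    and sep': "separated (gap M K) c H B' r' l'" and B': "B' \<subseteq> butlast ` A"
    and P: "butlast ` piece B r l w = B" and u: "u \<in> piece B r l w"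
    and y: "y \<in> recession Z (Suc k) I (piece B r l w)" "escapes y I J" and kJ: "k \<in> J"
    and y': "y' \<in> recession Z k H B'" "escapes y' H (J - {k})"
    and x': "x' \<in> B'" "pt k (J - {k}) (val (butlast u)) = pt k (J - {k}) (val x')"
    and agree: "\<And>i. i \<in> idx (J - {k}) \<Longrightarrow> r i = r' i \<and> l i = l' i"
  shows "\<exists>t\<in>Z. 0 \<le> t \<and> move k H x' y' t @ [Fin (val u k)] \<in> A \<and> 
    key (cut M K) c H r' l' (move k H x' y' t) (val u k) = w"
proof -
  let ?J = "J - {k}" and ?x = "butlast u" and ?y = "y(k := 0)" and ?z = "val u k"
  have uA: "u \<in> A" and xB: "?x \<in> B" using u by (auto simp: piece_def)
  have B0: "B \<noteq> {}" "B' \<noteq> {}" using xB x'(1) by auto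
  interpret sp: separated_piece Z e M K n k c H B r l using sep B B0(1) by (rule piece_separated)
  interpret sp': separated_piece Z e M K n k c H B' r' l' using sep' B' B0(2) by (rule piece_separated)
  have PF: "piece B r l w \<subseteq> FI Z (Suc k) I" using A_FI by (auto simp: piece_def)
  have yB: "?y \<in> recession Z k H B" using recession_butlast[OF y(1) PF] P by simp
  have ye: "escapes ?y H ?J" using y(2) by (rule escapes_butlast)
  \<comment> \<open>Since \<open>k\<close> is finite on the face, the height \<open>?z\<close> is
    constant along the ray.\<close>
  have yk: "y k = 0" using y(2) kJ k by (auto simp: escapes_def)
  have ray: "move k H ?x ?y t \<in> B \<and> b + lin \<alpha> H (move k H ?x ?y t) \<le> ?z \<and> ext_le (Fin ?z) (\<nu> (move k H ?x ?y t)) \<and>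
     key (cut M K) c H r l (move k H ?x ?y t) ?z = w" if t: "t \<in> Z" "0 \<le> t" for t
  proof -
    let ?v = "move (Suc k) I u y t"
    have v: "?v \<in> piece B r l w" using recessionD(2)[OF y(1) u t] .
    have 1: "butlast ?v = move k H ?x ?y t" using A_D(1)[OF uA] by (rule butlast_move)
    have 2: "val ?v k = ?z" using k yk by simp
    have vA: "?v \<in> A" using v by (simp add: piece_def)
    show ?thesis using v A_D(2,3)[OF vA] unfolding piece_def 1[symmetric] 2[symmetric] by blast
  qed
  have r1: "\<forall>t\<in>Z. 0 \<le> t \<longrightarrow> move k H ?x ?y t \<in> butlast ` A" using ray B by blast
  have r2: "\<forall>t\<in>Z. 0 \<le> t \<longrightarrow> move k H x' y' t \<in> butlast ` A" using recessionD(2)[OF y'(1) x'(1)] B' by blast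
  note rays = largely_continuous_rays[OF _ FI_base H(1) ye y'(2) r1 r2 x'(2)]
  have mu_pos: "0 \<le> lam \<alpha> H ?y" "0 \<le> lam \<alpha> H y'" using ray_slope_nonneg[OF r1 mu(1)] ray_slope_nonneg[OF r2 mu(1)] by auto
  \<comment> \<open>The lower bound stays below the constant height \<open>?z\<close>, so its slope
    is zero; large continuity transfers both slope and value to the other ray.\<close>
  have "0 \<le> - lam \<alpha> H ?y"
  proof (rule nonneg_slope)
    fix t assume "t \<in> Z" "0 \<le> t"
    then have "b + lin \<alpha> H (move k H ?x ?y t) \<le> ?z" using ray by blast
    then show "b + lin \<alpha> H ?x \<le> ?z + qmul (- lam \<alpha> H ?y) t"
      by (simp add: lin_move[OF H(1)] q.scale_minus_left algebra_simps)
  qed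
  then have lam0: "lam \<alpha> H y' = 0" "lin \<alpha> H ?x = lin \<alpha> H x'" using rays[OF mu(2) mu_pos] mu_pos by auto
  have mu': "b + lin \<alpha> H (move k H x' y' t) \<le> ?z" for t
    unfolding lin_move[OF H(1)] lam0(1) using A_D(2)[OF uA] lam0(2) by simp
  have "\<exists>T\<in>Z. 0 \<le> T \<and> (\<forall>t\<ge>T. t \<in> Z \<longrightarrow> ext_le (Fin ?z) (\<nu> (move k H x' y' t)))"
  proof (cases "\<forall>x\<in>butlast ` A. \<nu> x = PInf")
    case True
    have "ext_le (Fin ?z) (\<nu> (move k H x' y' t))" if "t \<in> Z" "0 \<le> t" for t 
    proof -
      have "move k H x' y' t \<in> butlast ` A" using r2 that by blast
      then have "\<nu> (move k H x' y' t) = PInf" by (rule bspec[OF True])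
      then show ?thesis by simp
    qed
    then show ?thesis using Z_zero by blast
  next
    case False
    then obtain b' \<beta> where nu': "\<And>x. x \<in> butlast ` A \<Longrightarrow> \<nu> x = Fin (b' + lin \<beta> H x)"
      using nu(1) unfolding affine_map_iff by blast
    have lc: "largely_continuous k (butlast ` A) (\<lambda>x. Fin (b' + lin \<beta> H x))"
      using nu(3) nu' by (rule largely_continuous_cong)
    have nn: "0 \<le> b' + lin \<beta> H x" if "x \<in> butlast ` A" for x
    proof -
      have "ext_le (Fin 0) (\<nu> x)" using nu(2) that unfolding nonneg_map_def by blast
      then show ?thesis using nu'[OF that] by simp
    qed
    have xA: "?x \<in> butlast ` A" using xB B by blast
    have zx: "?z \<le> b' + lin \<beta> H ?x" using A_D(3)[OF uA] nu'[OF xA] by simp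
    \<comment> \<open>The upper bound has the same constant value on both rays or is eventually
      above \<open>?z\<close> on the second one.\<close>
    have "(lam \<beta> H y' = 0 \<and> lin \<beta> H ?x = lin \<beta> H x') \<or> 0 < lam \<beta> H y'"
      using rays[OF lc ray_slope_nonneg[OF r1 nn] ray_slope_nonneg[OF r2 nn]] by blast
    then obtain T where T: "T \<in> Z" "0 \<le> T" "\<forall>t\<ge>T. ?z - (b' + lin \<beta> H x') \<le> qmul (lam \<beta> H y') t"
    proof
      assume "lam \<beta> H y' = 0 \<and> lin \<beta> H ?x = lin \<beta> H x'"
      then have "\<forall>t\<ge>0. ?z - (b' + lin \<beta> H x') \<le> qmul (lam \<beta> H y') t" using zx by simp
      then show thesis using that Z_zero by blast
    next
      assume "0 < lam \<beta> H y'"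
      then show thesis using large_multiple that by blast
    qed
    have "ext_le (Fin ?z) (\<nu> (move k H x' y' t))" if t: "T \<le> t" "t \<in> Z" for t
    proof -
      have "move k H x' y' t \<in> butlast ` A" using r2 t T(2) by (meson order.trans)
      then have "\<nu> (move k H x' y' t) = Fin (b' + lin \<beta> H x' + qmul (lam \<beta> H y') t)"
        using nu' by (simp add: lin_move[OF H(1)] add.assoc)
      moreover have "?z - (b' + lin \<beta> H x') \<le> qmul (lam \<beta> H y') t" using T(3) t(1) by blast
      ultimately show ?thesis by (simp add: algebra_simps)
    qed
    then show ?thesis using T(1,2) by blast
  qed
  then obtain T1 where T1: "T1 \<in> Z" "0 \<le> T1" "\<forall>t\<ge>T1. t \<in> Z \<longrightarrow> ext_le (Fin ?z) (\<nu> (move k H x' y' t))" by blast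
  obtain T2 where T2: "T2 \<in> Z" "0 \<le> T2" "\<forall>t\<ge>T2. \<forall>\<kappa>\<in>r' ` idx H. \<kappa> \<notin> r' ` idx ?J \<longrightarrow> 
    nmul (cut M K (l' (rep H r' \<kappa>))) ?z \<le> coord c (move k H x' y' t) (rep H r' \<kappa>)"
    using far_levels[OF sep' B' B0(2) y'(2)] by blast
  obtain T3 where T3: "T3 \<in> Z" "0 \<le> T3" "\<forall>t\<ge>T3. \<forall>\<kappa>\<in>r ` idx H. \<kappa> \<notin> r ` idx ?J \<longrightarrow> 
    nmul (cut M K (l (rep H r \<kappa>))) ?z \<le> coord c (move k H ?x ?y t) (rep H r \<kappa>)"
    using far_levels[OF sep B B0(1) ye] by blast
  define t where "t = max T1 T2"
  have t: "t \<in> Z" "0 \<le> t" "T1 \<le> t" "T2 \<le> t" using T1 T2 by (auto simp: t_def max_def)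
  let ?w = "move k H x' y' t"
  have wA: "?w \<in> butlast ` A" using r2 t by blast
  have "?w @ [Fin ?z] \<in> A" using wA A_D(5)[OF uA] mu' T1(3)[rule_format, OF t(3,1)] A_D(4)[OF uA] by (rule A_I)
  \<comment> \<open>The keys are compared at points far along both rays, where all blocks infinite
    on the face are above \<open>?z\<close>.\<close>
  moreover have "key (cut M K) c H r l (move k H ?x ?y T3) ?z = key (cut M K) c H r' l' ?w ?z"
  proof (rule key_visible[OF H(2)])
    show J: "?J \<subseteq> H" using ye by (simp add: escapes_def)
    have gap1: "1 \<le> gap M K i" for i by (simp add: gap_def)
    show "r i < r j" if "i \<in> idx ?J" "j \<in> idx H - idx ?J" for i j
      using separated_lower[OF sep gap1 c(2) xB H(1) yB ye that] .
    show "r' i < r' j" if "i \<in> idx ?J" "j \<in> idx H - idx ?J" for i j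
      using separated_lower[OF sep' gap1 c(2) x'(1) H(1) y' that] .
    show "r i = r' i \<and> l i = l' i \<and> coord c (move k H ?x ?y T3) i = coord c ?w i" if i: "i \<in> idx ?J" for i
    proof (cases i)
      case (Suc j)
      then have j: "j \<in> ?J" "j \<in> H" "j < k" using i J H(1) by auto
      then have "?y j = 0" "y' j = 0" using ye y'(2) by (auto simp: escapes_def)
      moreover have "val ?x j = val x' j" using x'(2) j unfolding pt_eq_iff by blast
      ultimately have "coord c (move k H ?x ?y T3) i = coord c ?w i" using Suc j by simp
      then show ?thesis using agree[OF i] by blast
    qed (use agree[OF i] in simp)
    show "r 0 = 0" by (rule separatedD(1)[OF sep])
    show "nmul (cut M K (l (rep H r \<kappa>))) ?z \<le> coord c (move k H ?x ?y T3) (rep H r \<kappa>)" 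
      if "\<kappa> \<in> r ` idx H" "\<kappa> \<notin> r ` idx ?J" for \<kappa> using T3(3) that by blast
    show "nmul (cut M K (l' (rep H r' \<kappa>))) ?z \<le> coord c ?w (rep H r' \<kappa>)" 
      if "\<kappa> \<in> r' ` idx H" "\<kappa> \<notin> r' ` idx ?J" for \<kappa> using T2(3) t(4) that by blast
  qed
  moreover have "key (cut M K) c H r l (move k H ?x ?y T3) ?z = w" using ray[OF T3(1,2)] by blast
  ultimately show ?thesis using t(1,2) by metis
qed

text \<open>If \<open>k\<close> is infinite on the face, everything is inherited from the socle. If
  \<open>k\<close> is finite, its value is a height over a point of a face of the socle, and
  \<open>transfer\<close> moves this height, with its key, from one piece to the other.\<close>

lemma compatible_pieces:
  assumes sep: "separated (gap M K) c H B r l" and B: "B \<subseteq> butlast ` A"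
    and sep': "separated (gap M K) c H B' r' l'" and B': "B' \<subseteq> butlast ` A"
    and P: "butlast ` piece B r l w = B" and P': "butlast ` piece B' r' l' w' = B'"
    and new: "separated M c I (piece B r l w) (new_rank k w r) (new_scale (cut M K) H k w r l)" "w div 2 \<in> r ` idx H"
    and new': "separated M c I (piece B' r' l' w') (new_rank k w' r') (new_scale (cut M K) H k w' r' l')"
    and compat: "compatible Z k H (B, r, l) (B', r', l')"
  shows "compatible Z (Suc k) I (piece B r l w, new_rank k w r, new_scale (cut M K) H k w r l)
    (piece B' r' l' w', new_rank k w' r', new_scale (cut M K) H k w' r' l')"
  unfolding compatible_def prod.case
proof (intro allI impI)
  let ?P = "piece B r l w" and ?P' = "piece B' r' l' w'"
  fix J y y'
  assume y: "y \<in> recession Z (Suc k) I ?P" and y': "y' \<in> recession Z (Suc k) I ?P'"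
    and ye: "escapes y I J" and ye': "escapes y' I J" 
    and "\<exists>a\<in>?P. \<exists>a'\<in>?P'. pt (Suc k) J (val a) = pt (Suc k) J (val a')"
  then obtain a a' where a: "a \<in> ?P" "a' \<in> ?P'" "pt (Suc k) J (val a) = pt (Suc k) J (val a')" by blast
  let ?J = "J - {k}"
  have JI: "J \<subseteq> I" using ye by (simp add: escapes_def)
  have sub: "?P \<subseteq> A" "?P' \<subseteq> A" by (auto simp: piece_def)
  have PF: "?P \<subseteq> FI Z (Suc k) I" "?P' \<subseteq> FI Z (Suc k) I" using sub A_FI by blast+
  have yB: "y(k := 0) \<in> recession Z k H B" "y'(k := 0) \<in> recession Z k H B'"
    using recession_butlast[OF y PF(1)] recession_butlast[OF y' PF(2)] P P' by simp_all
  note yBe = escapes_butlast[OF ye, of k] escapes_butlast[OF ye', of k]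
  have pt_butlast: "pt k ?J (val u) = pt k ?J (val (butlast u))" if "u \<in> A" for u
    using A_D(1)[OF that] by (intro pt_cong) (simp add: val_butlast)
  have aa: "pt k ?J (val (butlast a)) = pt k ?J (val (butlast a'))" 
    using a(3) pt_butlast a(1,2) sub unfolding pt_Suc by (metis append1_eq_conv subsetD)
  have aB: "butlast a \<in> B" "butlast a' \<in> B'" using a(1,2) by (auto simp: piece_def)
  note base = compatibleD[OF compat yB yBe aB aa]
  have lower: "new_rank k w r i < new_rank k w r j" if "i \<in> idx J" "j \<in> idx I - idx J" for i j
    using separated_lower[OF new(1) M(2) c(2) a(1) I y ye that] .
  have lower': "new_rank k w' r' i < new_rank k w' r' j" if "i \<in> idx J" "j \<in> idx I - idx J" for i j
    using separated_lower[OF new' M(2) c(2) a(2) I y' ye' that] .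
  show "(\<forall>x\<in>?P. \<exists>x'\<in>?P'. pt (Suc k) J (val x) = pt (Suc k) J (val x')) \<and> 
    (\<forall>i\<in>idx J. new_rank k w r i = new_rank k w' r' i \<and> 
      new_scale (cut M K) H k w r l i = new_scale (cut M K) H k w' r' l' i)"
  proof (cases "k \<in> J")
    case False
    then have J: "?J = J" by simp
    have agree: "new_rank k w r i = new_rank k w' r' i \<and> 
      new_scale (cut M K) H k w r l i = new_scale (cut M K) H k w' r' l' i" if i: "i \<in> idx J" for i
    proof -
      have ik: "i \<noteq> Suc k" using i False by auto
      have kJ: "Suc k \<in> idx I - idx J" using k False by simp
      have "new_rank k w r i < w" "new_rank k w' r' i < w'" 
        using lower[OF i kJ] lower'[OF i kJ] by (simp_all add: new_rank_def)
      \<comment> \<open>The last coordinate escapes, so its block is strictly above the finite ones;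
        none of these was joined, and their factors are unchanged.\<close>
      then have "2 * r i \<noteq> w" "2 * r' i \<noteq> w'" using ik by (auto simp: new_rank_def)
      then show ?thesis using base(2)[of i] i J ik by (simp add: new_rank_def new_scale_def)
    qed
    have "\<exists>x'\<in>?P'. pt (Suc k) J (val u) = pt (Suc k) J (val x')" if u: "u \<in> ?P" for u
    proof -
      have "butlast u \<in> B" using u by (simp add: piece_def)
      then obtain v where v: "v \<in> B'" "pt k ?J (val (butlast u)) = pt k ?J (val v)" using base(1) by blast
      have "v \<in> butlast ` ?P'" using v(1) P' by simp
      then obtain u' where u': "v = butlast u'" "u' \<in> ?P'" by (rule imageE)
      have "u \<in> A" "u' \<in> A" using u u'(2) sub by blast+
      then have "pt k ?J (val u) = pt k ?J (val u')" using v(2) u'(1) pt_butlast by simp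
      then have "pt (Suc k) J (val u) = pt (Suc k) J (val u')" using False by (simp add: pt_Suc)
      then show ?thesis using u'(2) by blast
    qed
    then show ?thesis using agree by blast
  next
    case True
    have val_k: "val u k = val u' k" if "pt (Suc k) J (val u) = pt (Suc k) J (val u')" for u u' :: "'a ext list"
      using that True unfolding pt_eq_iff by blast
    have agree: "\<And>i. i \<in> idx ?J \<Longrightarrow> r i = r' i \<and> l i = l' i" using base(2) .
    note tr = transfer[OF sep B sep' B' P _ y ye True yB(2) yBe(2) _ _ agree]
    have yk: "y' k = 0" using ye' True k by (auto simp: escapes_def)
    \<comment> \<open>The height of \<open>a\<close> is also that of \<open>a'\<close>. By
      \<open>transfer\<close> it has key \<open>w\<close> at a point of a ray on which the piece
      over \<open>B'\<close> prescribes the key \<open>w'\<close>.\<close>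
    have ww: "w = w'"
    proof -
      obtain t where t: "t \<in> Z" "0 \<le> t" 
        "key (cut M K) c H r' l' (move k H (butlast a') (y'(k := 0)) t) (val a k) = w"
        using tr[OF a(1) aB(2) aa] by blast
      let ?v = "move (Suc k) I a' y' t"
      have v: "?v \<in> ?P'" using recessionD(2)[OF y' a(2) t(1,2)] .
      have "a' \<in> A" using a(2) sub by blast
      then have 1: "butlast ?v = move k H (butlast a') (y'(k := 0)) t" using A_D(1) by (intro butlast_move)
      have 2: "val ?v k = val a k" using k yk val_k[OF a(3)] by simp
      have "key (cut M K) c H r' l' (butlast ?v) (val ?v k) = w'" using v by (simp add: piece_def)
      then show ?thesis using t(3) unfolding 1 2 by simp
    qed
    have "\<exists>x'\<in>?P'. pt (Suc k) J (val u) = pt (Suc k) J (val x')" if u: "u \<in> ?P" for u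
    proof -
      have uB: "butlast u \<in> B" using u by (simp add: piece_def)
      then obtain v where v: "v \<in> B'" "pt k ?J (val (butlast u)) = pt k ?J (val v)" using base(1) by blast
      obtain t where t: "t \<in> Z" "0 \<le> t" "move k H v (y'(k := 0)) t @ [Fin (val u k)] \<in> A"
        "key (cut M K) c H r' l' (move k H v (y'(k := 0)) t) (val u k) = w"
        using tr[OF u v] by blast
      let ?x = "move k H v (y'(k := 0)) t"
      have xB: "?x \<in> B'" using recessionD(2)[OF yB(2) v(1) t(1,2)] .
      have len: "length ?x = k" by (simp add: move_def)
      have vk: "val (?x @ [Fin (val u k)]) k = val u k" using len by simp
      have in_P': "?x @ [Fin (val u k)] \<in> ?P'"
        unfolding piece_def mem_Collect_eq vk butlast_snoc using t(3,4) xB ww by blast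
      have uA: "u \<in> A" using u sub by blast
      have J: "?J \<subseteq> H" using JI by blast
      have "pt k ?J (val v) = pt k ?J (val ?x)"
      proof (rule pt_cong)
        fix i assume i: "i < k" "i \<in> ?J"
        then have "(y'(k := 0)) i = 0" "i \<in> H" using yBe(2) J by (auto simp: escapes_def)
        then show "val v i = val ?x i" using i(1) by simp
      qed
      moreover have "pt k ?J (val (?x @ [Fin (val u k)])) = pt k ?J (val ?x)"
        using len by (intro pt_cong) simp
      ultimately have "pt k ?J (val u) = pt k ?J (val (?x @ [Fin (val u k)]))" 
        using v(2) pt_butlast[OF uA] by simp
      then have "pt (Suc k) J (val u) = pt (Suc k) J (val (?x @ [Fin (val u k)]))" 
        unfolding pt_Suc vk by simp
      then show ?thesis using in_P' by blast
    qed
    moreover have "new_rank k w r i = new_rank k w' r' i \<and> 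
      new_scale (cut M K) H k w r l i = new_scale (cut M K) H k w' r' l' i" if i: "i \<in> idx J" for i
    proof (cases "i = Suc k")
      case False
      then have "i \<in> idx ?J" using i by (auto simp: idx_def)
      then show ?thesis using agree[of i] ww False by (simp add: new_rank_def new_scale_def)
    next
      case ik: True
      show ?thesis
      proof (cases "even w")
        case ev: True
        \<comment> \<open>The factor of \<open>k\<close> comes from the joined block. This block
          contains a finite coordinate, so it is visible on the face, and both pieces choose the
          same representative.\<close>
        define \<kappa> where "\<kappa> = w div 2"
        have \<kappa>w: "w = 2 * \<kappa>" using ev by (simp add: \<kappa>_def)
        have "\<kappa> \<in> r ` idx H" using new(2) by (simp add: \<kappa>_def)
        then obtain i0 where i0: "i0 \<in> idx H" "r i0 = \<kappa>" by blast
        have i0k: "i0 \<noteq> Suc k" "i0 \<in> idx I" using i0(1) by (auto simp: idx_def)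
        have "i0 \<in> idx J"
        proof (rule ccontr)
          assume "i0 \<notin> idx J"
          then have "new_rank k w r (Suc k) < new_rank k w r i0" using lower i0k(2) True by simp
          then show False using i0(2) i0k(1) \<kappa>w by (simp add: new_rank_def)
        qed
        then have "i0 \<in> idx ?J" using i0k(1) by (auto simp: idx_def)
        then have \<kappa>J: "\<kappa> \<in> r ` idx ?J" "\<kappa> \<in> r' ` idx ?J" using i0(2) agree[of i0] by force+
        have JH: "?J \<subseteq> H" using JI by blast
        have gap1: "1 \<le> gap M K i" for i by (simp add: gap_def)
        have low: "r i < r j" if "i \<in> idx ?J" "j \<in> idx H - idx ?J" for i j
          using separated_lower[OF sep gap1 c(2) aB(1) H(1) yB(1) yBe(1) that] .
        have low': "r' i < r' j" if "i \<in> idx ?J" "j \<in> idx H - idx ?J" for i j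
          using separated_lower[OF sep' gap1 c(2) aB(2) H(1) yB(2) yBe(2) that] .
        have "rep H r \<kappa> = rep ?J r \<kappa>" "rep ?J r \<kappa> \<in> idx ?J" using rep_visible[OF JH low \<kappa>J(1)] by auto
        moreover have "rep H r' \<kappa> = rep ?J r' \<kappa>" using rep_visible(1)[OF JH low' \<kappa>J(2)] .
        moreover have "rep ?J r \<kappa> = rep ?J r' \<kappa>" using agree by (intro rep_agree) blast
        ultimately have "rep H r \<kappa> = rep H r' \<kappa>" "l (rep H r \<kappa>) = l' (rep H r \<kappa>)" using agree by auto
        then show ?thesis using ik ww by (simp add: new_rank_def new_scale_def \<kappa>_def)
      next
        case False
        then show ?thesis using ik ww by (simp add: new_rank_def new_scale_def)
      qed
    qed
    ultimately show ?thesis by blast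
  qed
qed

end

section \<open>Existence of decompositions\<close>

lemma decompositionD:
  assumes "decomposition Z e m N I A M c C"
  shows "finite C" "(B, r, l) \<in> C \<Longrightarrow> precell_rec Z e m N I B \<and> separated M c I B r l"
    "T \<in> C \<Longrightarrow> T' \<in> C \<Longrightarrow> T \<noteq> T' \<Longrightarrow> fst T \<inter> fst T' = {}" "(\<Union>T\<in>C. fst T) = A"
    "T \<in> C \<Longrightarrow> T' \<in> C \<Longrightarrow> compatible Z m I T T'"
  using assms unfolding decomposition_def by blast+

context zgroup_hull
begin

text \<open>Appending \<open>PInf\<close> changes neither the truncated coordinates indexed by
  \<open>I\<close> nor the recession vectors, so ranks and factors are kept.\<close>

lemma decomposition_PInf:
  assumes dec: "decomposition Z e k (butlast N) I B M c C" and k: "k \<notin> I" and I: "I \<subseteq> {..<k}" 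
    and N: "length N = Suc k" "1 \<le> last N" 
  shows "decomposition Z e (Suc k) N I ((\<lambda>x. x @ [PInf]) ` B) M c ((\<lambda>(B, r, l). ((\<lambda>x. x @ [PInf]) ` B, r, l)) ` C)"
proof -
  let ?s = "\<lambda>x :: 'a ext list. x @ [PInf]"
  let ?\<phi> = "\<lambda>(B :: 'a ext list set, r :: nat \<Rightarrow> nat, l :: nat \<Rightarrow> nat). (?s ` B, r, l)"
  note C = decompositionD[OF dec]
  have fst: "fst (?\<phi> T) = ?s ` fst T" for T by (cases T) simp
  have len: "length x = k" if "(B, r, l) \<in> C" "x \<in> B" for B r l x
    using C(2)[OF that(1)] precell_rec_FI that(2) FI_length by blast
  have coord: "coord c (?s x) i = coord c x i" if "length x = k" "i \<in> idx I" for x i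
    using that I by (cases i) auto
  have pt: "pt (Suc k) J (val (?s x)) = pt k J (val x) @ [PInf]" if "length x = k" "J \<subseteq> I" for x J
  proof -
    have "k \<notin> J" using that(2) k by blast
    then show ?thesis using that(1) by (auto simp: pt_Suc intro!: pt_cong)
  qed
  have bl: "butlast ` ?s ` B = B" for B :: "'a ext list set" by (simp add: image_image)
  have Ik: "I - {k} = I" using k by simp
  have rec: "y \<in> recession Z k I B" if y: "y \<in> recession Z (Suc k) I (?s ` B)" and B: "(B, r, l) \<in> C" for y B r l
  proof -
    have "precell_rec Z e (Suc k) N I (?s ` B)" using C(2)[OF B] precell_rec_PInfI[OF _ k N] by blast
    then have F: "?s ` B \<subseteq> FI Z (Suc k) I" by (rule precell_rec_FI)
    have "y k = 0" using recessionD(1)[OF y k] .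
    then have "y(k := 0) = y" by auto
    then show ?thesis using recession_butlast[OF y F] unfolding bl Ik by simp
  qed
  show ?thesis
    unfolding decomposition_def
  proof (intro conjI ballI impI)
    show "finite (?\<phi> ` C)" using C(1) by simp
    fix T' assume "T' \<in> ?\<phi> ` C"
    then obtain B r l where T: "(B, r, l) \<in> C" "T' = (?s ` B, r, l)" by auto
    have pre: "precell_rec Z e (Suc k) N I (?s ` B)" using C(2)[OF T(1)] precell_rec_PInfI[OF _ k N] by blast
    have sep: "separated M c I B r l" using C(2)[OF T(1)] by blast
    have "separated M c I (?s ` B) r l" 
      unfolding separated_def
    proof (intro conjI ballI)
      fix a i j assume a: "a \<in> ?s ` B" and ij: "i \<in> idx I" "j \<in> idx I"
      obtain x where x: "a = ?s x" "x \<in> B" using a by (rule imageE)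
      have eq: "coord c a i = coord c x i" "coord c a j = coord c x j" 
        unfolding x(1) by (rule coord[OF len[OF T(1) x(2)] ij(1)], rule coord[OF len[OF T(1) x(2)] ij(2)])
      show "r i = r j \<longrightarrow> coord c a i \<le> nmul (l i) (coord c a j)" 
        "r i < r j \<longrightarrow> nmul (M (max (l i) (l j))) (coord c a i) \<le> coord c a j"
        unfolding eq using separatedD(4,5)[OF sep x(2) ij] by blast+
    qed (use separatedD(1-3)[OF sep] in blast)+
    then show "case T' of (B, r, l) \<Rightarrow> precell_rec Z e (Suc k) N I B \<and> separated M c I B r l" using pre T(2) by simp
  next
    fix T1 T2 assume "T1 \<in> ?\<phi> ` C" "T2 \<in> ?\<phi> ` C" and ne: "T1 \<noteq> T2"
    then obtain S1 S2 where S: "S1 \<in> C" "S2 \<in> C" "T1 = ?\<phi> S1" "T2 = ?\<phi> S2" by blast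
    then have "S1 \<noteq> S2" using ne by blast
    then have "fst S1 \<inter> fst S2 = {}" using C(3) S by blast
    then show "fst T1 \<inter> fst T2 = {}" unfolding S(3,4) fst by auto
  next
    have "(\<Union>T\<in>?\<phi> ` C. fst T) = (\<Union>T\<in>C. ?s ` fst T)" using fst by simp
    then show "(\<Union>T\<in>?\<phi> ` C. fst T) = ?s ` B" unfolding C(4)[symmetric] image_UN .
  next
    fix T1 T2 assume "T1 \<in> ?\<phi> ` C" "T2 \<in> ?\<phi> ` C"
    then obtain B r l B' r' l' where S: "(B, r, l) \<in> C" "T1 = (?s ` B, r, l)" "(B', r', l') \<in> C" "T2 = (?s ` B', r', l')" 
      by auto
    show "compatible Z (Suc k) I T1 T2"
      unfolding S(2,4) compatible_def prod.case
    proof (intro allI impI)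
      fix J y y'
      assume y: "y \<in> recession Z (Suc k) I (?s ` B)" and y': "y' \<in> recession Z (Suc k) I (?s ` B')"
        and ye: "escapes y I J" and ye': "escapes y' I J" 
        and "\<exists>a\<in>?s ` B. \<exists>a'\<in>?s ` B'. pt (Suc k) J (val a) = pt (Suc k) J (val a')"
      then obtain x x' where x: "x \<in> B" "x' \<in> B'" "pt (Suc k) J (val (?s x)) = pt (Suc k) J (val (?s x'))" by blast
      have J: "J \<subseteq> I" using ye by (simp add: escapes_def)
      have "pt k J (val x) = pt k J (val x')" 
        using x(3) pt[OF len[OF S(1) x(1)] J] pt[OF len[OF S(3) x(2)] J] by simp
      note base = compatibleD[OF C(5)[OF S(1,3)] rec[OF y S(1)] rec[OF y' S(3)] ye ye' x(1,2) this]
      have "\<exists>a'\<in>?s ` B'. pt (Suc k) J (val a) = pt (Suc k) J (val a')" if a: "a \<in> ?s ` B" for a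
      proof -
        obtain u where u: "a = ?s u" "u \<in> B" using a by (rule imageE)
        obtain u' where u': "u' \<in> B'" "pt k J (val u) = pt k J (val u')" using base(1)[OF u(2)] by blast
        have "pt (Suc k) J (val a) = pt (Suc k) J (val (?s u'))"
          unfolding u(1) using u'(2) pt[OF len[OF S(1) u(2)] J] pt[OF len[OF S(3) u'(1)] J] by simp
        then show ?thesis using u'(1) by blast
      qed
      then show "(\<forall>a\<in>?s ` B. \<exists>a'\<in>?s ` B'. pt (Suc k) J (val a) = pt (Suc k) J (val a')) \<and> (\<forall>i\<in>idx J. r i = r' i \<and> l i = l' i)"
        using base(2) by blast
    qed
  qed
qed

end

context fibration
begin

lemma decomposition_fibration:
  assumes dec: "decomposition Z e k (butlast N) H (butlast ` A) (gap M K) c C"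
    and mu_tame: "tame K H c (butlast ` A) (\<lambda>x. b + lin \<alpha> H x)"
    and nu_tame: "(\<forall>x\<in>butlast ` A. \<nu> x = PInf) \<or> 
      (\<exists>b' \<beta>. (\<forall>x\<in>butlast ` A. \<nu> x = Fin (b' + lin \<beta> H x)) \<and> tame K H c (butlast ` A) (\<lambda>x. b' + lin \<beta> H x))"
    and N: "length N = Suc k" "last N = n" and \<rho>: "\<rho> < n"
  shows "\<exists>C. decomposition Z e (Suc k) N I A M c C"
proof -
  note C = decompositionD[OF dec]
  define refine where "refine = (\<lambda>((B, r, l), w). (piece B r l w, new_rank k w r, new_scale (cut M K) H k w r l))"
  \<comment> \<open>Empty slices are discarded, as precells are nonempty. The index set is finite
    because each rank admits only two keys.\<close>
  define X where "X = {((B, r, l), w) | B r l w. (B, r, l) \<in> C \<and> piece B r l w \<noteq> {}}"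
  have sub: "B \<subseteq> butlast ` A" if "(B, r, l) \<in> C" for B r l
    using UN_upper[OF that, of fst] unfolding C(4) by simp
  have good: "precell_rec Z e (Suc k) N I (piece B r l w)" "butlast ` piece B r l w = B"
    "separated M c I (piece B r l w) (new_rank k w r) (new_scale (cut M K) H k w r l)" "w div 2 \<in> r ` idx H"
    "separated (gap M K) c H B r l" "B \<subseteq> butlast ` A"
    if BC: "(B, r, l) \<in> C" and ne: "piece B r l w \<noteq> {}" for B r l w
  proof -
    have 1: "precell_rec Z e k (butlast N) H B" "separated (gap M K) c H B r l" using C(2)[OF BC] by auto
    show "precell_rec Z e (Suc k) N I (piece B r l w)" "butlast ` piece B r l w = B"
      "separated M c I (piece B r l w) (new_rank k w r) (new_scale (cut M K) H k w r l)" "w div 2 \<in> r ` idx H"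
      by (rule piece_good[OF 1(2) sub[OF BC] mu_tame nu_tame N \<rho> 1(1) ne])+
    show "separated (gap M K) c H B r l" "B \<subseteq> butlast ` A" by (rule 1(2), rule sub[OF BC])
  qed
  have finX: "finite X"
  proof (rule finite_subset)
    let ?W = "\<Union>(B, r, l)\<in>C. (\<lambda>\<kappa>. 2 * \<kappa>) ` r ` idx H \<union> (\<lambda>\<kappa>. 2 * \<kappa> + 1) ` r ` idx H"
    have "finite (idx H)" using H(2) by (simp add: idx_def)
    then have "finite ?W" using C(1) by (intro finite_UN_I) (auto split: prod.splits)
    then show "finite (C \<times> ?W)" using C(1) by (rule finite_cartesian_product[rotated])
    show "X \<subseteq> C \<times> ?W"
    proof
      fix q assume "q \<in> X"
      then obtain B r l w where q: "q = ((B, r, l), w)" "(B, r, l) \<in> C" "piece B r l w \<noteq> {}" unfolding X_def by blast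
      have "w div 2 \<in> r ` idx H" using good(4)[OF q(2,3)] .
      moreover have "w = 2 * (w div 2) \<or> w = 2 * (w div 2) + 1" by presburger
      ultimately have "w \<in> (\<lambda>\<kappa>. 2 * \<kappa>) ` r ` idx H \<union> (\<lambda>\<kappa>. 2 * \<kappa> + 1) ` r ` idx H" by (metis UnI1 UnI2 imageI)
      then have "w \<in> ?W" using q(2) by (intro UN_I[of "(B, r, l)"]) simp_all
      then show "q \<in> C \<times> ?W" using q(1,2) by simp
    qed
  qed
  have "decomposition Z e (Suc k) N I A M c (refine ` X)"
    unfolding decomposition_def
  proof (intro conjI ballI impI)
    show "finite (refine ` X)" using finX by simp
    fix T' assume "T' \<in> refine ` X"
    then obtain B r l w where "T' = refine ((B, r, l), w)" "(B, r, l) \<in> C" "piece B r l w \<noteq> {}" unfolding X_def by blast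
    then show "case T' of (B, r, l) \<Rightarrow> precell_rec Z e (Suc k) N I B \<and> separated M c I B r l"
      using good by (simp add: refine_def)
  next
    fix T1 T2 assume "T1 \<in> refine ` X" "T2 \<in> refine ` X" and ne: "T1 \<noteq> T2"
    then obtain B r l w B' r' l' w' where T: "T1 = refine ((B, r, l), w)" "(B, r, l) \<in> C" 
      "T2 = refine ((B', r', l'), w')" "(B', r', l') \<in> C" unfolding X_def by blast
    have "piece B r l w \<inter> piece B' r' l' w' = {}"
    proof (cases "(B, r, l) = (B', r', l')")
      case True
      then have "w \<noteq> w'" using ne T by auto
      then show ?thesis using True by (auto simp: piece_def)
    next
      case False
      then have "B \<inter> B' = {}" using C(3)[OF T(2,4)] by simp
      then show ?thesis by (auto simp: piece_def)
    qed
    then show "fst T1 \<inter> fst T2 = {}" using T(1,3) by (simp add: refine_def)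
  next
    show "(\<Union>T\<in>refine ` X. fst T) = A"
    proof (intro equalityI subsetI)
      fix a assume "a \<in> (\<Union>T\<in>refine ` X. fst T)"
      then show "a \<in> A" by (auto simp: X_def refine_def piece_def)
    next
      fix a assume a: "a \<in> A"
      then have "butlast a \<in> (\<Union>T\<in>C. fst T)" unfolding C(4) by (rule imageI)
      then obtain T where T: "T \<in> C" "butlast a \<in> fst T" by (rule UN_E)
      obtain B r l where Brl: "T = (B, r, l)" by (cases T)
      let ?w = "key (cut M K) c H r l (butlast a) (val a k)"
      have aP: "a \<in> piece B r l ?w" using a T(2) Brl by (simp add: piece_def)
      then have "((B, r, l), ?w) \<in> X" unfolding X_def using T(1) Brl by blast
      then have "refine ((B, r, l), ?w) \<in> refine ` X" by (rule imageI)
      moreover have "a \<in> fst (refine ((B, r, l), ?w))" using aP by (simp add: refine_def)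
      ultimately show "a \<in> (\<Union>T\<in>refine ` X. fst T)" by (rule UN_I)
    qed
  next
    fix T1 T2 assume "T1 \<in> refine ` X" "T2 \<in> refine ` X"
    then obtain B r l w B' r' l' w' where T: "T1 = refine ((B, r, l), w)" "(B, r, l) \<in> C" "piece B r l w \<noteq> {}"
      "T2 = refine ((B', r', l'), w')" "(B', r', l') \<in> C" "piece B' r' l' w' \<noteq> {}" unfolding X_def by blast
    show "compatible Z (Suc k) I T1 T2"
      unfolding T(1,4) refine_def prod.case
      by (rule compatible_pieces[OF good(5,6)[OF T(2,3)] good(5,6)[OF T(5,6)] good(2)[OF T(2,3)] good(2)[OF T(5,6)]
          good(3,4)[OF T(2,3)] good(3)[OF T(5,6)] C(5)[OF T(2,5)]])
  qed
  then show ?thesis by blast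
qed

end

context zgroup_hull
begin

lemma gap_mono: 
  assumes "mono M" shows "mono (gap M K)"
proof (rule monoI)
  fix i j :: nat assume ij: "i \<le> j"
  have cut: "cut M K i \<le> cut M K j"
    unfolding cut_def using ij monoD[OF assms ij] by (intro mult_le_mono add_le_mono) auto
  have "M (i * cut M K i) \<le> M (j * cut M K j)" using mult_le_mono[OF ij cut] by (rule monoD[OF assms])
  then show "gap M K i \<le> gap M K j"
    unfolding gap_def using ij cut by (intro add_le_mono mult_le_mono) auto
qed

lemma tame_affine:
  assumes "precell_rec Z e m N I A" "\<forall>i<length N. 1 \<le> N ! i" 
    "\<forall>x\<in>A. 0 \<le> b + lin \<alpha> I x" "largely_continuous m A (\<lambda>x. Fin (b + lin \<alpha> I x))"
  shows "\<exists>K\<ge>1. \<exists>c0\<ge>0. \<forall>c\<ge>c0. tame K I c A (\<lambda>x. b + lin \<alpha> I x)"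
  using comparison[OF assms] unfolding tame_def idx_def by meson

text \<open>The order of quantifiers is essential: the step applies the induction hypothesis to
  \<open>gap M K\<close> with the same \<open>c\<close>, so the threshold \<open>c0\<close> must not
  depend on \<open>M\<close>. This is possible because \<open>K\<close> and the thresholds from
  \<open>comparison\<close> come from the bounds alone.\<close>

lemma exists_decomposition:
  assumes "precell_rec Z e m N I A" "\<forall>i<length N. 1 \<le> N ! i"
  shows "\<exists>c0. \<forall>c\<in>Z. c0 \<le> c \<longrightarrow> (\<forall>M. mono M \<longrightarrow> (\<forall>i. 1 \<le> M i) \<longrightarrow> (\<exists>C. decomposition Z e m N I A M c C))"
  using assms
proof (induction m arbitrary: N I A)
  case 0
  then have A: "A = {[]}" "I = {}" by auto
  have "separated M c {} {[]} (\<lambda>_. 0) (\<lambda>_. 1)" for M and c :: 'a by (simp add: separated_def idx_def)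
  then have "decomposition Z e 0 N I A M c {({[]}, \<lambda>_. 0, \<lambda>_. 1)}" for M c
    using 0(1) A by (simp add: decomposition_def compatible_def)
  then show ?case by blast
next
  case (Suc k)
  note pre = Suc.prems(1)
  have len: "length N = Suc k" using precell_rec_length[OF pre] .
  have N: "\<forall>i<length (butlast N). 1 \<le> butlast N ! i" using Suc.prems(2) len by (simp add: nth_butlast)
  have "last N = N ! k" using len by (cases N rule: rev_cases) auto
  then have n: "1 \<le> last N" using Suc.prems(2) len by simp
  show ?case
  proof (cases "k \<in> I")
    case False
    note pre' = precell_rec_PInfE[OF pre False]
    note IH = Suc.IH[OF pre'(1) N]
    have "\<exists>C. decomposition Z e (Suc k) N I A M c C" if "decomposition Z e k (butlast N) I (butlast ` A) M c C" for M c C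
      using decomposition_PInf[OF that False precell_rec_subset[OF pre'(1)] len n] pre'(2) by metis
    then show ?thesis using IH by meson
  next
    case True
    let ?H = "I - {k}" and ?B = "butlast ` A"
    obtain b \<alpha> \<nu> \<rho> where pre': "precell_rec Z e k (butlast N) ?H ?B"
      and mu: "\<forall>x\<in>?B. 0 \<le> b + lin \<alpha> ?H x" "largely_continuous k ?B (\<lambda>x. Fin (b + lin \<alpha> ?H x))"
      and nu: "affine_map ?H ?B \<nu>" "nonneg_map ?B \<nu>" "largely_continuous k ?B \<nu>" and \<rho>: "\<rho> < last N"
      and A: "A = fibred Z e k I (last N) \<rho> ?B b \<alpha> \<nu>"
      by (rule precell_rec_fibredE[OF pre True])
    obtain c0 where c0: "\<forall>c\<in>Z. c0 \<le> c \<longrightarrow> (\<forall>M. mono M \<longrightarrow> (\<forall>i. 1 \<le> M i) \<longrightarrow> (\<exists>C. decomposition Z e k (butlast N) ?H ?B M c C))"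
      using Suc.IH[OF pre' N] by blast
    obtain K1 c1 where K1: "1 \<le> K1" "0 \<le> c1" "\<forall>c\<ge>c1. tame K1 ?H c ?B (\<lambda>x. b + lin \<alpha> ?H x)"
      using tame_affine[OF pre' N mu] by blast
    \<comment> \<open>For \<open>\<nu>\<close> constantly \<open>PInf\<close> any two constants
      serve.\<close>
    have "\<exists>K2 c2. \<forall>c\<ge>c2. (\<forall>x\<in>?B. \<nu> x = PInf) \<or> 
      (\<exists>b' \<beta>. (\<forall>x\<in>?B. \<nu> x = Fin (b' + lin \<beta> ?H x)) \<and> tame K2 ?H c ?B (\<lambda>x. b' + lin \<beta> ?H x))"
      using nu(1) unfolding affine_map_iff
    proof
      assume "\<exists>b' \<beta>. \<forall>x\<in>?B. \<nu> x = Fin (b' + lin \<beta> ?H x)"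
      then obtain b' \<beta> where nu': "\<forall>x\<in>?B. \<nu> x = Fin (b' + lin \<beta> ?H x)" by blast
      have "\<forall>x\<in>?B. 0 \<le> b' + lin \<beta> ?H x"
      proof
        fix x assume x: "x \<in> ?B"
        have "ext_le (Fin 0) (\<nu> x)" using nu(2) x unfolding nonneg_map_def by (rule bspec)
        then show "0 \<le> b' + lin \<beta> ?H x" using bspec[OF nu' x] by simp
      qed
      moreover have "largely_continuous k ?B (\<lambda>x. Fin (b' + lin \<beta> ?H x))"
        using nu(3) bspec[OF nu'] by (rule largely_continuous_cong)
      ultimately show ?thesis using tame_affine[OF pre' N] nu' by blast
    qed blast
    then obtain K2 c2 where K2: "\<forall>c\<ge>c2. (\<forall>x\<in>?B. \<nu> x = PInf) \<or> 
      (\<exists>b' \<beta>. (\<forall>x\<in>?B. \<nu> x = Fin (b' + lin \<beta> ?H x)) \<and> tame K2 ?H c ?B (\<lambda>x. b' + lin \<beta> ?H x))" by blast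
    define K where "K = max K1 K2"
    \<comment> \<open>The entries serve the socle, the lower bound, the upper bound, positivity of
      \<open>c\<close>, and the width needed for the residues in this coordinate.\<close>
    define d where "d = max (max c0 c1) (max c2 (max e (nmul (last N) e)))"
    have "\<exists>C. decomposition Z e (Suc k) N I A M c C" if c: "c \<in> Z" "d \<le> c" and M: "mono M" "\<forall>i. 1 \<le> M i" for c M
    proof -
      have cs: "c0 \<le> c" "c1 \<le> c" "c2 \<le> c" "e \<le> c" "nmul (last N) e \<le> c" using c(2) by (auto simp: d_def)
      have c_pos: "0 < c" using e_pos cs(4) by (rule order.strict_trans2)
      interpret fib: fibration Z e M K "last N" k \<rho> c I A b \<alpha> \<nu>
      proof unfold_locales
        show "1 \<le> K" using K1(1) by (simp add: K_def)
        show "I \<subseteq> {..<Suc k}" by (rule precell_rec_subset[OF pre])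
        show "?B \<subseteq> FI Z k ?H" by (rule precell_rec_FI[OF pre'])
        show "0 \<le> b + lin \<alpha> ?H x" if "x \<in> ?B" for x using mu(1) that by (rule bspec)
      qed (use M n c(1) c_pos cs(5) True A mu(2) nu in simp_all)
      have "\<forall>i. 1 \<le> gap M K i" by (simp add: gap_def)
      then obtain C where C: "decomposition Z e k (butlast N) ?H ?B (gap M K) c C"
        using c0 c(1) cs(1) gap_mono[OF M(1)] by blast
      have t1: "tame K ?H c ?B (\<lambda>x. b + lin \<alpha> ?H x)"
        using K1(3) cs(2) c_pos by (intro tame_mono[of K1 ?H c ?B _ K]) (auto simp: K_def)
      have t2: "(\<forall>x\<in>?B. \<nu> x = PInf) \<or> 
        (\<exists>b' \<beta>. (\<forall>x\<in>?B. \<nu> x = Fin (b' + lin \<beta> ?H x)) \<and> tame K ?H c ?B (\<lambda>x. b' + lin \<beta> ?H x))"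
      proof -
        have "tame K ?H c ?B f" if "tame K2 ?H c ?B f" for f
          using that _ order.refl less_imp_le[OF c_pos] by (rule tame_mono) (simp add: K_def)
        then show ?thesis using K2 cs(3) by meson
      qed
      show ?thesis using C t1 t2 len refl \<rho> by (rule fib.decomposition_fibration)
    qed
    then show ?thesis by blast
  qed
qed

section \<open>From decompositions to complexes of monohedral precells\<close>

lemma face_eq:
  assumes pre: "precell_rec Z e m N I B" "\<forall>i<length N. 1 \<le> N ! i" and ne: "face m J B \<noteq> {}"
  shows "\<exists>y\<in>recession Z m I B. escapes y I J" "face m J B = (\<lambda>x. pt m J (val x)) ` B"
proof -
  note B = precell_rec_FI[OF pre(1)] and I = precell_rec_subset[OF pre(1)]
  obtain b0 where "b0 \<in> clos m B" "supp b0 = J" using ne unfolding face_def by blast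
  then show ex: "\<exists>y\<in>recession Z m I B. escapes y I J" using face_escapes[OF pre] by blast
  then obtain y where y: "y \<in> recession Z m I B" "escapes y I J" by blast
  have J: "J \<subseteq> {..<m}" using y(2) I by (auto simp: escapes_def)
  show "face m J B = (\<lambda>x. pt m J (val x)) ` B"
  proof (intro equalityI subsetI)
    fix b assume "b \<in> face m J B"
    then have "b \<in> clos m B" "supp b = J" by (auto simp: face_def)
    \<comment> \<open>By discreteness a sufficiently close point of \<open>B\<close> already
      projects to \<open>b\<close>, so the face is a projection and not just the closure of
      one.\<close>
    then show "b \<in> (\<lambda>x. pt m J (val x)) ` B" using clos_approx(2)[OF B] by blast
  next
    fix b assume "b \<in> (\<lambda>x. pt m J (val x)) ` B"
    then obtain x where x: "b = pt m J (val x)" "x \<in> B" by (rule imageE)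
    have "\<forall>t\<in>Z. 0 \<le> t \<longrightarrow> move m I x y t \<in> B" using recessionD(2)[OF y(1) x(2)] by blast
    then have "b \<in> clos m B" unfolding x(1) by (rule ray_limit_in_clos[OF y(2) I])
    moreover have "supp b = J" unfolding x(1) using J by (rule supp_pt)
    ultimately show "b \<in> face m J B" by (simp add: face_def)
  qed
qed

text \<open>Projecting to \<open>J\<close> a ray of \<open>B\<close> that tends to the smaller face
  gives a ray inside the larger face with the same limit.\<close>

lemma face_subset_clos:
  assumes pre: "precell_rec Z e m N I B" "\<forall>i<length N. 1 \<le> N ! i" 
    and ne: "face m J B \<noteq> {}" "face m J' B \<noteq> {}" and JJ': "J' \<subseteq> J"
  shows "face m J' B \<subseteq> clos m (face m J B)"
proof
  note I = precell_rec_subset[OF pre(1)]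
  fix b assume "b \<in> face m J' B"
  then obtain x where x: "b = pt m J' (val x)" "x \<in> B" unfolding face_eq(2)[OF pre ne(2)] by (rule imageE)
  obtain y where y: "y \<in> recession Z m I B" "escapes y I J'" using face_eq(1)[OF pre ne(2)] by blast
  have J: "J \<subseteq> I" using face_eq(1)[OF pre ne(1)] by (auto simp: escapes_def)
  have Jm: "J \<subseteq> {..<m}" using J I by (rule order.trans)
  have ye: "escapes y J J'" using y(2) J JJ' by (auto simp: escapes_def)
  have "move m J x y t \<in> face m J B" if "t \<in> Z" "0 \<le> t" for t
  proof -
    have "move m J x y t = pt m J (val (move m I x y t))"
      unfolding move_def[of m J] using J by (intro pt_cong) (simp add: subsetD)
    moreover have "move m I x y t \<in> B" using recessionD(2)[OF y(1) x(2) that] .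
    ultimately show ?thesis unfolding face_eq(2)[OF pre ne(1)] by blast
  qed
  then show "b \<in> clos m (face m J B)" unfolding x(1) using ray_limit_in_clos[OF ye Jm] by blast
qed

text \<open>Two incomparable supports would contain indices whose ranks are ordered in both ways, by
  \<open>separated_lower\<close> applied to each face. So supports form a chain, and inclusion of
  supports gives specialisation.\<close>

lemma separated_monohedral:
  assumes pre: "precell_rec Z e m N I B" "\<forall>i<length N. 1 \<le> N ! i" 
    and sep: "separated M c I B r l" "\<And>i. 1 \<le> M i" "0 < c"
  shows "monohedral m B"
  unfolding monohedral_def
proof (intro ballI)
  note I = precell_rec_subset[OF pre(1)]
  obtain x where x: "x \<in> B" using precell_rec_nonempty[OF pre(1)] by blast
  fix F F' assume "F \<in> faces m B" "F' \<in> faces m B"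
  then obtain J J' where F: "F = face m J B" "F \<noteq> {}" "F' = face m J' B" "F' \<noteq> {}" unfolding faces_def by blast
  have ne: "face m J B \<noteq> {}" "face m J' B \<noteq> {}" using F by auto
  obtain y y' where y: "y \<in> recession Z m I B" "escapes y I J" "y' \<in> recession Z m I B" "escapes y' I J'"
    using face_eq(1)[OF pre ne(1)] face_eq(1)[OF pre ne(2)] by blast
  have sub: "J \<subseteq> I" "J' \<subseteq> I" using y by (auto simp: escapes_def)
  have "J \<subseteq> J' \<or> J' \<subseteq> J"
  proof (rule ccontr)
    assume "\<not> ?thesis"
    then obtain i j where ij: "i \<in> J" "i \<notin> J'" "j \<in> J'" "j \<notin> J" by blast
    have "r (Suc i) < r (Suc j)"
      by (rule separated_lower[OF sep x I y(1,2)]) (use ij sub in auto)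
    moreover have "r (Suc j) < r (Suc i)"
      by (rule separated_lower[OF sep x I y(3,4)]) (use ij sub in auto)
    ultimately show False by simp
  qed
  then show "F \<subseteq> clos m F' \<or> F' \<subseteq> clos m F"
    unfolding F(1,3) using face_subset_clos[OF pre ne] face_subset_clos[OF pre ne(2,1)] by blast
qed

text \<open>A point common to two closures lies in the faces of both pieces with the support of that
  point; compatibility in both directions makes these two faces equal.\<close>

lemma decomposition_complex:
  assumes dec: "decomposition Z e m N I A M c C" and N: "\<forall>i<length N. 1 \<le> N ! i"
  shows "complex Z m (fst ` C)"
proof -
  note C = decompositionD(1)[OF dec] decompositionD(2)[OF dec, THEN conjunct1] decompositionD(3,5)[OF dec]
  have inter: "face m J B \<subseteq> face m J B'" if BC: "(B, r, l) \<in> C" "(B', r', l') \<in> C" and b: "b \<in> face m J B" "b \<in> face m J B'" 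
    for B r l B' r' l' J b
  proof -
    note pre = C(2)[OF BC(1)] C(2)[OF BC(2)]
    have ne: "face m J B \<noteq> {}" "face m J B' \<noteq> {}" using b by auto
    obtain y y' where y: "y \<in> recession Z m I B" "escapes y I J" "y' \<in> recession Z m I B'" "escapes y' I J"
      using face_eq(1)[OF pre(1) N ne(1)] face_eq(1)[OF pre(2) N ne(2)] by blast
    note eq = face_eq(2)[OF pre(1) N ne(1)] face_eq(2)[OF pre(2) N ne(2)]
    obtain x where x: "b = pt m J (val x)" "x \<in> B" using b(1) unfolding eq by (rule imageE)
    obtain x' where x': "b = pt m J (val x')" "x' \<in> B'" using b(2) unfolding eq by (rule imageE)
    have "pt m J (val x) = pt m J (val x')" using x(1) x'(1) by simp
    note ex = compatibleD(1)[OF C(4)[OF BC] y(1,3,2,4) x(2) x'(2) this]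
    show ?thesis
    proof
      fix v assume "v \<in> face m J B"
      then obtain u where u: "v = pt m J (val u)" "u \<in> B" unfolding eq by (rule imageE)
      then obtain u' where "u' \<in> B'" "pt m J (val u) = pt m J (val u')" using ex by blast
      then show "v \<in> face m J B'" unfolding eq u(1) by (metis imageI)
    qed
  qed
  show ?thesis
    unfolding complex_def
  proof (intro conjI ballI impI)
    show "finite (fst ` C)" using C(1) by simp
    fix B assume "B \<in> fst ` C"
    then obtain r l where "(B, r, l) \<in> C" by force
    then have "B \<subseteq> FI Z m I" using C(2) precell_rec_FI by blast
    then show "B \<subseteq> Gam Z m" by (auto simp: FI_def)
  next
    fix B B' assume "B \<in> fst ` C" "B' \<in> fst ` C" "B \<noteq> B'"
    then obtain T T' where "T \<in> C" "T' \<in> C" "B = fst T" "B' = fst T'" "T \<noteq> T'" by blast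
    then show "B \<inter> B' = {}" using C(3) by simp
  next
    fix B B' assume "B \<in> fst ` C" "B' \<in> fst ` C"
    then obtain r l r' l' where BC: "(B, r, l) \<in> C" "(B', r', l') \<in> C" by force
    show "clos m B \<inter> clos m B' = \<Union>(faces m B \<inter> faces m B')"
    proof (intro equalityI subsetI)
      fix b assume "b \<in> clos m B \<inter> clos m B'"
      then have b: "b \<in> face m (supp b) B" "b \<in> face m (supp b) B'" by (auto simp: face_def)
      have "face m (supp b) B = face m (supp b) B'" 
        using inter[OF BC b] inter[OF BC(2,1) b(2,1)] by (rule equalityI)
      then have "face m (supp b) B \<in> faces m B \<inter> faces m B'" using b unfolding faces_def by blast
      then show "b \<in> \<Union>(faces m B \<inter> faces m B')" using b(1) by (rule UnionI)
    next
      fix b assume "b \<in> \<Union>(faces m B \<inter> faces m B')"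
      then obtain F where F: "b \<in> F" "F \<in> faces m B" "F \<in> faces m B'" by blast
      have "F \<subseteq> clos m B" "F \<subseteq> clos m B'" using F(2,3) by (auto simp: faces_def face_def)
      then show "b \<in> clos m B \<inter> clos m B'" using F(1) by blast
    qed
  qed
qed

end

theorem theorem5p4:
  fixes Z :: "'a::linordered_ab_group_add set" and e :: 'a
    and N :: "nat list" and I :: "nat set" and A :: "'a ext list set"
  assumes "zgroup Z e"
    and "\<forall>i<length N. 1 \<le> N ! i"
    and "I \<subseteq> {..<length N}"
    and "A \<subseteq> FI Z (length N) I"
    and "precell Z e N I A"
  shows "\<exists>C. complex Z (length N) C \<and>
           (\<forall>B\<in>C. monohedral (length N) B \<and> (\<exists>J. precell Z e N J B)) \<and>
           \<Union>C = A"
proof -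
  interpret zgroup_hull Z e by unfold_locales (rule assms(1))
  have pre: "precell_rec Z e (length N) N I A" using assms(5) by (simp add: precell_def)
  obtain c0 where c0: "\<forall>c\<in>Z. c0 \<le> c \<longrightarrow> (\<forall>M. mono M \<longrightarrow> (\<forall>i. 1 \<le> M i) \<longrightarrow> (\<exists>C. decomposition Z e (length N) N I A M c C))"
    using exists_decomposition[OF pre assms(2)] by blast
  obtain c where c: "c \<in> Z" "max c0 e \<le> c" using cofinal by blast
  have c_pos: "0 < c" using e_pos c(2) by (auto intro: order.strict_trans2)
  \<comment> \<open>Monohedrality only needs \<open>M\<close> to be at least 1, so the constant
    function suffices at the top level; the growth is generated inside the induction.\<close>
  have M: "mono (\<lambda>_::nat. 1::nat)" by (simp add: mono_def)
  obtain C where C: "decomposition Z e (length N) N I A (\<lambda>_. 1) c C" using c0 c M by auto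
  have "monohedral (length N) B \<and> (\<exists>J. precell Z e N J B)" if BC: "B \<in> fst ` C" for B
  proof -
    obtain r l where "(B, r, l) \<in> C" using BC by force
    then have "precell_rec Z e (length N) N I B" "separated (\<lambda>_. 1) c I B r l" using decompositionD(2)[OF C] by blast+
    then show ?thesis using separated_monohedral[OF _ assms(2)] c_pos unfolding precell_def by blast
  qed
  moreover have "\<Union>(fst ` C) = A" by (rule decompositionD(4)[OF C])
  ultimately show ?thesis using decomposition_complex[OF C assms(2)] by blast
qed

end
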